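(* Let $m\in\mathbb N$ and let $f_1,\ldots,f_m$ be non-constant rational maps such that the rational semigroup $G=\langle f_1,\ldots,f_m\rangle$ is expanding. Let $\tilde f:J(\tilde f)\to J(\tilde f)$ be the associated skew product, and let $\mu$ be an $\tilde f$-invariant Borel probability measure on $J(\tilde f)$. Let $\mathcal R$ be a $\Pi$-adapted partition of $J(\tilde f)$. Then for $\mu$-a.e. $x\in J(\tilde f)$, $$\lim_{r\to0}\frac{\log\mu(B^\Pi(x,r))}{\log r}=\frac{h_\Pi(\tilde f,\mu,x)}{E_\mu(\log\|\tilde f'\|\mid\mathcal I)(x)},$$ where $$h_\Pi(\tilde f,\mu,x):=E_\mu\big(I_\mu(\mathcal R\mid\tilde f^{-1}\Pi^{-1}\gamma)-I_\mu(\mathcal R\mid\Pi^{-1}\gamma)\,\big|\,\mathcal I\big)(x).$$ If $\mu$ is ergodic, then for $\mu$-a.e. $x\in J(\tilde f)$, $$\lim_{r\to0}\frac{\log\mu(B^\Pi(x,r))}{\log r}=\frac{h_\Pi(\tilde f,\mu)}{\int_{J(\tilde f)}\log\|\tilde f'(y)\|\,d\mu(y)},$$ where $$h_\Pi(\tilde f,\mu):=H_\mu(\mathcal R\mid\tilde f^{-1}\Pi^{-1}\gamma)-H_\mu(\mathcal R\mid\Pi^{-1}\gamma).$$ In particular, if $\mu$ is ergodic, then the measure $\Pi_*\mu$ is exact dimensional.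
   Context: **Skew product and Julia sets.** $\widehat{\mathbb C}$ is the Riemann sphere with the spherical metric $d_{\widehat{\mathbb C}}$. $G=\langle f_1,\ldots,f_m\rangle$ is the semigroup generated by $f_1,\ldots,f_m$ under composition; its Julia set $J(G)$ is the set of $z\in\widehat{\mathbb C}$ such that $G$ is not normal on any neighbourhood of $z$. Let $\Sigma_m=\{1,\ldots,m\}^{\mathbb Z}$ with the shift map $\sigma:\Sigma_m\to\Sigma_m$. The skew product associated with $(f_1,\ldots,f_m)$ is $\tilde f:\Sigma_m\times\widehat{\mathbb C}\to\Sigma_m\times\widehat{\mathbb C}$, $\tilde f(\omega,z)=(\sigma\omega,f_{\omega_1}(z))$ for $\omega=(\ldots,\omega_0,\omega_1,\omega_2,\ldots)$. For $\omega\in\Sigma_m$, $J_\omega(\tilde f)$ is the set of $z\in\widehat{\mathbb C}$ such that $\{f_{\omega_n}\circ\cdots\circ f_{\omega_1}\}_{n\ge1}$ is not normal on any neighbourhood of $z$, and $J(\tilde f)=\overline{\bigcup_{\omega\in\Sigma_m}\{\omega\}\times J_\omega(\tilde f)}$ (closure in $\Sigma_m\times\widehat{\mathbb C}$). It is known that $\tilde f(J(\tilde f))=\tilde f^{-1}(J(\tilde f))=J(\tilde f)$; the restriction of $\tilde f$ to $J(\tilde f)$ is again denoted $\tilde f$. $\Pi$ is the second coordinate projection $\Sigma_m\times\widehat{\mathbb C}\to\widehat{\mathbb C}$, here restricted to $J(\tilde f)$. **Expanding.** $\|\varphi'(z)\|$ is the operator norm of the derivative of a holomorphic map $\varphi$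 at $z$ with respect to the spherical metric, and $\|(\tilde f^n)'(\omega,z)\|:=\|(f_{\omega_n}\circ\cdots\circ f_{\omega_1})'(z)\|$. $G$ is expanding if $J(G)\ne\emptyset$ and there are $C>0$, $\lambda>1$ with $\inf_{(\omega,z)\in J(\tilde f)}\|(\tilde f^n)'(\omega,z)\|\ge C\lambda^n$ for every $n\ge1$. **Entropy.** For a probability measure $\nu$, a countable measurable partition $\xi$ and a sub-$\sigma$-algebra $\mathcal A$, $I_\nu(\xi\mid\mathcal A)=-\sum_{A\in\xi}\mathbf 1_A\log E_\nu(\mathbf 1_A\mid\mathcal A)$ and $H_\nu(\xi\mid\mathcal A)=\int I_\nu(\xi\mid\mathcal A)\,d\nu$, where $E_\nu(\cdot\mid\mathcal A)$ is conditional expectation. $\mathcal B(\Delta)$ is the Borel $\sigma$-algebra of $\Delta$; $\gamma:=\mathcal B(\widehat{\mathbb C})$; $\mathcal I:=\{B\in\mathcal B(J(\tilde f)):\tilde f^{-1}B=B\}$. **$\Pi$-adapted partitions.** Let $[j]=\{\omega\in\Sigma_m:\omega_1=j\}$. A finite Borel partition $\mathcal R$ of $J(\tilde f)$ is $\Pi$-adapted if for any $R\in\mathcal R$ there exist $j\in\{1,\ldots,m\}$, a compact set $K_R\subset\widehat{\mathbb C}$ and an open set $U_R\subset\widehat{\mathbb C}$ such that $R\subset J(\tilde f)\cap([j]\times K_R)$, $K_R\subset U_R$, and $f_j$ is injective on $U_R$. Such partitions exist when $G$ is expanding. **Other notation.** $B^\Pi(x,r)=\{y\in J(\tilde f):d_{\widehat{\mathbb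 C}}(\Pi y,\Pi x)<r\}$. A Borel probability measure $\nu$ on a metric space $X$ is exact dimensional if there is a constant $D\ge0$ with $\lim_{r\to0}\log\nu(B(x,r))/\log r=D$ for $\nu$-a.e. $x\in X$, where $B(x,r)$ is the open ball. *)

theory Defs
  imports "HOL-Probability.Probability" "HOL-Computational_Algebra.Polynomial"
begin

datatype rsphere = Fin complex | Infty

primrec stereo :: "rsphere \<Rightarrow> complex \<times> real" where
  "stereo (Fin z) =
     ((2 / (1 + (cmod z)\<^sup>2)) *\<^sub>R z, ((cmod z)\<^sup>2 - 1) / (1 + (cmod z)\<^sup>2))"
| "stereo Infty = (0, 1)"

lemma one_plus_norm_sq_pos: "0 < 1 + (cmod z)\<^sup>2"
  by (smt (verit) zero_le_power2)

lemma norm_stereo [simp]: "norm (stereo x) = 1"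
proof (cases x)
  case (Fin z)
  define n where "n = (cmod z)\<^sup>2"
  have n: "1 + n > 0" using one_plus_norm_sq_pos n_def by simp
  have "(norm (stereo x))\<^sup>2 = (2 / (1 + n))\<^sup>2 * n + ((n - 1) / (1 + n))\<^sup>2"
    by (simp add: Fin norm_prod_def n_def power_mult_distrib power_divide)
  also have "\<dots> = 1"
    using n by (simp add: power_divide add_divide_distrib[symmetric] divide_eq_eq)
       (simp add: power2_eq_square algebra_simps)
  finally show ?thesis
    by (simp add: power2_eq_1_iff) (smt (verit) norm_ge_zero)
qed (simp add: norm_prod_def)

lemma stereo_inject: "stereo x = stereo y \<longleftrightarrow> x = y"
proof -
  have fin: "fst (stereo (Fin z)) /\<^sub>R (1 - snd (stereo (Fin z))) = z"
    and ne: "snd (stereo (Fin z)) \<noteq> 1" for z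
  proof -
    have p: "1 + (cmod z)\<^sup>2 \<noteq> 0" using one_plus_norm_sq_pos[of z] by simp
    have "1 - snd (stereo (Fin z)) = 2 / (1 + (cmod z)\<^sup>2)"
      using p by (simp add: field_simps)
    moreover have "fst (stereo (Fin z)) = (2 / (1 + (cmod z)\<^sup>2)) *\<^sub>R z"
      by simp
    moreover have "inverse c *\<^sub>R c *\<^sub>R z = z" if "c \<noteq> 0" for c :: real
      using that by simp
    ultimately show "fst (stereo (Fin z)) /\<^sub>R (1 - snd (stereo (Fin z))) = z"
      using p by (metis divide_eq_0_iff zero_neq_numeral)
    show "snd (stereo (Fin z)) \<noteq> 1"
      using p by (simp add: field_simps)
  qed
  show ?thesis
  proof (cases x; cases y)
    fix a b assume "x = Fin a" "y = Fin b"
    then show ?thesis using fin by metis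
  next
    fix a assume "x = Fin a" "y = Infty"
    then show ?thesis using ne[of a] by (metis rsphere.distinct(1) snd_conv stereo.simps(2))
  next
    fix b assume "x = Infty" "y = Fin b"
    then show ?thesis using ne[of b] by (metis rsphere.distinct(1) snd_conv stereo.simps(2))
  qed auto
qed

lemma inner_unit_bounds:
  fixes a b :: "'a::real_inner"
  assumes "norm a = 1" "norm b = 1"
  shows "- 1 \<le> a \<bullet> b" "a \<bullet> b \<le> 1"
  using Cauchy_Schwarz_ineq2[of a b] assms by (auto simp: abs_le_iff)

lemma inner_unit_eq_1:
  fixes a b :: "'a::real_inner"
  assumes "norm a = 1" "norm b = 1" "a \<bullet> b = 1"
  shows "a = b"
proof -
  have "(a - b) \<bullet> (a - b) = (norm a)\<^sup>2 - 2 * (a \<bullet> b) + (norm b)\<^sup>2"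
    by (simp add: power2_norm_eq_inner inner_diff inner_commute)
  then show ?thesis using assms by simp
qed

lemma arccos_inner_triangle:
  fixes a b c :: "'a::real_inner"
  assumes a: "norm a = 1" and b: "norm b = 1" and c: "norm c = 1"
  shows "arccos (a \<bullet> c) \<le> arccos (a \<bullet> b) + arccos (b \<bullet> c)"
proof -
  define p q where "p = a \<bullet> b" and "q = b \<bullet> c"
  note bd = inner_unit_bounds[OF a b] inner_unit_bounds[OF b c] inner_unit_bounds[OF a c]
  have aa: "a \<bullet> a = 1" and bb: "b \<bullet> b = 1" and cc: "c \<bullet> c = 1"
    using a b c by (simp_all flip: power2_norm_eq_inner)
  define u v where "u = a - p *\<^sub>R b" and "v = c - q *\<^sub>R b"
  have uv: "u \<bullet> v = a \<bullet> c - p * q"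
    by (simp add: u_def v_def p_def q_def inner_diff inner_commute bb)
  have uu: "u \<bullet> u = 1 - p\<^sup>2"
    by (simp add: u_def p_def inner_diff inner_commute aa bb power2_eq_square)
  have vv: "v \<bullet> v = 1 - q\<^sup>2"
    by (simp add: v_def q_def inner_diff inner_commute bb cc power2_eq_square)
  have "p * q - a \<bullet> c \<le> norm u * norm v"
    using Cauchy_Schwarz_ineq2[of u v] uv by linarith
  then have le: "p * q - sqrt (1 - p\<^sup>2) * sqrt (1 - q\<^sup>2) \<le> a \<bullet> c"
    by (simp add: norm_eq_sqrt_inner uu vv)
  show ?thesis
  proof (cases "arccos p + arccos q \<le> pi")
    case True
    have "cos (arccos p + arccos q) \<le> a \<bullet> c"
      using le bd by (simp add: cos_add sin_arccos_abs abs_le_iff p_def q_def)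
    then have "arccos (a \<bullet> c) \<le> arccos (cos (arccos p + arccos q))"
      by (intro arccos_le_arccos) (use bd in auto)
    also have "\<dots> = arccos p + arccos q"
      using True bd by (intro arccos_cos) (auto simp: p_def q_def arccos_lbound add_nonneg_nonneg)
    finally show ?thesis by (simp add: p_def q_def)
  next
    case False
    then show ?thesis using arccos_ubound[of "a \<bullet> c"] bd by (simp add: p_def q_def)
  qed
qed

text \<open>Great-circle distance on the unit sphere, i.e. the distance of the Riemannian metric
  \<open>2 |dz| / (1 + |z|\<^sup>2)\<close>.\<close>

instantiation rsphere :: metric_space
begin

definition dist_rsphere :: "rsphere \<Rightarrow> rsphere \<Rightarrow> real" where
  "dist_rsphere x y = arccos (stereo x \<bullet> stereo y)"

definition uniformity_rsphere :: "(rsphere \<times> rsphere) filter" where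
  "uniformity_rsphere = (INF e\<in>{0 <..}. principal {(x, y). dist x y < e})"

definition open_rsphere :: "rsphere set \<Rightarrow> bool" where
  "open_rsphere U \<longleftrightarrow>
     (\<forall>x\<in>U. eventually (\<lambda>(x', y). x' = x \<longrightarrow> y \<in> U) uniformity)"

instance
proof
  fix x y z :: rsphere
  show "dist x y = 0 \<longleftrightarrow> x = y"
  proof
    assume "dist x y = 0"
    then have "cos (arccos (stereo x \<bullet> stereo y)) = 1"
      by (simp add: dist_rsphere_def)
    then have "stereo x \<bullet> stereo y = 1"
      using inner_unit_bounds[of "stereo x" "stereo y"] by simp
    then show "x = y"
      using inner_unit_eq_1[of "stereo x" "stereo y"] stereo_inject by simp
  qed (simp add: dist_rsphere_def flip: power2_norm_eq_inner)
  show "dist x y \<le> dist x z + dist y z"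
    using arccos_inner_triangle[of "stereo x" "stereo z" "stereo y"]
    by (simp add: dist_rsphere_def inner_commute)
qed (simp_all add: uniformity_rsphere_def open_rsphere_def)

end

text \<open>For coprime \<open>p, q\<close> this is the map induced by \<open>p / q\<close> on the sphere. With
  \<open>d = max (degree p) (degree q)\<close>, the homogenisation of \<open>p / q\<close> sends the point at infinity
  to \<open>[coeff p d : coeff q d]\<close>.\<close>

definition rat_map :: "complex poly \<Rightarrow> complex poly \<Rightarrow> rsphere \<Rightarrow> rsphere" where
  "rat_map p q x = (case x of
      Fin z \<Rightarrow> if poly q z = 0 then Infty else Fin (poly p z / poly q z)
    | Infty \<Rightarrow> (let d = max (degree p) (degree q) in
        if coeff q d = 0 then Infty else Fin (coeff p d / coeff q d)))"

definition rational_map :: "(rsphere \<Rightarrow> rsphere) \<Rightarrow> bool" where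
  "rational_map g \<longleftrightarrow> (\<exists>p q. q \<noteq> 0 \<and> coprime p q \<and> g = rat_map p q)"

text \<open>Near \<open>x\<close> we use the holomorphic coordinate \<open>z\<close> if \<open>x\<close> is finite and \<open>1 / z\<close> if it is
  not: \<^term>\<open>coord x\<close> is the coordinate (with a junk value at the point outside its domain)
  and \<^term>\<open>param x\<close> its inverse. The spherical metric is \<open>2 |du| / (1 + |u|\<^sup>2)\<close> in either
  coordinate \<open>u\<close>.\<close>

definition coord :: "rsphere \<Rightarrow> rsphere \<Rightarrow> complex" where
  "coord x y = (case y of
      Fin z \<Rightarrow> (if x = Infty then inverse z else z)
    | Infty \<Rightarrow> 0)"

definition param :: "rsphere \<Rightarrow> complex \<Rightarrow> rsphere" where
  "param x u = (if x = Infty then (if u = 0 then Infty else Fin (inverse u)) else Fin u)"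

definition sph_norm :: "rsphere \<Rightarrow> complex \<Rightarrow> real" where
  "sph_norm x v = 2 * cmod v / (1 + (cmod (coord x x))\<^sup>2)"

definition coord_deriv :: "(rsphere \<Rightarrow> rsphere) \<Rightarrow> rsphere \<Rightarrow> complex" where
  "coord_deriv \<phi> x = deriv (coord (\<phi> x) \<circ> \<phi> \<circ> param x) (coord x x)"

definition sph_deriv_norm :: "(rsphere \<Rightarrow> rsphere) \<Rightarrow> rsphere \<Rightarrow> real" where
  "sph_deriv_norm \<phi> x = (SUP v\<in>{v. sph_norm x v = 1}. sph_norm (\<phi> x) (coord_deriv \<phi> x * v))"

lemma sph_deriv_norm_eq:
  "sph_deriv_norm \<phi> x =
     cmod (coord_deriv \<phi> x) * (1 + (cmod (coord x x))\<^sup>2) / (1 + (cmod (coord (\<phi> x) (\<phi> x)))\<^sup>2)"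
proof -
  let ?a = "1 + (cmod (coord x x))\<^sup>2" and ?b = "1 + (cmod (coord (\<phi> x) (\<phi> x)))\<^sup>2"
  let ?S = "{v. sph_norm x v = 1}"
  have a: "?a > 0" by (rule one_plus_norm_sq_pos)
  have iff: "sph_norm x v = 1 \<longleftrightarrow> cmod v = ?a / 2" for v
    using a by (auto simp: sph_norm_def field_simps)
  have "complex_of_real (?a / 2) \<in> ?S"
    using a unfolding mem_Collect_eq iff norm_of_real by simp
  then have "?S \<noteq> {}" by blast
  moreover have "sph_norm (\<phi> x) (coord_deriv \<phi> x * v) = cmod (coord_deriv \<phi> x) * ?a / ?b"
    if "v \<in> ?S" for v
  proof -
    have "cmod v = ?a / 2" using that iff by simp
    then show ?thesis by (simp add: sph_norm_def norm_mult)
  qed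
  ultimately show ?thesis
    unfolding sph_deriv_norm_def by simp
qed

definition normal_on :: "(rsphere \<Rightarrow> rsphere) set \<Rightarrow> rsphere set \<Rightarrow> bool" where
  "normal_on F U \<longleftrightarrow>
     (\<forall>g :: nat \<Rightarrow> rsphere \<Rightarrow> rsphere. range g \<subseteq> F \<longrightarrow>
        (\<exists>r h. strict_mono (r :: nat \<Rightarrow> nat) \<and>
           (\<forall>K. compact K \<and> K \<subseteq> U \<longrightarrow> uniform_limit K (g \<circ> r) h sequentially)))"

definition Julia :: "(rsphere \<Rightarrow> rsphere) set \<Rightarrow> rsphere set" where
  "Julia F = {z. \<not> (\<exists>U. open U \<and> z \<in> U \<and> normal_on F U)}"

text \<open>A tuple \<open>f\<^sub>1, \<dots>, f\<^sub>m\<close> is given by \<open>m\<close> and a function \<open>f\<close> on \<^typ>\<open>nat\<close> of which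
  only the values on \<open>{1..m}\<close> matter.\<close>

inductive_set semigroup_gen :: "nat \<Rightarrow> (nat \<Rightarrow> rsphere \<Rightarrow> rsphere) \<Rightarrow> (rsphere \<Rightarrow> rsphere) set"
  for m f where
  gen: "j \<in> {1..m} \<Longrightarrow> f j \<in> semigroup_gen m f"
| comp: "g \<in> semigroup_gen m f \<Longrightarrow> h \<in> semigroup_gen m f \<Longrightarrow> g \<circ> h \<in> semigroup_gen m f"

definition Sigma_shift :: "nat \<Rightarrow> (int \<Rightarrow> nat) set" where
  "Sigma_shift m = {\<omega>. \<forall>k. \<omega> k \<in> {1..m}}"

definition shift :: "(int \<Rightarrow> nat) \<Rightarrow> (int \<Rightarrow> nat)" where
  "shift \<omega> = (\<lambda>k. \<omega> (k + 1))"

definition skew ::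
    "(nat \<Rightarrow> rsphere \<Rightarrow> rsphere) \<Rightarrow> (int \<Rightarrow> nat) \<times> rsphere \<Rightarrow> (int \<Rightarrow> nat) \<times> rsphere" where
  "skew f = (\<lambda>(\<omega>, z). (shift \<omega>, f (\<omega> 1) z))"

primrec fibre_iter ::
    "(nat \<Rightarrow> rsphere \<Rightarrow> rsphere) \<Rightarrow> (int \<Rightarrow> nat) \<Rightarrow> nat \<Rightarrow> rsphere \<Rightarrow> rsphere" where
  "fibre_iter f \<omega> 0 = id"
| "fibre_iter f \<omega> (Suc n) = f (\<omega> (int (Suc n))) \<circ> fibre_iter f \<omega> n"

definition fibre_Julia :: "(nat \<Rightarrow> rsphere \<Rightarrow> rsphere) \<Rightarrow> (int \<Rightarrow> nat) \<Rightarrow> rsphere set" where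
  "fibre_Julia f \<omega> = Julia {fibre_iter f \<omega> n | n. n \<ge> 1}"

text \<open>The closure is taken in \<^typ>\<open>(int \<Rightarrow> nat) \<times> rsphere\<close> with the product topology, in which
  \<open>Sigma_shift m \<times> UNIV\<close> is closed.\<close>

definition skew_Julia ::
    "nat \<Rightarrow> (nat \<Rightarrow> rsphere \<Rightarrow> rsphere) \<Rightarrow> ((int \<Rightarrow> nat) \<times> rsphere) set" where
  "skew_Julia m f = closure (\<Union>\<omega>\<in>Sigma_shift m. {\<omega>} \<times> fibre_Julia f \<omega>)"

definition skew_deriv_norm ::
    "(nat \<Rightarrow> rsphere \<Rightarrow> rsphere) \<Rightarrow> nat \<Rightarrow> (int \<Rightarrow> nat) \<times> rsphere \<Rightarrow> real" where
  "skew_deriv_norm f n = (\<lambda>(\<omega>, z). sph_deriv_norm (fibre_iter f \<omega> n) z)"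

definition expanding :: "nat \<Rightarrow> (nat \<Rightarrow> rsphere \<Rightarrow> rsphere) \<Rightarrow> bool" where
  "expanding m f \<longleftrightarrow> Julia (semigroup_gen m f) \<noteq> {} \<and>
     (\<exists>C > 0. \<exists>L > 1. \<forall>n \<ge> 1. \<forall>x \<in> skew_Julia m f. C * L ^ n \<le> skew_deriv_norm f n x)"

definition invariant_prob :: "'a measure \<Rightarrow> ('a \<Rightarrow> 'a) \<Rightarrow> bool" where
  "invariant_prob M T \<longleftrightarrow> prob_space M \<and> distr M M T = M"

definition invariant_sets :: "'a measure \<Rightarrow> ('a \<Rightarrow> 'a) \<Rightarrow> 'a measure" where
  "invariant_sets M T = sigma (space M) {B \<in> sets M. T -` B \<inter> space M = B}"

definition ergodic :: "'a measure \<Rightarrow> ('a \<Rightarrow> 'a) \<Rightarrow> bool" where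
  "ergodic M T \<longleftrightarrow>
     (\<forall>B \<in> sets M. T -` B \<inter> space M = B \<longrightarrow> measure M B = 0 \<or> measure M B = 1)"

text \<open>Information function and conditional entropy, for finite partitions \<open>\<xi>\<close> only
  (the sum over an infinite \<open>\<xi>\<close> would be 0).\<close>

definition cond_info :: "'a measure \<Rightarrow> 'a set set \<Rightarrow> 'a measure \<Rightarrow> 'a \<Rightarrow> real" where
  "cond_info M \<xi> F x = - (\<Sum>A\<in>\<xi>. indicator A x * ln (real_cond_exp M F (indicator A) x))"

definition cond_entropy :: "'a measure \<Rightarrow> 'a set set \<Rightarrow> 'a measure \<Rightarrow> real" where
  "cond_entropy M \<xi> F = (\<integral>x. cond_info M \<xi> F x \<partial>M)"

definition Pi_adapted ::
    "nat \<Rightarrow> (nat \<Rightarrow> rsphere \<Rightarrow> rsphere) \<Rightarrow> ((int \<Rightarrow> nat) \<times> rsphere) set set \<Rightarrow> bool" where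
  "Pi_adapted m f \<R> \<longleftrightarrow>
     finite \<R> \<and> partition_on (skew_Julia m f) \<R> \<and> \<R> \<subseteq> sets borel \<and>
     (\<forall>R\<in>\<R>. \<exists>j\<in>{1..m}. \<exists>K U. compact K \<and> open U \<and>
        R \<subseteq> skew_Julia m f \<inter> ({\<omega> \<in> Sigma_shift m. \<omega> 1 = j} \<times> K) \<and>
        K \<subseteq> U \<and> inj_on (f j) U)"

definition Pi_alg :: "('b \<times> 'a::topological_space) measure \<Rightarrow> ('b \<times> 'a) measure" where
  "Pi_alg \<mu> = vimage_algebra (space \<mu>) snd borel"

definition skew_Pi_alg ::
    "(nat \<Rightarrow> rsphere \<Rightarrow> rsphere) \<Rightarrow> ((int \<Rightarrow> nat) \<times> rsphere) measure \<Rightarrow>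
     ((int \<Rightarrow> nat) \<times> rsphere) measure" where
  "skew_Pi_alg f \<mu> = vimage_algebra (space \<mu>) (skew f) (Pi_alg \<mu>)"

definition local_proj_entropy ::
    "(nat \<Rightarrow> rsphere \<Rightarrow> rsphere) \<Rightarrow> ((int \<Rightarrow> nat) \<times> rsphere) measure \<Rightarrow>
     ((int \<Rightarrow> nat) \<times> rsphere) set set \<Rightarrow> (int \<Rightarrow> nat) \<times> rsphere \<Rightarrow> real" where
  "local_proj_entropy f \<mu> \<R> =
     real_cond_exp \<mu> (invariant_sets \<mu> (skew f))
       (\<lambda>x. cond_info \<mu> \<R> (skew_Pi_alg f \<mu>) x - cond_info \<mu> \<R> (Pi_alg \<mu>) x)"

definition proj_entropy ::
    "(nat \<Rightarrow> rsphere \<Rightarrow> rsphere) \<Rightarrow> ((int \<Rightarrow> nat) \<times> rsphere) measure \<Rightarrow>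
     ((int \<Rightarrow> nat) \<times> rsphere) set set \<Rightarrow> real" where
  "proj_entropy f \<mu> \<R> = cond_entropy \<mu> \<R> (skew_Pi_alg f \<mu>) - cond_entropy \<mu> \<R> (Pi_alg \<mu>)"

definition Pi_ball ::
    "nat \<Rightarrow> (nat \<Rightarrow> rsphere \<Rightarrow> rsphere) \<Rightarrow> (int \<Rightarrow> nat) \<times> rsphere \<Rightarrow> real \<Rightarrow>
     ((int \<Rightarrow> nat) \<times> rsphere) set" where
  "Pi_ball m f x r = {y \<in> skew_Julia m f. dist (snd y) (snd x) < r}"

definition exact_dimensional :: "'a::metric_space measure \<Rightarrow> bool" where
  "exact_dimensional \<nu> \<longleftrightarrow>
     (\<exists>D \<ge> 0. AE x in \<nu>. ((\<lambda>r. ln (measure \<nu> (ball x r)) / ln r) \<longlongrightarrow> D) (at_right 0))"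

end

theory Submission
  imports Defs "HOL-Real_Asymp.Real_Asymp"
begin

text \<open>
  A spherical ball is the trace on the unit sphere of a Euclidean ball, so along the stereographic
  embedding the theorem becomes a statement about a map \<open>s\<close> from a measure preserving
  system \<open>(M, T)\<close> to a Euclidean space. Write \<open>B x r\<close> for the set of points whose image under
  \<open>s\<close> is closer than \<open>r\<close> to that of \<open>x\<close>, and \<open>R x\<close> for the atom of the partition containing
  \<open>x\<close>. On one atom the skew product acts on the sphere by a single injective branch with
  non-vanishing derivative, hence almost as a similarity of ratio \<open>D x\<close>, the norm of the
  derivative, uniformly at small scales (\<open>uniform_distortion\<close>). Therefore \<open>R x \<inter> B x r\<close> almost
  equals the part in \<open>R x\<close> of the preimage of \<open>B (T x) (D x * r)\<close>. Since \<open>T\<close> preserves the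
  measure, passing from \<open>(x, r)\<close> to \<open>(T x, D x * r)\<close> changes the logarithm of the mass of the
  ball by the difference of two local informations: that of the atom \<open>R x\<close> inside \<open>B x r\<close>,
  and that of \<open>R x\<close> inside the preimage of the ball around \<open>T x\<close>.

  As \<open>r\<close> tends to \<open>0\<close> these two quantities converge to the conditional informations given the
  \<open>\<sigma>\<close>-algebras generated by \<open>s\<close> and by \<open>s \<circ> T\<close> (\<open>information_limit\<close>). This is Lebesgue
  differentiation for an arbitrary finite measure on a Euclidean space; it rests on Besicovitch's
  covering theorem (\<open>besicovitch_covering\<close>), which also gives a weak type inequality
  (\<open>weak_type_maximal\<close>) and from it an integrable bound over all scales.

  Starting at radius \<open>r\<close> and iterating until the radius has grown to a fixed size takes \<open>n\<close> steps,
  where \<open>ln r\<close> is minus the \<open>n\<close>-th Birkhoff sum of \<open>ln \<circ> D\<close> up to a bounded error, and the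
  logarithm of the mass of \<open>B x r\<close> is a sum of \<open>n\<close> local information differences up to a bounded
  error. The \<open>k\<close>-th difference is taken at a scale exponentially small in \<open>n - k\<close>, since \<open>T\<close> is
  expanding. So it is not a Birkhoff sum of one function, but Maker's version of the ergodic theorem
  (\<open>maker\<close>), whose hypothesis of domination is the integrable bound above, shows that it behaves
  like one. The quotient of the two sums is the asserted ratio (\<open>local_dimension\<close>). Distortion
  factors \<open>exp \<epsilon>\<close> per step perturb the exponent by \<open>\<epsilon>\<close> and disappear in the limit.
\<close>

section \<open>Covering by balls with bounded overlap\<close>

definition separated :: "real \<Rightarrow> 'a::metric_space set \<Rightarrow> bool" where
  "separated \<delta> S \<longleftrightarrow> (\<forall>x\<in>S. \<forall>y\<in>S. x \<noteq> y \<longrightarrow> \<delta> \<le> dist x y)"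

lemma separated_card_le:
  assumes S: "separated \<delta> S" and K: "finite K" "S \<subseteq> (\<Union>k\<in>K. ball k (\<delta>/2))"
  shows "finite S" "card S \<le> card K"
proof -
  have "\<forall>x\<in>S. \<exists>k\<in>K. x \<in> ball k (\<delta>/2)" using K(2) by blast
  then obtain g where g: "\<And>x. x \<in> S \<Longrightarrow> g x \<in> K" "\<And>x. x \<in> S \<Longrightarrow> dist (g x) x < \<delta>/2"
    unfolding Bex_def mem_ball by metis
  have "inj_on g S"
  proof (rule inj_onI, rule ccontr)
    fix x y assume xy: "x \<in> S" "y \<in> S" "g x = g y" "x \<noteq> y"
    have "dist x y \<le> dist (g x) x + dist (g x) y" by (rule dist_triangle3)
    also have "\<dots> < \<delta>" using g(2)[OF xy(1)] g(2)[OF xy(2)] xy(3) by simp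
    finally show False using S xy by (force simp: separated_def)
  qed
  moreover have "g ` S \<subseteq> K" using g by blast
  ultimately show "finite S" "card S \<le> card K"
    using K(1) by (auto intro: inj_on_finite card_inj_on_le)
qed

lemma maximal_separated_exists:
  fixes Z :: "'a::euclidean_space set"
  assumes "bounded Z" "\<delta> > 0"
  shows "\<exists>W\<subseteq>Z. finite W \<and> separated \<delta> W \<and> Z \<subseteq> (\<Union>w\<in>W. ball w \<delta>)"
proof -
  have "compact (closure Z)" using assms by (simp add: compact_closure)
  then obtain K where K: "finite K" "closure Z \<subseteq> (\<Union>k\<in>K. ball k (\<delta>/2))"
    using seq_compact_imp_totally_bounded[OF compact_imp_seq_compact, rule_format, of "closure Z" "\<delta>/2"] assms
    by (auto intro: that)
  let ?P = "\<lambda>W. W \<subseteq> Z \<and> separated \<delta> W"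
  have fin: "finite W" "card W \<le> card K" if "?P W" for W
    using separated_card_le[of \<delta> W K] that K closure_subset by blast+
  let ?Q = "\<lambda>n. \<exists>W. ?P W \<and> card W = n"
  have bound: "n \<le> card K" if "?Q n" for n using that fin(2) by blast
  have "?Q 0" by (intro exI[of _ "{}"]) (simp add: separated_def)
  then have "?Q (Greatest ?Q)" by (rule GreatestI_nat) (fact bound)
  then obtain W where W: "?P W" "card W = Greatest ?Q" by blast
  have max: "card V \<le> card W" if "?P V" for V
    unfolding W(2) by (rule Greatest_le_nat[of ?Q _ "card K"]) (use that bound in blast)+
  have "Z \<subseteq> (\<Union>w\<in>W. ball w \<delta>)"
  proof (rule ccontr)
    assume "\<not> ?thesis"
    then obtain z where z: "z \<in> Z" "\<And>w. w \<in> W \<Longrightarrow> \<delta> \<le> dist w z" by force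
    then have "?P (insert z W)" using W by (auto simp: separated_def dist_commute)
    moreover have "z \<notin> W" using z(2)[of z] assms by auto
    ultimately show False using max[of "insert z W"] fin(1)[OF W(1)] by simp
  qed
  then show ?thesis using W(1) fin(1) by blast
qed

lemma packing_bound:
  obtains P :: nat where
    "\<And>S (z::'a::euclidean_space) \<rho>. \<lbrakk>\<rho> > 0; S \<subseteq> cball z \<rho>; separated (\<rho>/2) S\<rbrakk> \<Longrightarrow> finite S \<and> card S \<le> P"
proof -
  have "compact (cball (0::'a) 1)" by simp
  then obtain K where K: "finite K" "cball (0::'a) 1 \<subseteq> (\<Union>k\<in>K. ball k (1/4))"
    using seq_compact_imp_totally_bounded[OF compact_imp_seq_compact, rule_format, of "cball (0::'a) 1" "1/4"]
    by (auto intro: that)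
  show ?thesis
  proof (rule that[of "card K"])
    fix S and z :: 'a and \<rho> :: real
    assume *: "\<rho> > 0" "S \<subseteq> cball z \<rho>" "separated (\<rho>/2) S"
    let ?f = "\<lambda>x. (x - z) /\<^sub>R \<rho>"
    have inj: "inj_on ?f S" using * by (auto simp: inj_on_def)
    have d: "dist (?f x) (?f y) = dist x y / \<rho>" for x y
    proof -
      have "?f x - ?f y = (x - y) /\<^sub>R \<rho>" by (simp add: algebra_simps)
      then show ?thesis using *(1) by (simp add: dist_norm divide_inverse mult.commute)
    qed
    have "separated (1/2) (?f ` S)"
      unfolding separated_def
    proof (intro ballI impI)
      fix a b assume "a \<in> ?f ` S" "b \<in> ?f ` S" "a \<noteq> b"
      then obtain x y where xy: "x \<in> S" "y \<in> S" "a = ?f x" "b = ?f y" "x \<noteq> y" by blast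
      then have "\<rho>/2 \<le> dist x y" using *(3) by (simp add: separated_def)
      then show "1/2 \<le> dist a b" using *(1) unfolding xy(3,4) d by (simp add: pos_le_divide_eq)
    qed
    moreover have "?f ` S \<subseteq> cball 0 1"
    proof
      fix a assume "a \<in> ?f ` S"
      then obtain x where x: "x \<in> S" "a = ?f x" by blast
      then have "dist x z \<le> \<rho>" using *(2) by (auto simp: dist_commute)
      moreover have "norm a = dist x z / \<rho>" using d[of x z] x(2) by simp
      ultimately show "a \<in> cball 0 1" using *(1) by simp
    qed
    ultimately have "finite (?f ` S)" "card (?f ` S) \<le> card K"
      using separated_card_le[of "1/2" "?f ` S" K] K by auto
    then show "finite S \<and> card S \<le> card K"
      using inj by (simp add: card_image finite_image_iff)
  qed
qed

text \<open>If the side opposite to the origin is the longest of the triangle \<open>0, u, v\<close>, then the angle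
  at \<open>0\<close> is at least 60 degrees. Hence only boundedly many pairwise incomparable balls can
  contain a common point: their centres lie in separated directions.\<close>

lemma sgn_separated:
  fixes u v :: "'a::euclidean_space"
  assumes u: "norm u < norm (u - v)" and v: "norm v < norm (u - v)"
  shows "1 \<le> dist (sgn u) (sgn v)"
proof -
  have nz: "u \<noteq> 0" "v \<noteq> 0" using assms by auto
  define m where "m = max (norm u) (norm v)"
  have "m\<^sup>2 < (norm (u - v))\<^sup>2"
    using u v by (intro power_strict_mono) (auto simp: m_def le_max_iff_disj)
  also have "\<dots> = (norm u)\<^sup>2 + (norm v)\<^sup>2 - 2 * (u \<bullet> v)"
    by (simp add: power2_norm_eq_inner inner_diff inner_commute)
  finally have "2 * (u \<bullet> v) \<le> (min (norm u) (norm v))\<^sup>2" by (simp add: m_def max_def min_def split: if_splits)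
  also have "\<dots> \<le> norm u * norm v" by (simp add: power2_eq_square mult_mono min_def)
  finally have "2 * (sgn u \<bullet> sgn v) \<le> 1"
    using nz by (simp add: sgn_div_norm field_simps)
  then have "1 \<le> (dist (sgn u) (sgn v))\<^sup>2"
    using nz by (simp add: dist_norm power2_norm_eq_inner inner_diff inner_commute)
       (simp add: norm_sgn flip: power2_norm_eq_inner)
  then show ?thesis using power2_le_imp_le[of 1 "dist (sgn u) (sgn v)"] by simp
qed

text \<open>Besicovitch's theorem, with balls selected in dyadic layers of decreasing radius. In the layer of
  radii between \<open>2 ^ -(k + 1)\<close> and \<open>2 ^ -k\<close>, a maximal \<open>2 ^ -(k + 1)\<close>-separated set of the
  points not yet covered is chosen; maximality makes its balls cover the rest of the layer. A
  point lies in few balls of one layer, by packing, and in balls of few layers: of two balls from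
  different layers the smaller has its centre outside of the larger one, so \<open>sgn_separated\<close>
  applies to the directions of the centres seen from the point.\<close>

theorem besicovitch_covering:
  obtains N :: nat where
    "\<And>(Z::'a::euclidean_space set) r. \<lbrakk>bounded Z; \<And>z. z \<in> Z \<Longrightarrow> 0 < r z \<and> r z < 1\<rbrakk> \<Longrightarrow>
       \<exists>W\<subseteq>Z. countable W \<and> Z \<subseteq> (\<Union>w\<in>W. ball w (r w)) \<and>
         (\<forall>y. finite {w\<in>W. y \<in> ball w (r w)} \<and> card {w\<in>W. y \<in> ball w (r w)} \<le> N)"
proof -
  obtain P where P: "\<And>S (z::'a) \<rho>. \<lbrakk>\<rho> > 0; S \<subseteq> cball z \<rho>; separated (\<rho>/2) S\<rbrakk> \<Longrightarrow> finite S \<and> card S \<le> P"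
    by (rule packing_bound) blast
  show ?thesis
  proof (rule that[of "P * P"])
    fix Z :: "'a set" and r :: "'a \<Rightarrow> real"
    assume Z: "bounded Z" and r: "\<And>z. z \<in> Z \<Longrightarrow> 0 < r z \<and> r z < 1"
    define layer where "layer k = {z \<in> Z. (1/2)^Suc k \<le> r z \<and> r z < (1/2)^k}" for k
    have layer_ex: "\<exists>k. z \<in> layer k" if "z \<in> Z" for z
    proof -
      define k where "k = (LEAST k. (1/2)^Suc k \<le> r z)"
      have "\<exists>k. (1/2)^k < r z" using r[OF that] by (intro real_arch_pow_inv) auto
      then obtain k0 where "(1/2)^k0 < r z" ..
      then have "(1/2)^Suc k0 \<le> r z" using r[OF that] by (simp)
      then have 1: "(1/2)^Suc k \<le> r z" unfolding k_def by (rule LeastI)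
      have "r z < (1/2)^k"
      proof (cases k)
        case 0 then show ?thesis using r[OF that] by simp
      next
        case (Suc j)
        then have "\<not> (1/2)^Suc j \<le> r z" using not_less_Least[of j "\<lambda>k. (1/2)^Suc k \<le> r z"] k_def by simp
        then show ?thesis using Suc by simp
      qed
      then show ?thesis using 1 that by (auto simp: layer_def)
    qed
    define pick where "pick \<delta> S = (SOME W. W \<subseteq> S \<and> finite W \<and> separated \<delta> W \<and> S \<subseteq> (\<Union>w\<in>W. ball w \<delta>))"
      for \<delta> and S :: "'a set"
    have pick: "pick \<delta> S \<subseteq> S \<and> finite (pick \<delta> S) \<and> separated \<delta> (pick \<delta> S) \<and> S \<subseteq> (\<Union>w\<in>pick \<delta> S. ball w \<delta>)"
      if "S \<subseteq> Z" "\<delta> > 0" for S \<delta>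
      unfolding pick_def by (rule someI_ex) (use maximal_separated_exists bounded_subset Z that in metis)
    define cov where "cov = rec_nat {} (\<lambda>k U. U \<union> (\<Union>w\<in>pick ((1/2)^Suc k) (layer k - U). ball w (r w)))"
    define V where "V k = pick ((1/2)^Suc k) (layer k - cov k)" for k
    have cov_Suc: "cov (Suc k) = cov k \<union> (\<Union>w\<in>V k. ball w (r w))" for k
      by (simp add: cov_def V_def)
    have V: "V k \<subseteq> layer k - cov k" "finite (V k)" "separated ((1/2)^Suc k) (V k)"
      "layer k - cov k \<subseteq> (\<Union>w\<in>V k. ball w ((1/2)^Suc k))" for k
      using pick[of "layer k - cov k" "(1/2)^Suc k"] by (auto simp: V_def layer_def)
    have cov_mono: "cov i \<subseteq> cov j" if "i \<le> j" for i j
      using that by (rule lift_Suc_mono_le[rotated]) (auto simp: cov_Suc)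
    define W where "W = (\<Union>k. V k)"
    have WZ: "W \<subseteq> Z" using V(1) by (force simp: W_def layer_def)
    have cW: "countable W" unfolding W_def using V(2) by (auto intro: countable_finite)
    have cover: "Z \<subseteq> (\<Union>w\<in>W. ball w (r w))"
    proof
      fix z assume "z \<in> Z"
      then obtain k where k: "z \<in> layer k" using layer_ex by blast
      have cW': "cov j \<subseteq> (\<Union>w\<in>W. ball w (r w))" for j
      proof (induction j)
        case 0 then show ?case by (simp add: cov_def)
      next
        case (Suc j) then show ?case by (auto simp: cov_Suc W_def)
      qed
      show "z \<in> (\<Union>w\<in>W. ball w (r w))"
      proof (cases "z \<in> cov k")
        case False
        then obtain w where w: "w \<in> V k" "dist w z < (1/2)^Suc k" using V(4)[of k] k by force
        moreover have "(1/2)^Suc k \<le> r w" using w V(1)[of k] by (auto simp: layer_def)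
        ultimately show ?thesis by (force simp: W_def)
      qed (use cW' in blast)
    qed
    have far: "r x \<le> dist x y \<and> r y < r x" if "x \<in> V i" "y \<in> V j" "i < j" for x y i j
    proof -
      have "x \<in> layer i" "y \<in> layer j" "y \<notin> cov j" using that V(1) by blast+
      have "y \<notin> cov (Suc i)" using cov_mono[of "Suc i" j] that \<open>y \<notin> cov j\<close> by auto
      then have "r x \<le> dist x y" using that by (auto simp: cov_Suc not_less)
      moreover have "r y < (1/2)^j" "(1/2)^Suc i \<le> r x" using \<open>x \<in> layer i\<close> \<open>y \<in> layer j\<close> by (auto simp: layer_def)
      moreover have "(1/2::real)^j \<le> (1/2)^Suc i" using that by (intro power_decreasing) auto
      ultimately show ?thesis by linarith
    qed
    have mult: "finite {w\<in>W. y \<in> ball w (r w)} \<and> card {w\<in>W. y \<in> ball w (r w)} \<le> P * P" for y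
    proof -
      define Y where "Y k = {w \<in> V k. y \<in> ball w (r w)}" for k
      define I where "I = {k. Y k \<noteq> {}}"
      have Yk: "card (Y k) \<le> P" "finite (Y k)" for k
      proof -
        have "Y k \<subseteq> cball y ((1/2)^k)"
          using V(1)[of k] by (force simp: Y_def layer_def dist_commute)
        moreover have "separated ((1/2)^k/2) (Y k)" using V(3)[of k] by (auto simp: separated_def Y_def)
        ultimately show "card (Y k) \<le> P" "finite (Y k)" using P[of "(1/2)^k" "Y k" y] by auto
      qed
      have "\<forall>k\<in>I. \<exists>w. w \<in> Y k" by (auto simp: I_def)
      then obtain g where g: "\<And>k. k \<in> I \<Longrightarrow> g k \<in> Y k" by metis
      define u where "u k = sgn (g k - y)" for k
      have sep1: "1 \<le> dist (u i) (u j)" if "i \<in> I" "j \<in> I" "i < j" for i j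
      proof -
        have m: "g i \<in> V i" "g j \<in> V j" "dist (g i) y < r (g i)" "dist (g j) y < r (g j)"
          using g that by (auto simp: Y_def)
        have "r (g i) \<le> dist (g i) (g j)" "r (g j) < r (g i)" using far[OF m(1,2) that(3)] by auto
        then show ?thesis unfolding u_def
          by (intro sgn_separated) (use m in \<open>auto simp: dist_norm\<close>)
      qed
      have sep: "1 \<le> dist (u i) (u j)" if "i \<in> I" "j \<in> I" "i \<noteq> j" for i j
        using sep1[of i j] sep1[of j i] that by (cases "i < j") (auto simp: dist_commute)
      have inj: "inj_on u I" using sep by (force simp: inj_on_def)
      have "u ` I \<subseteq> cball 0 1" by (auto simp: u_def norm_sgn)
      moreover have "separated (1/2) (u ` I)" using sep by (force simp: separated_def)
      ultimately have "finite (u ` I)" "card (u ` I) \<le> P" using P[of 1 "u ` I" 0] by auto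
      then have I: "finite I" "card I \<le> P" using inj by (simp_all add: card_image finite_image_iff)
      have eq: "{w\<in>W. y \<in> ball w (r w)} = (\<Union>k\<in>I. Y k)" by (auto simp: W_def Y_def I_def)
      have "card (\<Union>k\<in>I. Y k) \<le> (\<Sum>k\<in>I. card (Y k))" using I by (intro card_UN_le) auto
      also have "\<dots> \<le> card I * P" using sum_bounded_above[of I "\<lambda>k. card (Y k)" P] Yk by simp
      also have "\<dots> \<le> P * P" using I by (simp)
      finally show ?thesis using eq I Yk by auto
    qed
    show "\<exists>W\<subseteq>Z. countable W \<and> Z \<subseteq> (\<Union>w\<in>W. ball w (r w)) \<and>
         (\<forall>y. finite {w\<in>W. y \<in> ball w (r w)} \<and> card {w\<in>W. y \<in> ball w (r w)} \<le> P * P)"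
      using WZ cW cover mult by blast
  qed
qed

section \<open>Differentiation of finite measures\<close>

definition weak_type_bound :: "'a::euclidean_space itself \<Rightarrow> nat \<Rightarrow> bool" where
  "weak_type_bound _ N \<longleftrightarrow> (\<forall>(\<alpha> :: 'a measure) \<beta> Z t.
     finite_measure \<alpha> \<longrightarrow> finite_measure \<beta> \<longrightarrow> sets \<alpha> = sets borel \<longrightarrow> sets \<beta> = sets borel \<longrightarrow> 0 \<le> t \<longrightarrow> bounded Z \<longrightarrow>
     (\<forall>z\<in>Z. \<exists>r. 0 < r \<and> r < 1 \<and> measure \<alpha> (ball z r) \<le> t * measure \<beta> (ball z r)) \<longrightarrow>
     (\<exists>S\<in>sets borel. Z \<subseteq> S \<and> measure \<alpha> S \<le> t * real N * measure \<beta> UNIV))"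

lemma weak_type_boundD:
  assumes "weak_type_bound TYPE('a::euclidean_space) N"
    and "finite_measure (\<alpha> :: 'a measure)" "finite_measure \<beta>" "sets \<alpha> = sets borel" "sets \<beta> = sets borel" "0 \<le> t" "bounded Z"
    and "\<And>z. z \<in> Z \<Longrightarrow> \<exists>r. 0 < r \<and> r < 1 \<and> measure \<alpha> (ball z r) \<le> t * measure \<beta> (ball z r)"
  shows "\<exists>S\<in>sets borel. Z \<subseteq> S \<and> measure \<alpha> S \<le> t * real N * measure \<beta> UNIV"
  by (rule assms(1)[unfolded weak_type_bound_def, rule_format, OF assms(2-7)]) (rule assms(8))

text \<open>The total \<open>\<beta>\<close>-mass of the covering balls is at most \<open>N\<close> times that of the whole space, since no
  point lies in more than \<open>N\<close> of them. Below, \<open>Z\<close> is a set of exceptional points of unknown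
  measurability, hence the measurable superset.\<close>

lemma weak_type_maximal:
  obtains N where "weak_type_bound TYPE('a::euclidean_space) N"
proof -
  obtain N where N: "\<And>(Z::'a set) r. \<lbrakk>bounded Z; \<And>z. z \<in> Z \<Longrightarrow> 0 < r z \<and> r z < 1\<rbrakk> \<Longrightarrow>
       \<exists>W\<subseteq>Z. countable W \<and> Z \<subseteq> (\<Union>w\<in>W. ball w (r w)) \<and>
         (\<forall>y. finite {w\<in>W. y \<in> ball w (r w)} \<and> card {w\<in>W. y \<in> ball w (r w)} \<le> N)"
    using besicovitch_covering by blast
  show ?thesis
  proof (rule that[of N], unfold weak_type_bound_def, intro allI impI)
    fix \<alpha> \<beta> :: "'a measure" and Z t
    assume fin: "finite_measure \<alpha>" "finite_measure \<beta>" and [measurable_cong]: "sets \<alpha> = sets borel" "sets \<beta> = sets borel"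
      and t: "0 \<le> (t::real)" and Z: "bounded Z"
      and ex: "\<forall>z\<in>Z. \<exists>r. 0 < r \<and> r < 1 \<and> measure \<alpha> (ball z r) \<le> t * measure \<beta> (ball z r)"
    interpret A: finite_measure \<alpha> by fact
    interpret B: finite_measure \<beta> by fact
    have spb: "space \<beta> = UNIV" using sets_eq_imp_space_eq[of \<beta> borel] \<open>sets \<beta> = sets borel\<close> by simp
    obtain r where r: "\<And>z. z \<in> Z \<Longrightarrow> 0 < r z \<and> r z < 1"
      "\<And>z. z \<in> Z \<Longrightarrow> measure \<alpha> (ball z (r z)) \<le> t * measure \<beta> (ball z (r z))"
      using ex by metis
    have "\<exists>W\<subseteq>Z. countable W \<and> Z \<subseteq> (\<Union>w\<in>W. ball w (r w)) \<and>
         (\<forall>y. finite {w\<in>W. y \<in> ball w (r w)} \<and> card {w\<in>W. y \<in> ball w (r w)} \<le> N)"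
      by (rule N[OF Z r(1)])
    then obtain W where W: "W \<subseteq> Z" "countable W" "Z \<subseteq> (\<Union>w\<in>W. ball w (r w))"
      and mult: "\<And>y. finite {w\<in>W. y \<in> ball w (r w)} \<and> card {w\<in>W. y \<in> ball w (r w)} \<le> N"
      by (elim exE conjE) blast
    have finite_bound: "measure \<alpha> (\<Union>w\<in>F. ball w (r w)) \<le> t * real N * measure \<beta> UNIV"
      if F: "F \<subseteq> W" "finite F" for F
    proof -
      have "measure \<alpha> (\<Union>w\<in>F. ball w (r w)) \<le> (\<Sum>w\<in>F. measure \<alpha> (ball w (r w)))"
        by (rule measure_UNION_le) (use F in auto)
      also have "\<dots> \<le> (\<Sum>w\<in>F. t * measure \<beta> (ball w (r w)))"
        by (rule sum_mono) (use r(2) F W in blast)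
      also have "\<dots> = t * (\<integral>y. (\<Sum>w\<in>F. indicator (ball w (r w)) y) \<partial>\<beta>)"
        by (subst Bochner_Integration.integral_sum)
           (auto simp: sum_distrib_left spb intro!: integrable_real_indicator simp: less_top[symmetric])
      also have "\<dots> \<le> t * (\<integral>y. real N \<partial>\<beta>)"
      proof (intro mult_left_mono integral_mono t)
        fix y
        have "(\<Sum>w\<in>F. indicator (ball w (r w)) y) = real (card {w\<in>F. y \<in> ball w (r w)})"
          using F by (simp add: indicator_def if_distrib sum.If_cases Int_def del: mem_ball cong: if_cong)
        also have "card {w\<in>F. y \<in> ball w (r w)} \<le> card {w\<in>W. y \<in> ball w (r w)}"
          using mult[of y] F by (intro card_mono) auto
        finally show "(\<Sum>w\<in>F. indicator (ball w (r w)) y) \<le> real N" using mult[of y] by linarith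
      qed (auto intro!: integrable_real_indicator simp: less_top[symmetric])
      finally show ?thesis by (simp add: spb mult_ac)
    qed
    define F where "F i = {w\<in>W. to_nat_on W w \<le> i}" for i
    have F: "F i \<subseteq> W" "finite (F i)" for i
    proof -
      have "inj_on (to_nat_on W) (F i)" using inj_on_to_nat_on[OF W(2)] by (rule inj_on_subset) (auto simp: F_def)
      moreover have "to_nat_on W ` F i \<subseteq> {..i}" by (auto simp: F_def)
      ultimately show "finite (F i)" by (rule inj_on_finite) simp
    qed (auto simp: F_def)
    let ?S = "\<Union>w\<in>W. ball w (r w)"
    have "(\<lambda>i. measure \<alpha> (\<Union>w\<in>F i. ball w (r w))) \<longlonglongrightarrow> measure \<alpha> (\<Union>i. \<Union>w\<in>F i. ball w (r w))"
      by (rule A.finite_Lim_measure_incseq) (auto simp: incseq_def F_def \<open>sets \<alpha> = sets borel\<close> intro!: open_UN borel_open intro: order_trans)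
    moreover have "(\<Union>i. \<Union>w\<in>F i. ball w (r w)) = ?S" by (auto simp: F_def)
    ultimately have "measure \<alpha> ?S \<le> t * real N * measure \<beta> UNIV"
      using finite_bound F by (intro LIMSEQ_le_const2) auto
    moreover have "?S \<in> sets borel" by (intro borel_open) auto
    ultimately show "\<exists>S\<in>sets borel. Z \<subseteq> S \<and> measure \<alpha> S \<le> t * real N * measure \<beta> UNIV"
      using W(3) by blast
  qed
qed

lemma AE_not_in_small:
  assumes "finite_measure \<nu>"
    and small: "\<And>e::real. e > 0 \<Longrightarrow> \<exists>S\<in>sets \<nu>. Z \<subseteq> S \<and> measure \<nu> S \<le> e"
  shows "AE z in \<nu>. z \<notin> Z"
proof -
  interpret finite_measure \<nu> by fact
  have "\<forall>n::nat. \<exists>S\<in>sets \<nu>. Z \<subseteq> S \<and> measure \<nu> S \<le> 1 / Suc n" using small by simp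
  then obtain S where S: "\<And>n::nat. S n \<in> sets \<nu>" "\<And>n. Z \<subseteq> S n" "\<And>n. measure \<nu> (S n) \<le> 1 / Suc n"
    by metis
  have m: "(\<Inter>n. S n) \<in> sets \<nu>" using S by auto
  have "measure \<nu> (\<Inter>n. S n) \<le> 1 / Suc n" for n
    using finite_measure_mono[of "\<Inter>n. S n" "S n"] S by (meson INT_lower UNIV_I order_trans)
  then have "measure \<nu> (\<Inter>n. S n) \<le> 0"
    using LIMSEQ_le_const[OF lim_inverse_n'[THEN LIMSEQ_Suc], of "measure \<nu> (\<Inter>n. S n)"]
    by (auto simp: divide_inverse)
  then have "(\<Inter>n. S n) \<in> null_sets \<nu>"
    using m by (auto simp: null_sets_def emeasure_eq_measure measure_le_0_iff)
  then show ?thesis using S(2) by (intro AE_I'[of "\<Inter>n. S n"]) auto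
qed

text \<open>The weak type inequality with factor \<open>0\<close>.\<close>

lemma AE_ball_pos:
  fixes \<nu> :: "'a::euclidean_space measure"
  assumes "finite_measure \<nu>" and b': "sets \<nu> = sets borel"
  shows "AE z in \<nu>. \<forall>r>0. 0 < measure \<nu> (ball z r)"
proof -
  interpret finite_measure \<nu> by fact
  obtain N where N: "weak_type_bound TYPE('a) N" by (rule weak_type_maximal)
  define Z where "Z b = {z \<in> cball 0 (real b). \<exists>r>0. measure \<nu> (ball z r) = 0}" for b :: nat
  have "AE z in \<nu>. z \<notin> Z b" for b
  proof (rule AE_not_in_small[OF assms(1)])
    fix e :: real assume "e > 0"
    have "\<exists>S\<in>sets borel. Z b \<subseteq> S \<and> measure \<nu> S \<le> 0 * real N * measure \<nu> UNIV"
    proof (rule weak_type_boundD[OF N assms(1,1) b' b'])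
      fix z assume "z \<in> Z b"
      then obtain r where r: "r > 0" "measure \<nu> (ball z r) = 0" by (auto simp: Z_def)
      have "measure \<nu> (ball z (min r (1/2))) \<le> measure \<nu> (ball z r)"
        by (rule finite_measure_mono) (auto simp: b')
      then show "\<exists>r. 0 < r \<and> r < 1 \<and> measure \<nu> (ball z r) \<le> 0 * measure \<nu> (ball z r)"
        using r by (intro exI[of _ "min r (1/2)"]) (auto simp: measure_le_0_iff)
    qed (auto simp: Z_def intro!: bounded_subset[OF bounded_cball[of 0]])
    then obtain S where "S \<in> sets borel" "Z b \<subseteq> S" "measure \<nu> S \<le> 0 * real N * measure \<nu> UNIV" by blast
    then show "\<exists>S\<in>sets \<nu>. Z b \<subseteq> S \<and> measure \<nu> S \<le> e" using b' \<open>e > 0\<close> by (intro bexI[of _ S]) auto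
  qed
  then have "AE z in \<nu>. \<forall>b. z \<notin> Z b" by (simp add: AE_all_countable)
  then show ?thesis
  proof eventually_elim
    case (elim z)
    obtain b where "norm z \<le> real b" using real_arch_simple by blast
    then show ?case using elim[rule_format, of b] by (auto simp: Z_def zero_less_measure_iff)
  qed
qed

text \<open>Up to a piece \<open>A - K\<close> of small mass, \<open>A\<close> is a compact set \<open>K\<close>, and small balls around a point
  outside of \<open>A\<close> do not meet \<open>K\<close>. The points at which the small piece is nevertheless seen with
  density \<open>1 / (j + 1)\<close> have small mass by the weak type inequality.\<close>

lemma density_at_outside_points:
  fixes \<nu> :: "'a::euclidean_space measure"
  assumes "finite_measure \<nu>" and b: "sets \<nu> = sets borel" and A: "A \<in> sets borel"
  shows "AE z in \<nu>. z \<notin> A \<longrightarrow>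
     ((\<lambda>r. measure \<nu> (A \<inter> ball z r) / measure \<nu> (ball z r)) \<longlongrightarrow> 0) (at_right 0)"
proof -
  interpret finite_measure \<nu> by fact
  obtain N where N: "weak_type_bound TYPE('a) N" by (rule weak_type_maximal)
  let ?q = "\<lambda>z r. measure \<nu> (A \<inter> ball z r) / measure \<nu> (ball z r)"
  define Z where "Z b j = {z \<in> cball 0 (real b). z \<notin> A \<and> \<not> (\<forall>\<^sub>F r in at_right 0. ?q z r < 1 / Suc j)}"
    for b j :: nat
  have "AE z in \<nu>. z \<notin> Z b' j" for b' j
  proof (rule AE_not_in_small[OF assms(1)])
    fix e :: real assume e: "e > 0"
    \<comment> \<open>The weak type inequality loses the factor \<open>(j + 1) * N\<close>.\<close>
    define \<delta> where "\<delta> = e / (real (Suc j) * real N + 1)"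
    have \<delta>: "\<delta> > 0" using e unfolding \<delta>_def by (intro divide_pos_pos add_nonneg_pos mult_nonneg_nonneg of_nat_0_le_iff zero_less_one)
    have "\<exists>K. K \<subseteq> A \<and> compact K \<and> measure \<nu> A < measure \<nu> K + \<delta>"
    proof (rule ccontr)
      assume "\<not> ?thesis"
      then have "measure \<nu> K \<le> measure \<nu> A - \<delta>" if "K \<subseteq> A" "compact K" for K using that by force
      then have "emeasure \<nu> A \<le> ennreal (measure \<nu> A - \<delta>)"
        by (subst inner_regular[OF b]) (auto intro!: SUP_least simp: A emeasure_eq_measure ennreal_leI)
      then have "measure \<nu> A \<le> measure \<nu> A - \<delta> \<or> measure \<nu> A \<le> 0"
        by (auto simp: emeasure_eq_measure ennreal_le_iff2)
      moreover have "0 \<le> measure \<nu> A - \<delta>"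
        using \<open>\<And>K. K \<subseteq> A \<Longrightarrow> compact K \<Longrightarrow> measure \<nu> K \<le> measure \<nu> A - \<delta>\<close>[of "{}"] by simp
      ultimately show False using \<delta> by simp
    qed
    then obtain K where K: "K \<subseteq> A" "compact K" "measure \<nu> A < measure \<nu> K + \<delta>" by blast
    have Km: "K \<in> sets \<nu>" using K(2) b by (simp add: borel_compact)
    have AK: "A - K \<in> sets \<nu>" "measure \<nu> (A - K) < \<delta>"
      using finite_measure_Diff[of A K] K A b Km by auto
    define \<beta> where "\<beta> = density \<nu> (indicator (A - K))"
    have \<beta>b: "sets \<beta> = sets borel" by (simp add: \<beta>_def b)
    have \<beta>: "measure \<beta> X = measure \<nu> ((A - K) \<inter> X)" if "X \<in> sets borel" for X
      unfolding \<beta>_def measure_def using emeasure_restricted[OF AK(1)] that b by simp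
    have "finite_measure \<beta>"
      unfolding \<beta>_def by (rule finite_measureI) (use AK emeasure_restricted[OF AK(1) sets.top] in simp)
    then have "\<exists>S\<in>sets borel. Z b' j \<subseteq> S \<and> measure \<nu> S \<le> real (Suc j) * real N * measure \<beta> UNIV"
    proof (intro weak_type_boundD[OF N assms(1) _ b \<beta>b])
      fix z assume z: "z \<in> Z b' j"
      then have "open (- K)" "z \<in> - K" using K by (auto simp: Z_def compact_imp_closed)
      then obtain d where d: "d > 0" "ball z d \<subseteq> - K" by (meson openE)
      have "\<not> (\<forall>\<^sub>F r in at_right 0. ?q z r < 1 / Suc j)" using z by (simp add: Z_def)
      then have "\<not> (\<forall>r>0. r < min d 1 \<longrightarrow> ?q z r < 1 / Suc j)"
        unfolding eventually_at_right_field using d(1) by (auto simp del: min_less_iff_conj)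
      then obtain r where r: "0 < r" "r < d" "r < 1" "1 / Suc j \<le> ?q z r" by force
      have pos: "measure \<nu> (ball z r) > 0"
      proof (rule ccontr)
        assume "\<not> ?thesis"
        then have "measure \<nu> (ball z r) = 0" by (simp add: zero_less_measure_iff)
        then show False using r(4) by simp
      qed
      have "(A - K) \<inter> ball z r = A \<inter> ball z r" using d r by force
      then have "measure \<beta> (ball z r) = measure \<nu> (A \<inter> ball z r)" using \<beta>[of "ball z r"] by simp
      then have "measure \<nu> (ball z r) \<le> real (Suc j) * measure \<beta> (ball z r)"
        using r(4) pos by (simp add: field_simps)
      then show "\<exists>r. 0 < r \<and> r < 1 \<and> measure \<nu> (ball z r) \<le> real (Suc j) * measure \<beta> (ball z r)"
        using r by blast
    qed (auto simp: Z_def intro!: bounded_subset[OF bounded_cball[of 0]])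
    then obtain S where S: "S \<in> sets borel" "Z b' j \<subseteq> S" "measure \<nu> S \<le> real (Suc j) * real N * measure \<beta> UNIV"
      by blast
    note S(3)
    also have "measure \<beta> UNIV \<le> \<delta>" using \<beta>[of UNIV] AK by simp
    then have "real (Suc j) * real N * measure \<beta> UNIV \<le> real (Suc j) * real N * \<delta>"
      by (intro mult_left_mono) auto
    also have "\<dots> \<le> (real (Suc j) * real N + 1) * \<delta>" using \<delta> by (intro mult_right_mono) auto
    also have "\<dots> = e"
    proof -
      have "0 < real (Suc j) * real N + 1"
        by (intro add_nonneg_pos mult_nonneg_nonneg of_nat_0_le_iff zero_less_one)
      then show ?thesis unfolding \<delta>_def by simp
    qed
    finally show "\<exists>S\<in>sets \<nu>. Z b' j \<subseteq> S \<and> measure \<nu> S \<le> e" using S b by auto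
  qed
  then have "AE z in \<nu>. \<forall>b' j. z \<notin> Z b' j" by (simp add: AE_all_countable)
  then show ?thesis
  proof (eventually_elim, intro impI)
    fix z assume z: "\<forall>b' j. z \<notin> Z b' j" "z \<notin> A"
    obtain b' where b': "norm z \<le> real b'" using real_arch_simple by blast
    have ev: "\<forall>\<^sub>F r in at_right 0. ?q z r < 1 / Suc j" for j
      using z b' by (auto simp: Z_def)
    show "(?q z \<longlongrightarrow> 0) (at_right 0)"
    proof (rule tendstoI)
      fix e :: real assume "e > 0"
      then obtain j where "1 / Suc j < e" using reals_Archimedean by (auto simp: divide_inverse)
      then show "\<forall>\<^sub>F r in at_right 0. dist (?q z r) 0 < e"
        using ev[of j] by (auto elim!: eventually_mono)
    qed
  qed
qed

lemma lebesgue_density: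
  fixes \<nu> :: "'a::euclidean_space measure"
  assumes fin: "finite_measure \<nu>" and b: "sets \<nu> = sets borel" and A: "A \<in> sets borel"
  shows "AE z in \<nu>. ((\<lambda>r. measure \<nu> (A \<inter> ball z r) / measure \<nu> (ball z r)) \<longlongrightarrow> indicator A z) (at_right 0)"
proof -
  interpret finite_measure \<nu> by fact
  have "AE z in \<nu>. z \<notin> A \<longrightarrow> ((\<lambda>r. measure \<nu> (A \<inter> ball z r) / measure \<nu> (ball z r)) \<longlongrightarrow> 0) (at_right 0)"
    "AE z in \<nu>. z \<notin> - A \<longrightarrow> ((\<lambda>r. measure \<nu> (- A \<inter> ball z r) / measure \<nu> (ball z r)) \<longlongrightarrow> 0) (at_right 0)"
    using density_at_outside_points[OF fin b A] density_at_outside_points[OF fin b, of "- A"] A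
    by (blast, simp)
  then show ?thesis using AE_ball_pos[OF fin b]
  proof eventually_elim
    case (elim z)
    show ?case
    proof (cases "z \<in> A")
      case True
      have eq: "measure \<nu> (A \<inter> ball z r) / measure \<nu> (ball z r) = 1 - measure \<nu> (- A \<inter> ball z r) / measure \<nu> (ball z r)"
        if "r > 0" for r
      proof -
        have "measure \<nu> (ball z r) = measure \<nu> (A \<inter> ball z r) + measure \<nu> (- A \<inter> ball z r)"
          using A b by (subst finite_measure_Union[symmetric]) (auto intro!: arg_cong[of _ _ "measure \<nu>"])
        moreover have "measure \<nu> (ball z r) \<noteq> 0" using elim(3) that by force
        ultimately show ?thesis by (simp add: eq_diff_eq flip: add_divide_distrib)
      qed
      have "((\<lambda>r. 1 - measure \<nu> (- A \<inter> ball z r) / measure \<nu> (ball z r)) \<longlongrightarrow> 1 - 0) (at_right 0)"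
        using elim(2) True by (intro tendsto_intros) auto
      moreover have "\<forall>\<^sub>F r in at_right 0. 1 - measure \<nu> (- A \<inter> ball z r) / measure \<nu> (ball z r)
          = measure \<nu> (A \<inter> ball z r) / measure \<nu> (ball z r)"
        using eventually_at_right_less[of 0] by eventually_elim (simp add: eq)
      ultimately show ?thesis using True by (auto intro: Lim_transform_eventually)
    qed (use elim in auto)
  qed
qed

section \<open>Conditional probabilities as limits over balls\<close>

definition factor_ball :: "'a measure \<Rightarrow> ('a \<Rightarrow> 'b::metric_space) \<Rightarrow> 'a \<Rightarrow> real \<Rightarrow> 'a set" where
  "factor_ball M s x r = {y \<in> space M. dist (s y) (s x) < r}"

lemma factor_ball_eq: "factor_ball M s x r = s -` ball (s x) r \<inter> space M"
  by (auto simp: factor_ball_def dist_commute)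

lemma factor_ball_sets [measurable]:
  fixes s :: "'a \<Rightarrow> 'b::euclidean_space"
  assumes [measurable]: "s \<in> borel_measurable M"
  shows "factor_ball M s x r \<in> sets M"
  unfolding factor_ball_eq by measurable

lemma subalgebra_vimage:
  assumes "s \<in> measurable M N"
  shows "subalgebra M (vimage_algebra (space M) s N)"
  using assms measurable_space[OF assms] unfolding subalgebra_def
  by (auto simp: sets_vimage_algebra2 intro: measurable_sets)

text \<open>Convergence \<open>\<phi> r x \<longlongrightarrow> \<Phi> x\<close> is turned into an error sequence \<open>e N x\<close> that controls all scales
  below \<open>\<tau> N\<close> at once and is dominated. Left continuity in \<open>r\<close> lets rational scales
  suffice, so that the supremum is measurable.\<close>

lemma (in prob_space) maximal_deviation:
  fixes \<phi> :: "real \<Rightarrow> 'a \<Rightarrow> real"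
  assumes \<phi>: "\<And>r. 0 < r \<Longrightarrow> \<phi> r \<in> borel_measurable M" and \<Phi> [measurable]: "\<Phi> \<in> borel_measurable M"
    and H [measurable]: "H \<in> borel_measurable M"
    and bd: "AE x in M. \<forall>r. 0 < r \<and> r < 1 \<longrightarrow> \<bar>\<phi> r x\<bar> \<le> H x"
    and lim: "AE x in M. ((\<lambda>r. \<phi> r x) \<longlongrightarrow> \<Phi> x) (at_right 0)"
    and left: "AE x in M. \<forall>r. 0 < r \<and> r < 1 \<longrightarrow> ((\<lambda>t. \<phi> t x) \<longlongrightarrow> \<phi> r x) (at_left r)"
    and H0: "\<And>x. 0 \<le> H x"
    and \<tau>: "\<And>N. 0 < \<tau> N \<and> \<tau> N \<le> 1" "\<tau> \<longlonglongrightarrow> 0"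
  shows "\<exists>e. (\<forall>N. e N \<in> borel_measurable M) \<and> (\<forall>N x. 0 \<le> e N x \<and> e N x \<le> 2 * H x) \<and>
    (AE x in M. (\<lambda>N. e N x) \<longlonglongrightarrow> 0) \<and>
    (AE x in M. \<forall>N r. 0 < r \<and> r < \<tau> N \<longrightarrow> \<bar>\<phi> r x - \<Phi> x\<bar> \<le> e N x)"
proof -
  define E where "E N x = (SUP q\<in>\<rat> \<inter> {0<..<\<tau> N}. ennreal \<bar>\<phi> q x - \<Phi> x\<bar>)" for N :: nat and x
  have E [measurable]: "E N \<in> borel_measurable M" for N
    unfolding E_def
  proof (rule borel_measurable_SUP)
    fix q assume "q \<in> \<rat> \<inter> {0<..<\<tau> N}"
    then have [measurable]: "\<phi> q \<in> borel_measurable M" using \<phi> by simp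
    show "(\<lambda>x. ennreal \<bar>\<phi> q x - \<Phi> x\<bar>) \<in> borel_measurable M" by measurable
  qed (simp add: countable_rat)
  define e where "e N x = enn2real (min (ennreal (2 * H x)) (E N x))" for N x
  have [measurable]: "e N \<in> borel_measurable M" for N unfolding e_def by measurable
  moreover have "0 \<le> e N x \<and> e N x \<le> 2 * H x" for N x
  proof -
    have "e N x \<le> enn2real (ennreal (2 * H x))" unfolding e_def by (intro enn2real_mono) auto
    then show ?thesis using H0[of x] by (simp add: e_def)
  qed
  moreover have "AE x in M. (\<lambda>N. e N x) \<longlonglongrightarrow> 0 \<and> (\<forall>N r. 0 < r \<and> r < \<tau> N \<longrightarrow> \<bar>\<phi> r x - \<Phi> x\<bar> \<le> e N x)"
    using bd lim left
  proof eventually_elim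
    case (elim x)
    have "\<bar>\<Phi> x\<bar> \<le> H x"
    proof (rule tendsto_upperbound[OF tendsto_rabs[OF elim(2)]])
      show "\<forall>\<^sub>F r in at_right 0. \<bar>\<phi> r x\<bar> \<le> H x"
        unfolding eventually_at_right_field using elim(1) by (intro exI[of _ 1]) auto
    qed simp
    then have dev: "\<bar>\<phi> r x - \<Phi> x\<bar> \<le> 2 * H x" if "0 < r" "r < 1" for r
      using elim(1)[rule_format, of r] that by linarith
    have E_le: "E N x \<le> ennreal (2 * H x)" for N
      unfolding E_def using \<tau>(1)[of N] by (intro SUP_least ennreal_leI dev) auto
    then have e_eq: "ennreal (e N x) = E N x" for N
      by (simp add: e_def min_absorb2 ennreal_enn2real_if order_le_less_trans[OF E_le[of N]] less_top)
    have rat: "\<bar>\<phi> q x - \<Phi> x\<bar> \<le> e N x" if "q \<in> \<rat>" "0 < q" "q < \<tau> N" for q N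
    proof -
      have "ennreal \<bar>\<phi> q x - \<Phi> x\<bar> \<le> E N x" unfolding E_def using that by (intro SUP_upper) auto
      then show ?thesis unfolding e_eq[symmetric] by (simp add: e_def)
    qed
    have "\<bar>\<phi> r x - \<Phi> x\<bar> \<le> e N x" if r: "0 < r" "r < \<tau> N" for r N
    proof (rule ccontr)
      assume *: "\<not> ?thesis"
      have "((\<lambda>t. \<phi> t x) \<longlongrightarrow> \<phi> r x) (at_left r)" using elim(3) r \<tau>(1)[of N] by simp
      then have "((\<lambda>t. \<bar>\<phi> t x - \<Phi> x\<bar>) \<longlongrightarrow> \<bar>\<phi> r x - \<Phi> x\<bar>) (at_left r)" by (intro tendsto_intros)
      then have "\<forall>\<^sub>F t in at_left r. e N x < \<bar>\<phi> t x - \<Phi> x\<bar>" using * by (intro order_tendstoD(1)) auto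
      then obtain b where b: "b < r" "\<And>t. b < t \<Longrightarrow> t < r \<Longrightarrow> e N x < \<bar>\<phi> t x - \<Phi> x\<bar>"
        by (auto simp: eventually_at_left_field)
      obtain q where "q \<in> \<rat>" "max b 0 < q" "q < r" using Rats_dense_in_real[of "max b 0" r] b r by auto
      then show False using b(2)[of q] rat[of q N] r by simp
    qed
    moreover have "(\<lambda>N. e N x) \<longlonglongrightarrow> 0"
    proof (rule tendstoI)
      fix \<eta> :: real assume \<eta>: "\<eta> > 0"
      have "\<forall>\<^sub>F r in at_right 0. dist (\<phi> r x) (\<Phi> x) < \<eta> / 2"
        by (rule tendstoD[OF elim(2)]) (use \<eta> in simp)
      then obtain b where b: "b > 0" "\<And>t. 0 < t \<Longrightarrow> t < b \<Longrightarrow> \<bar>\<phi> t x - \<Phi> x\<bar> < \<eta> / 2"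
        by (auto simp: eventually_at_right_field dist_real_def)
      have "\<forall>\<^sub>F N in sequentially. \<tau> N < b" using order_tendstoD(2)[OF \<tau>(2)] b by simp
      then show "\<forall>\<^sub>F N in sequentially. dist (e N x) 0 < \<eta>"
      proof eventually_elim
        case (elim N)
        have "E N x \<le> ennreal (\<eta> / 2)"
          unfolding E_def using b elim by (intro SUP_least ennreal_leI less_imp_le) auto
        then have "e N x \<le> \<eta> / 2" unfolding e_eq[symmetric] using \<eta> by simp
        then show ?case using \<eta> by (simp add: e_def)
      qed
    qed
    ultimately show ?case by blast
  qed
  ultimately show ?thesis by (intro exI[of _ e]) auto
qed

text \<open>A Euclidean space valued map on a probability space. Points are compared only through the map,
  so \<open>factor_ball\<close> is the preimage of a ball, and \<open>F\<close> is the \<open>\<sigma>\<close>-algebra generated by the map.\<close>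

locale euclidean_factor = prob_space M for M :: "'a measure" +
  fixes s :: "'a \<Rightarrow> 'b::euclidean_space"
  assumes s [measurable]: "s \<in> borel_measurable M"
begin

abbreviation "F \<equiv> vimage_algebra (space M) s borel"

sublocale F: finite_measure_subalgebra M F
  by unfold_locales (rule subalgebra_vimage[OF s])

abbreviation "\<nu> \<equiv> distr M borel s"

lemma finite_image_measure: "finite_measure \<nu>"
  by (rule finite_measure_distr) simp

lemma AE_factor_ball_pos: "AE x in M. \<forall>r>0. 0 < prob (factor_ball M s x r)"
proof -
  have "AE z in \<nu>. \<forall>r>0. 0 < measure \<nu> (ball z r)"
    by (rule AE_ball_pos) (auto intro: finite_image_measure)
  from AE_distrD[OF s this] show ?thesis
    by (simp add: measure_distr factor_ball_eq)
qed

abbreviation "proportion A x r \<equiv> prob (A \<inter> factor_ball M s x r) / prob (factor_ball M s x r)"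

lemma density_factor_ball:
  assumes V: "V \<in> sets F"
  shows "AE x in M. ((\<lambda>r. proportion V x r) \<longlongrightarrow> indicator V x) (at_right 0)"
proof -
  obtain B where B: "B \<in> sets borel" "V = s -` B \<inter> space M"
    using V by (auto simp: sets_vimage_algebra2)
  have "AE z in \<nu>. ((\<lambda>r. measure \<nu> (B \<inter> ball z r) / measure \<nu> (ball z r)) \<longlongrightarrow> indicator B z) (at_right 0)"
    by (rule lebesgue_density) (auto intro: finite_image_measure B)
  from AE_distrD[OF s this] AE_space show ?thesis
  proof eventually_elim
    case (elim x)
    have "s -` (B \<inter> ball (s x) r) \<inter> space M = V \<inter> factor_ball M s x r" for r
      by (auto simp: factor_ball_eq B)
    moreover have "indicator B (s x) = (indicator V x :: real)"
      using elim(2) by (simp add: B indicator_def)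
    ultimately show ?case using elim(1) B(1) by (simp add: measure_distr factor_ball_eq)
  qed
qed

text \<open>On a level set \<open>V\<close> where the conditional probability \<open>P\<close> of \<open>A\<close> is within \<open>1 / (n + 1)\<close> of a
  constant, almost every point is a density point of \<open>V\<close>. There the proportion of \<open>A\<close> in a small
  ball, which is the average of \<open>P\<close> over the ball, is close to that constant.\<close>

lemma cond_prob_limit:
  assumes A [measurable]: "A \<in> sets M"
  shows "AE x in M. ((\<lambda>r. proportion A x r) \<longlongrightarrow>
    real_cond_exp M F (indicator A) x) (at_right 0)"
proof -
  define P where "P = real_cond_exp M F (indicator A)"
  have int: "integrable M (indicator A :: 'a \<Rightarrow> real)" by (rule integrable_real_indicator) (auto simp: less_top[symmetric])
  have intP: "integrable M P" unfolding P_def by (rule F.real_cond_exp_int(1)[OF int])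
  have PF [measurable]: "P \<in> borel_measurable F" unfolding P_def by simp
  have P01: "AE x in M. 0 \<le> P x \<and> P x \<le> 1"
    using F.real_cond_exp_ge_c[OF int, of 0] F.real_cond_exp_le_c[OF int, of 1]
    by (auto simp: P_def indicator_def)
  define V where "V n k = {x \<in> space M. real k / real (Suc n) \<le> P x \<and> P x < (real k + 1) / real (Suc n)}"
    for n k :: nat
  have V [measurable]: "V n k \<in> sets F" for n k
  proof -
    have "V n k = {x \<in> space F. real k / real (Suc n) \<le> P x \<and> P x < (real k + 1) / real (Suc n)}"
      by (simp add: V_def)
    also have "\<dots> \<in> sets F" by measurable
    finally show ?thesis .
  qed
  have VM [measurable]: "V n k \<in> sets M" for n k using V F.subalg by (auto simp: subalgebra_def)
  have key: "\<bar>prob (A \<inter> U) - real k / real (Suc n) * prob U\<bar> \<le> prob U / real (Suc n) + (prob U - prob (V n k \<inter> U))"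
    if U [measurable]: "U \<in> sets F" and k: "k \<le> Suc n" for U n k
  proof -
    have UM [measurable]: "U \<in> sets M" using U F.subalg by (auto simp: subalgebra_def)
    have "(\<integral>x\<in>U. indicator A x \<partial>M) = (\<integral>x\<in>U. P x \<partial>M)"
      unfolding P_def by (rule F.real_cond_exp_intA[OF int U])
    moreover have "(\<integral>x\<in>U. indicator A x \<partial>M) = prob (A \<inter> U)"
      by (simp add: set_lebesgue_integral_def flip: indicator_inter_arith)
         (simp add: Int_commute)
    ultimately have *: "prob (A \<inter> U) = (\<integral>x. indicator U x * P x \<partial>M)"
      by (simp add: set_lebesgue_integral_def)
    have iU: "integrable M (\<lambda>x. indicator U x * P x)"
      using integrable_real_mult_indicator[OF UM intP] by (simp add: mult.commute)
    have "prob (A \<inter> U) - real k / real (Suc n) * prob U = (\<integral>x. indicator U x * P x - real k / real (Suc n) * indicator U x \<partial>M)"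
      using iU by (simp add: * less_top[symmetric])
    also have "\<bar>\<dots>\<bar> \<le> (\<integral>x. \<bar>indicator U x * P x - real k / real (Suc n) * indicator U x\<bar> \<partial>M)"
      by (rule integral_abs_bound)
    also have "\<dots> \<le> (\<integral>x. indicator U x / real (Suc n) + (indicator U x - indicator (V n k \<inter> U) x) \<partial>M)"
    proof (rule integral_mono_AE)
      show "AE x in M. \<bar>indicator U x * P x - real k / real (Suc n) * indicator U x\<bar>
          \<le> indicator U x / real (Suc n) + (indicator U x - indicator (V n k \<inter> U) x)"
        using P01 AE_space
      proof eventually_elim
        case (elim x)
        have k1: "real k / real (Suc n) \<le> 1" "0 \<le> real k / real (Suc n)" using k by auto
        show ?case
        proof (cases "x \<in> U"; cases "x \<in> V n k")
          assume "x \<in> U" "x \<notin> V n k"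
          moreover have "\<bar>P x - real k / real (Suc n)\<bar> \<le> 1" using elim k1 by linarith
          then have "\<bar>P x - real k / real (Suc n)\<bar> \<le> 1 / real (Suc n) + 1"
            by (rule order_trans) simp
          ultimately show ?thesis by simp
        next
          assume "x \<in> U" "x \<in> V n k"
          moreover have "(real k + 1) / real (Suc n) = real k / real (Suc n) + 1 / real (Suc n)"
            by (rule add_divide_distrib)
          ultimately show ?thesis by (simp add: V_def abs_le_iff)
        qed auto
      qed
    qed (use iU in \<open>auto simp: less_top[symmetric] intro!: integrable_abs\<close>)
    also have "\<dots> = prob U / real (Suc n) + (prob U - prob (V n k \<inter> U))"
      by (simp add: less_top[symmetric])
    finally show ?thesis .
  qed
  have "AE x in M. \<forall>n k. ((\<lambda>r. proportion (V n k) x r) \<longlongrightarrow> indicator (V n k) x) (at_right 0)"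
    using density_factor_ball[OF V] by (simp add: AE_all_countable)
  then have "AE x in M. ((\<lambda>r. proportion A x r) \<longlongrightarrow> P x) (at_right 0)"
    using P01 AE_space AE_factor_ball_pos
  proof eventually_elim
    case (elim x)
    show ?case
    proof (rule tendstoI)
      fix e :: real assume "e > 0"
      then obtain n where n: "3 / Suc n < e"
        using reals_Archimedean[of "e/3"] by (auto simp: field_simps)
      define k where "k = nat \<lfloor>P x * Suc n\<rfloor>"
      have kk: "real k \<le> P x * Suc n" "P x * Suc n < real k + 1" using elim(2) by (auto simp: k_def)
      have "P x * Suc n \<le> Suc n" using elim(2) by (intro mult_left_le_one_le) auto
      then have k: "k \<le> Suc n" using kk by linarith
      have k2: "real k / Suc n \<le> P x" "P x < (real k + 1) / Suc n"
        using kk by (simp_all add: pos_divide_le_eq pos_less_divide_eq)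
      then have "x \<in> V n k" using elim(3) by (simp add: V_def)
      then have "((\<lambda>r. proportion (V n k) x r) \<longlongrightarrow> 1) (at_right 0)"
        using elim(1) by (metis indicator_simps(1))
      then have "\<forall>\<^sub>F r in at_right 0. proportion (V n k) x r > 1 - 1 / Suc n"
        by (rule order_tendstoD) simp
      then show "\<forall>\<^sub>F r in at_right 0. dist (proportion A x r) (P x) < e"
        using eventually_at_right_less[of 0]
      proof eventually_elim
        case (elim r)
        let ?U = "factor_ball M s x r"
        have U: "?U \<in> sets F" unfolding factor_ball_eq
          by (rule in_vimage_algebra) simp
        have pos: "prob ?U > 0" using \<open>\<forall>r>0. 0 < prob (factor_ball M s x r)\<close> elim by blast
        have "\<bar>prob (A \<inter> ?U) / prob ?U - real k / real (Suc n)\<bar> = \<bar>prob (A \<inter> ?U) - real k / real (Suc n) * prob ?U\<bar> / prob ?U"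
        proof -
          have "prob (A \<inter> ?U) / prob ?U - real k / real (Suc n) = (prob (A \<inter> ?U) - real k / real (Suc n) * prob ?U) / prob ?U"
            using pos by (simp add: diff_divide_distrib)
          then show ?thesis using pos by (simp add: abs_divide)
        qed
        also have "\<dots> \<le> (prob ?U / real (Suc n) + (prob ?U - prob (V n k \<inter> ?U))) / prob ?U"
          by (intro divide_right_mono key[OF U k]) simp
        also have "\<dots> = 1 / Suc n + (1 - prob (V n k \<inter> ?U) / prob ?U)"
          using pos by (simp add: add_divide_distrib diff_divide_distrib)
        also have "\<dots> < 1 / Suc n + 1 / Suc n" using elim by simp
        finally have "\<bar>prob (A \<inter> ?U) / prob ?U - real k / real (Suc n)\<bar> < 1 / Suc n + 1 / Suc n" .
        moreover have "\<bar>real k / real (Suc n) - P x\<bar> \<le> 1 / Suc n"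
          using k2 by (simp add: add_divide_distrib)
        ultimately show ?case using n by (simp add: dist_real_def) 
      qed
    qed
  qed
  then show ?thesis by (simp add: P_def)
qed

lemma cond_prob_pos:
  assumes A [measurable]: "A \<in> sets M"
  shows "AE x in M. x \<in> A \<longrightarrow> 0 < real_cond_exp M F (indicator A) x"
proof -
  define P where "P = real_cond_exp M F (indicator A)"
  have int: "integrable M (indicator A :: 'a \<Rightarrow> real)" by (rule integrable_real_indicator) (auto simp: less_top[symmetric])
  have intP: "integrable M P" unfolding P_def by (rule F.real_cond_exp_int(1)[OF int])
  have PF [measurable]: "P \<in> borel_measurable F" unfolding P_def by simp
  define U where "U = {x \<in> space F. P x \<le> 0}"
  have U [measurable]: "U \<in> sets F" unfolding U_def by measurable
  have UM [measurable]: "U \<in> sets M" using U F.subalg by (auto simp: subalgebra_def)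
  have "prob (A \<inter> U) = (\<integral>x\<in>U. indicator A x \<partial>M)"
    by (simp add: set_lebesgue_integral_def flip: indicator_inter_arith)
       (simp add: Int_commute)
  also have "\<dots> = (\<integral>x\<in>U. P x \<partial>M)"
    unfolding P_def by (rule F.real_cond_exp_intA[OF int U])
  also have "\<dots> \<le> (\<integral>x\<in>U. 0 \<partial>M)" unfolding set_lebesgue_integral_def
  proof (rule integral_mono)
    show "integrable M (\<lambda>x. indicator U x *\<^sub>R P x)"
      using integrable_real_mult_indicator[OF UM intP] by (simp add: mult.commute)
  qed (auto simp: U_def indicator_def)
  finally have "prob (A \<inter> U) = 0" by (simp add: measure_le_0_iff)
  then have "AE x in M. x \<notin> A \<inter> U" by (intro AE_not_in) (simp add: null_sets_def emeasure_eq_measure)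
  then show ?thesis using AE_space by eventually_elim (auto simp: U_def P_def)
qed

text \<open>The limit of the proportions is positive on \<open>A\<close>, and the mass of \<open>A\<close> in a ball only grows with the
  radius.\<close>

lemma AE_atom_factor_ball_pos:
  assumes A [measurable]: "A \<in> sets M"
  shows "AE x in M. x \<in> A \<longrightarrow> (\<forall>r>0. 0 < prob (A \<inter> factor_ball M s x r))"
  using cond_prob_limit[OF A] cond_prob_pos[OF A]
proof (eventually_elim, intro impI allI)
  fix x and r :: real
  assume lim: "((\<lambda>r. proportion A x r) \<longlongrightarrow>
    real_cond_exp M F (indicator A) x) (at_right 0)"
    and "x \<in> A \<longrightarrow> 0 < real_cond_exp M F (indicator A) x" "x \<in> A" and r: "r > 0"
  then have "\<forall>\<^sub>F r in at_right 0. proportion A x r > 0"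
    by (intro order_tendstoD(1)[OF lim]) simp
  then obtain b where b: "b > 0" "\<And>t. 0 < t \<Longrightarrow> t < b \<Longrightarrow> prob (A \<inter> factor_ball M s x t) / prob (factor_ball M s x t) > 0"
    by (auto simp: eventually_at_right_field)
  define t where "t = min (b/2) r"
  have t: "0 < t" "t < b" "t \<le> r" using b(1) r by (auto simp: t_def)
  have "prob (A \<inter> factor_ball M s x t) \<noteq> 0" using b(2)[OF t(1,2)] by auto
  then have "0 < prob (A \<inter> factor_ball M s x t)" by (simp add: zero_less_measure_iff)
  also have "\<dots> \<le> prob (A \<inter> factor_ball M s x r)"
    using t by (intro finite_measure_mono) (auto simp: factor_ball_def)
  finally show "0 < prob (A \<inter> factor_ball M s x r)" .
qed

lemma prob_factor_ball_measurable [measurable]: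
  assumes A [measurable]: "A \<in> sets M"
  shows "(\<lambda>x. prob (A \<inter> factor_ball M s x r)) \<in> borel_measurable M"
proof -
  define Q where "Q = {p \<in> space (M \<Otimes>\<^sub>M M). snd p \<in> A \<and> dist (s (snd p)) (s (fst p)) < r}"
  have "Q \<in> sets (M \<Otimes>\<^sub>M M)" unfolding Q_def by measurable
  then have "(\<lambda>x. emeasure M (Pair x -` Q)) \<in> borel_measurable M"
    by (rule measurable_emeasure_Pair)
  then have "(\<lambda>x. enn2real (emeasure M (Pair x -` Q))) \<in> borel_measurable M" by measurable
  moreover have "Pair x -` Q = A \<inter> factor_ball M s x r" if "x \<in> space M" for x
    using that sets.sets_into_space[OF A] by (auto simp: Q_def space_pair_measure factor_ball_def)
  ultimately show ?thesis
    unfolding measure_def by (subst measurable_cong[where g = "\<lambda>x. enn2real (emeasure M (Pair x -` Q))"]) auto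
qed

lemma prob_factor_ball_left_continuous:
  assumes A [measurable]: "A \<in> sets M"
  shows "((\<lambda>t. prob (A \<inter> factor_ball M s x t)) \<longlongrightarrow> prob (A \<inter> factor_ball M s x r)) (at_left r)"
proof (rule tendsto_at_left_sequentially[of "r - 1"])
  fix S :: "nat \<Rightarrow> real" assume S: "\<And>n. S n < r" "incseq S" "S \<longlonglongrightarrow> r"
  have "(\<lambda>n. prob (A \<inter> factor_ball M s x (S n))) \<longlonglongrightarrow> prob (\<Union>n. A \<inter> factor_ball M s x (S n))"
  proof (rule finite_Lim_measure_incseq)
    show "incseq (\<lambda>n. A \<inter> factor_ball M s x (S n))"
      using S(2) by (fastforce simp: incseq_def factor_ball_def intro: order_less_le_trans)
  qed auto
  moreover have "(\<Union>n. A \<inter> factor_ball M s x (S n)) = A \<inter> factor_ball M s x r"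
  proof (intro set_eqI iffI)
    fix y assume y: "y \<in> A \<inter> factor_ball M s x r"
    then have "\<forall>\<^sub>F n in sequentially. dist (s y) (s x) < S n"
      by (intro order_tendstoD(1)[OF S(3)]) (auto simp: factor_ball_def)
    then obtain n where "dist (s y) (s x) < S n" by (auto simp: eventually_sequentially)
    then show "y \<in> (\<Union>n. A \<inter> factor_ball M s x (S n))" using y by (auto simp: factor_ball_def)
  qed (use S(1) in \<open>auto simp: factor_ball_def intro: less_trans\<close>)
  ultimately show "(\<lambda>n. prob (A \<inter> factor_ball M s x (S n))) \<longlonglongrightarrow> prob (A \<inter> factor_ball M s x r)" by simp
qed simp

text \<open>By the weak type inequality, the part of \<open>A\<close> near which \<open>A\<close> takes up at most the fraction
  \<open>exp (- n)\<close> of some ball is contained in a set \<open>G n\<close> of mass \<open>O(exp (- n))\<close>. The function counting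
  the \<open>n\<close> with \<open>x \<in> G n\<close> is integrable and dominates the information of \<open>A\<close> at all scales below \<open>1\<close>.\<close>

lemma log_ratio_majorant:
  assumes bd: "bounded (s ` space M)" and A [measurable]: "A \<in> sets M"
  shows "\<exists>H. integrable M H \<and> (\<forall>x. 0 \<le> H x) \<and>
    (AE x in M. x \<in> A \<longrightarrow> (\<forall>r. 0 < r \<and> r < 1 \<longrightarrow> - ln (proportion A x r) \<le> H x))"
proof -
  obtain N where N: "weak_type_bound TYPE('b) N" by (rule weak_type_maximal)
  define \<alpha> where "\<alpha> = distr (density M (indicator A)) borel s"
  have \<alpha>b: "sets \<alpha> = sets borel" by (simp add: \<alpha>_def)
  have em: "emeasure \<alpha> B = emeasure M (A \<inter> (s -` B \<inter> space M))" if [measurable]: "B \<in> sets borel" for B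
    unfolding \<alpha>_def by (subst emeasure_distr) (auto simp: emeasure_restricted)
  have \<alpha>: "measure \<alpha> B = prob (A \<inter> (s -` B \<inter> space M))" if "B \<in> sets borel" for B
    using em[OF that] by (simp add: measure_def)
  have "space \<alpha> = UNIV" by (simp add: \<alpha>_def)
  then have fin: "finite_measure \<alpha>" by (intro finite_measureI) (simp add: em)
  have \<nu>U: "measure \<nu> UNIV = 1" by (simp add: measure_distr prob_space)
  define Z where "Z n = {z \<in> s ` space M. \<exists>r. 0 < r \<and> r < 1 \<and> measure \<alpha> (ball z r) \<le> exp (- real n) * measure \<nu> (ball z r)}"
    for n :: nat
  have "\<forall>n. \<exists>S. S \<in> sets borel \<and> Z n \<subseteq> S \<and> measure \<alpha> S \<le> exp (- real n) * real N * measure \<nu> UNIV"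
  proof
    fix n
    have "\<exists>S\<in>sets borel. Z n \<subseteq> S \<and> measure \<alpha> S \<le> exp (- real n) * real N * measure \<nu> UNIV"
      by (rule weak_type_boundD[OF N fin finite_image_measure \<alpha>b]) (auto simp: Z_def intro: bounded_subset[OF bd])
    then show "\<exists>S. S \<in> sets borel \<and> Z n \<subseteq> S \<and> measure \<alpha> S \<le> exp (- real n) * real N * measure \<nu> UNIV" by blast
  qed
  then obtain S where S [measurable]: "\<And>n. S n \<in> sets borel" and ZS: "\<And>n. Z n \<subseteq> S n"
    and S3: "\<And>n. measure \<alpha> (S n) \<le> exp (- real n) * real N"
    unfolding \<nu>U by (auto dest!: choice)
  define G where "G n = A \<inter> (s -` S n \<inter> space M)" for n
  have G [measurable]: "G n \<in> sets M" for n unfolding G_def by measurable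
  have Gp: "prob (G n) \<le> real N * exp (- 1) ^ n" for n
    using S3[of n] \<alpha>[OF S, of n] by (simp add: G_def mult.commute flip: exp_of_nat_mult)
  define He :: "'a \<Rightarrow> ennreal" where "He x = (\<Sum>n. indicator (G n) x)" for x
  have He [measurable]: "He \<in> borel_measurable M" unfolding He_def by measurable
  have "(\<integral>\<^sup>+x. He x \<partial>M) = (\<Sum>n. emeasure M (G n))" unfolding He_def
    by (subst nn_integral_suminf) auto
  also have "\<dots> \<le> (\<Sum>n. ennreal (real N * exp (- 1) ^ n))"
    by (intro suminf_le summableI) (auto simp: emeasure_eq_measure Gp intro!: ennreal_leI)
  also have "\<dots> < \<top>"
    by (subst less_top[symmetric], rule ennreal_suminf_neq_top) (auto intro!: summable_mult summable_geometric)
  finally have Hfin: "(\<integral>\<^sup>+x. He x \<partial>M) < \<top>" .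
  define H where "H x = enn2real (He x)" for x
  have "integrable M H"
  proof (rule integrableI_nonneg)
    have "(\<integral>\<^sup>+x. ennreal (H x) \<partial>M) \<le> (\<integral>\<^sup>+x. He x \<partial>M)"
      by (intro nn_integral_mono) (auto simp: H_def ennreal_enn2real_if)
    then show "(\<integral>\<^sup>+x. ennreal (H x) \<partial>M) < \<infinity>" using Hfin by (simp add: order_le_less_trans)
  qed (auto simp: H_def[abs_def])
  moreover have "AE x in M. He x \<noteq> \<infinity>" using Hfin by (intro nn_integral_PInf_AE) auto
  then have "AE x in M. x \<in> A \<longrightarrow> (\<forall>r. 0 < r \<and> r < 1 \<longrightarrow> - ln (proportion A x r) \<le> H x)"
    using AE_space
  proof (eventually_elim, intro impI allI)
    fix x and r :: real assume fin: "He x \<noteq> \<infinity>" and x: "x \<in> space M" "x \<in> A" and r: "0 < r \<and> r < 1"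
    define p where "p = proportion A x r"
    define v where "v = - ln p"
    have p0: "p \<ge> 0" by (simp add: p_def)
    have "v \<le> H x"
    proof (cases "p = 0 \<or> v \<le> 0")
      case True
      then have "v \<le> 0" by (auto simp: v_def)
      also have "0 \<le> H x" by (simp add: H_def)
      finally show ?thesis .
    next
      case False
      define n where "n = nat \<lfloor>v\<rfloor>"
      have n: "real n \<le> v" "v < real n + 1" using False by (auto simp: n_def)
      have "x \<in> G i" if "i \<le> n" for i
      proof -
        have "p = exp (- v)" using False p0 by (simp add: v_def)
        then have "p \<le> exp (- real i)" using n that by simp
        moreover have "prob (factor_ball M s x r) > 0"
          using False by (cases "prob (factor_ball M s x r) = 0") (auto simp: p_def zero_less_measure_iff)
        ultimately have "prob (A \<inter> factor_ball M s x r) \<le> exp (- real i) * prob (factor_ball M s x r)"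
          by (simp add: p_def pos_divide_le_eq)
        moreover have "measure \<alpha> (ball (s x) r) = prob (A \<inter> factor_ball M s x r)" by (simp add: \<alpha> factor_ball_eq)
        moreover have "measure \<nu> (ball (s x) r) = prob (factor_ball M s x r)" by (simp add: measure_distr factor_ball_eq)
        ultimately have "s x \<in> Z i" using x r by (auto simp: Z_def)
        then show ?thesis using ZS x by (auto simp: G_def)
      qed
      then have "(\<Sum>i\<le>n. indicator (G i) x :: ennreal) = (\<Sum>i\<le>n. 1)" by (intro sum.cong) auto
      moreover have "(\<Sum>i\<le>n. indicator (G i) x :: ennreal) \<le> He x"
        unfolding He_def by (intro sum_le_suminf summableI) auto
      ultimately have "ennreal (real (Suc n)) \<le> He x" by (simp add: ennreal_of_nat_eq_real_of_nat)
      then have "real (Suc n) \<le> H x" using fin unfolding H_def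
        by (metis enn2real_ennreal enn2real_mono infinity_ennreal_def less_top of_nat_0_le_iff)
      then show ?thesis using n by simp
    qed
    then show "- ln (proportion A x r) \<le> H x" by (simp add: v_def p_def)
  qed
  ultimately show ?thesis by (intro exI[of _ H]) (auto simp: H_def)
qed

text \<open>The information of the partition at scale \<open>r\<close>: the counterpart of \<open>cond_info\<close> in which conditional
  probabilities are replaced by proportions in balls.\<close>

definition ball_info :: "'a set set \<Rightarrow> real \<Rightarrow> 'a \<Rightarrow> real" where
  "ball_info \<R> r x = - (\<Sum>A\<in>\<R>. indicator A x * ln (proportion A x r))"

lemma sum_indicator_partition:
  fixes g :: "'a set \<Rightarrow> real"
  assumes "partition_on (space M) \<R>" "finite \<R>" "A \<in> \<R>" "x \<in> A"
  shows "(\<Sum>B\<in>\<R>. indicator B x * g B) = g A"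
proof -
  have "indicator B x * g B = (if B = A then g A else 0)" if "B \<in> \<R>" for B
    using partition_onD2[OF assms(1)] assms that by (auto simp: disjoint_def indicator_def)
  then have "(\<Sum>B\<in>\<R>. indicator B x * g B) = (\<Sum>B\<in>\<R>. if B = A then g A else 0)" by (intro sum.cong) auto
  then show ?thesis using assms by simp
qed

text \<open>The deviation from the limit is dominated and controlled over all scales below \<open>\<tau> N\<close> together. In
  the iteration the scales depend on the point, so a bound at a fixed sequence of scales would not do.\<close>

lemma information_limit:
  assumes bd: "bounded (s ` space M)"
    and \<R>: "finite \<R>" "partition_on (space M) \<R>" "\<R> \<subseteq> sets M"
    and \<tau>: "\<And>N. 0 < \<tau> N \<and> \<tau> N \<le> 1" "\<tau> \<longlonglongrightarrow> 0"
  shows "integrable M (cond_info M \<R> F)"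
    and "\<exists>e H. integrable M H \<and> (\<forall>N. e N \<in> borel_measurable M) \<and> (\<forall>N x. 0 \<le> e N x \<and> e N x \<le> H x) \<and>
      (AE x in M. (\<lambda>N. e N x) \<longlonglongrightarrow> 0) \<and>
      (AE x in M. \<forall>N r. 0 < r \<and> r < \<tau> N \<longrightarrow> \<bar>ball_info \<R> r x - cond_info M \<R> F x\<bar> \<le> e N x)"
proof -
  have \<R>m [measurable]: "A \<in> sets M" if "A \<in> \<R>" for A using \<R> that by auto
  have ex: "\<exists>A\<in>\<R>. x \<in> A" if "x \<in> space M" for x
    using partition_onD1[OF \<R>(2)] that by auto
  have "\<forall>A\<in>\<R>. \<exists>H. integrable M H \<and> (\<forall>x. 0 \<le> H x) \<and>
    (AE x in M. x \<in> A \<longrightarrow> (\<forall>r. 0 < r \<and> r < 1 \<longrightarrow> - ln (proportion A x r) \<le> H x))"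
    using log_ratio_majorant[OF bd] \<R>m by simp
  from bchoice[OF this] obtain h where h: "\<And>A. A \<in> \<R> \<Longrightarrow> integrable M (h A)" "\<And>A x. A \<in> \<R> \<Longrightarrow> 0 \<le> h A x"
    "\<And>A. A \<in> \<R> \<Longrightarrow> AE x in M. x \<in> A \<longrightarrow> (\<forall>r. 0 < r \<and> r < 1 \<longrightarrow> - ln (proportion A x r) \<le> h A x)"
    by blast
  define H where "H x = (\<Sum>A\<in>\<R>. h A x)" for x
  have H: "integrable M H" unfolding H_def using h by auto
  have [measurable]: "H \<in> borel_measurable M" using H by auto
  have H0: "0 \<le> H x" for x unfolding H_def using h by (auto intro: sum_nonneg)
  have pos: "AE x in M. \<forall>A\<in>\<R>. x \<in> A \<longrightarrow> (\<forall>r>0. 0 < prob (A \<inter> factor_ball M s x r))"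
    using AE_atom_factor_ball_pos \<R>m by (intro AE_finite_allI \<R>) auto
  have hA: "AE x in M. \<forall>A\<in>\<R>. x \<in> A \<longrightarrow> (\<forall>r. 0 < r \<and> r < 1 \<longrightarrow> - ln (proportion A x r) \<le> h A x)"
    using h(3) by (intro AE_finite_allI \<R>) auto
  have limA: "AE x in M. \<forall>A\<in>\<R>. ((\<lambda>r. proportion A x r) \<longlongrightarrow>
    real_cond_exp M F (indicator A) x) (at_right 0)"
    using cond_prob_limit \<R>m by (intro AE_finite_allI \<R>) auto
  have posA: "AE x in M. \<forall>A\<in>\<R>. x \<in> A \<longrightarrow> 0 < real_cond_exp M F (indicator A) x"
    using cond_prob_pos \<R>m by (intro AE_finite_allI \<R>) auto
  have bd': "AE x in M. \<forall>r. 0 < r \<and> r < 1 \<longrightarrow> \<bar>ball_info \<R> r x\<bar> \<le> H x"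
    using pos hA AE_space
  proof (eventually_elim, intro allI impI)
    fix x and r :: real
    assume *: "\<forall>A\<in>\<R>. x \<in> A \<longrightarrow> (\<forall>r>0. 0 < prob (A \<inter> factor_ball M s x r))"
      "\<forall>A\<in>\<R>. x \<in> A \<longrightarrow> (\<forall>r. 0 < r \<and> r < 1 \<longrightarrow> - ln (proportion A x r) \<le> h A x)"
      "x \<in> space M" and r: "0 < r \<and> r < 1"
    obtain A where A: "A \<in> \<R>" "x \<in> A" using ex *(3) by blast
    let ?p = "proportion A x r"
    have eq: "ball_info \<R> r x = - ln ?p"
      unfolding ball_info_def by (simp add: sum_indicator_partition[OF \<R>(2,1) A])
    have num: "0 < prob (A \<inter> factor_ball M s x r)" using * A r by blast
    have le: "prob (A \<inter> factor_ball M s x r) \<le> prob (factor_ball M s x r)" by (rule finite_measure_mono) auto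
    then have "0 < prob (factor_ball M s x r)" using num by linarith
    then have "0 < ?p" "?p \<le> 1" using num le by auto
    then have "0 \<le> - ln ?p" by simp
    moreover have "- ln ?p \<le> h A x" using *(2) A r by blast
    moreover have "h A x \<le> H x" unfolding H_def using h \<R> A by (intro member_le_sum) auto
    ultimately show "\<bar>ball_info \<R> r x\<bar> \<le> H x" unfolding eq by linarith
  qed
  have lim': "AE x in M. ((\<lambda>r. ball_info \<R> r x) \<longlongrightarrow> cond_info M \<R> F x) (at_right 0)"
    using limA posA AE_space
  proof eventually_elim
    case (elim x)
    obtain A where A: "A \<in> \<R>" "x \<in> A" using ex elim by blast
    have eq: "ball_info \<R> r x = - ln (proportion A x r)" for r
      unfolding ball_info_def by (simp add: sum_indicator_partition[OF \<R>(2,1) A])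
    have eq': "cond_info M \<R> F x = - ln (real_cond_exp M F (indicator A) x)"
      unfolding cond_info_def by (simp add: sum_indicator_partition[OF \<R>(2,1) A])
    have "0 < real_cond_exp M F (indicator A) x" using elim A by blast
    then show ?case unfolding eq eq' using elim A by (intro tendsto_intros) auto
  qed
  have left': "AE x in M. \<forall>r. 0 < r \<and> r < 1 \<longrightarrow> ((\<lambda>t. ball_info \<R> t x) \<longlongrightarrow> ball_info \<R> r x) (at_left r)"
    using pos AE_space
  proof (eventually_elim, intro allI impI)
    fix x and r :: real
    assume *: "\<forall>A\<in>\<R>. x \<in> A \<longrightarrow> (\<forall>r>0. 0 < prob (A \<inter> factor_ball M s x r))"
      "x \<in> space M" and r: "0 < r \<and> r < 1"
    obtain A where A: "A \<in> \<R>" "x \<in> A" using ex *(2) by blast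
    have eq: "ball_info \<R> r x = - ln (proportion A x r)" for r
      unfolding ball_info_def by (simp add: sum_indicator_partition[OF \<R>(2,1) A])
    have num: "0 < prob (A \<inter> factor_ball M s x r)" using * A r by blast
    have le: "prob (A \<inter> factor_ball M s x r) \<le> prob (factor_ball M s x r)" by (rule finite_measure_mono) auto
    then have den: "0 < prob (factor_ball M s x r)" using num by linarith
    have "((\<lambda>t. prob (space M \<inter> factor_ball M s x t)) \<longlongrightarrow> prob (space M \<inter> factor_ball M s x r)) (at_left r)"
      by (rule prob_factor_ball_left_continuous) simp
    then have l2: "((\<lambda>t. prob (factor_ball M s x t)) \<longlongrightarrow> prob (factor_ball M s x r)) (at_left r)"
      by (simp add: factor_ball_eq Int_absorb1 inf.absorb2)
    show "((\<lambda>t. ball_info \<R> t x) \<longlongrightarrow> ball_info \<R> r x) (at_left r)"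
      unfolding eq using num den by (intro tendsto_intros l2 prob_factor_ball_left_continuous \<R>m A) auto
  qed
  have m\<phi>: "ball_info \<R> r \<in> borel_measurable M" for r
  proof -
    have "(\<lambda>x. prob (space M \<inter> factor_ball M s x r)) \<in> borel_measurable M" by measurable
    then have [measurable]: "(\<lambda>x. prob (factor_ball M s x r)) \<in> borel_measurable M"
      by (simp add: factor_ball_eq Int_absorb1 inf.absorb2)
    show ?thesis unfolding ball_info_def by measurable
  qed
  have m\<Phi> [measurable]: "cond_info M \<R> F \<in> borel_measurable M"
    unfolding cond_info_def by measurable
  have "AE x in M. norm (cond_info M \<R> F x) \<le> norm (H x)"
    using bd' lim'
  proof eventually_elim
    case (elim x)
    have "\<bar>cond_info M \<R> F x\<bar> \<le> H x"
    proof (rule tendsto_upperbound[OF tendsto_rabs[OF elim(2)]])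
      show "\<forall>\<^sub>F r in at_right 0. \<bar>ball_info \<R> r x\<bar> \<le> H x"
        unfolding eventually_at_right_field using elim(1) by (intro exI[of _ 1]) auto
    qed simp
    then show ?case using H0[of x] by simp
  qed
  then show "integrable M (cond_info M \<R> F)" by (rule Bochner_Integration.integrable_bound[OF H m\<Phi>])
  obtain e where e: "\<forall>N. e N \<in> borel_measurable M" "\<forall>N x. 0 \<le> e N x \<and> e N x \<le> 2 * H x"
    "AE x in M. (\<lambda>N. e N x) \<longlonglongrightarrow> 0"
    "AE x in M. \<forall>N r. 0 < r \<and> r < \<tau> N \<longrightarrow> \<bar>ball_info \<R> r x - cond_info M \<R> F x\<bar> \<le> e N x"
    using maximal_deviation[OF m\<phi> m\<Phi> _ bd' lim' left' H0 \<tau>] by auto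
  show "\<exists>e H. integrable M H \<and> (\<forall>N. e N \<in> borel_measurable M) \<and> (\<forall>N x. 0 \<le> e N x \<and> e N x \<le> H x) \<and>
      (AE x in M. (\<lambda>N. e N x) \<longlonglongrightarrow> 0) \<and>
      (AE x in M. \<forall>N r. 0 < r \<and> r < \<tau> N \<longrightarrow> \<bar>ball_info \<R> r x - cond_info M \<R> F x\<bar> \<le> e N x)"
    by (rule exI[of _ e], rule exI[of _ "\<lambda>x. 2 * H x"]) (use e H in auto)
qed

end

section \<open>Ergodic theorems\<close>

locale measure_preserving_system = prob_space M for M :: "'a measure" +
  fixes T :: "'a \<Rightarrow> 'a"
  assumes T [measurable]: "T \<in> measurable M M" and distr_T: "distr M M T = M"
begin

abbreviation "\<I> \<equiv> invariant_sets M T"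

definition birkhoff_sum :: "('a \<Rightarrow> real) \<Rightarrow> nat \<Rightarrow> 'a \<Rightarrow> real" where
  "birkhoff_sum g n x = (\<Sum>k<n. g ((T ^^ k) x))"

lemma T_space: "x \<in> space M \<Longrightarrow> T x \<in> space M"
  using measurable_space[OF T] .

lemma funpow_space: "x \<in> space M \<Longrightarrow> (T ^^ n) x \<in> space M"
  by (induction n) (auto intro: T_space)

lemma funpow_measurable [measurable]: "(T ^^ n) \<in> measurable M M"
proof (induction n)
  case (Suc n)
  then show ?case using measurable_comp[OF Suc T] by simp
qed (simp add: id_def)

lemma AE_T: "AE x in M. P x \<Longrightarrow> AE x in M. P (T x)"
  using AE_distrD[OF T, of P] unfolding distr_T .

lemma AE_funpow: "AE x in M. P x \<Longrightarrow> AE x in M. \<forall>n. P ((T ^^ n) x)"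
proof -
  assume P: "AE x in M. P x"
  have "AE x in M. P ((T ^^ n) x)" for n
  proof (induction n)
    case (Suc n)
    then show ?case using AE_T[OF Suc] by (simp add: funpow_swap1)
  qed (use P in simp)
  then show ?thesis by (simp add: AE_all_countable)
qed

lemma integrable_T: "integrable M g \<Longrightarrow> integrable M (\<lambda>x. g (T x))" for g :: "'a \<Rightarrow> real"
  using integrable_distr[OF T, of g] by (simp add: distr_T)

lemma integral_T: "g \<in> borel_measurable M \<Longrightarrow> (\<integral>x. g (T x) \<partial>M) = (\<integral>x. g x \<partial>M)" for g :: "'a \<Rightarrow> real"
  using integral_distr[OF T, of g] by (simp add: distr_T)

lemma sets_invariant: "sets \<I> = {B \<in> sets M. T -` B \<inter> space M = B}"
proof -
  have "sigma_algebra (space M) {B \<in> sets M. T -` B \<inter> space M = B}"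
    unfolding sigma_algebra_iff2
  proof (intro conjI ballI allI impI)
    fix A :: "nat \<Rightarrow> 'a set" assume *: "range A \<subseteq> {B \<in> sets M. T -` B \<inter> space M = B}"
    then have "T -` (\<Union>n. A n) \<inter> space M = (\<Union>n. T -` A n \<inter> space M)" by auto
    also have "\<dots> = (\<Union>n. A n)" using * by auto
    finally have "T -` (\<Union>n. A n) \<inter> space M = (\<Union>n. A n)" .
    moreover have "(\<Union>n. A n) \<in> sets M" using * by (intro sets.countable_UN) auto
    ultimately show "(\<Union>n. A n) \<in> {B \<in> sets M. T -` B \<inter> space M = B}" by simp
  next
    fix B assume B: "B \<in> {B \<in> sets M. T -` B \<inter> space M = B}"
    then have "x \<in> B \<longleftrightarrow> T x \<in> B" if "x \<in> space M" for x using that by blast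
    then have "T -` (space M - B) \<inter> space M = space M - B" using T_space by blast
    then show "space M - B \<in> {B \<in> sets M. T -` B \<inter> space M = B}" using B by blast
  qed (use sets.sets_into_space in auto)
  then have "sigma_sets (space M) {B \<in> sets M. T -` B \<inter> space M = B} = {B \<in> sets M. T -` B \<inter> space M = B}"
    by (rule sigma_algebra.sigma_sets_eq)
  moreover have "{B \<in> sets M. T -` B \<inter> space M = B} \<subseteq> Pow (space M)" by blast
  ultimately show ?thesis unfolding invariant_sets_def by (simp only: sets_measure_of)
qed

lemma space_invariant: "space \<I> = space M"
  unfolding invariant_sets_def by (subst space_measure_of) (auto dest: sets.sets_into_space)

sublocale I: finite_measure_subalgebra M \<I>
  by unfold_locales (auto simp: subalgebra_def space_invariant sets_invariant)

lemma invariant_fun: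
  fixes g :: "'a \<Rightarrow> real"
  assumes [measurable]: "g \<in> borel_measurable \<I>" and x: "x \<in> space M"
  shows "g (T x) = g x"
proof -
  have "{y \<in> space \<I>. g y = g x} \<in> sets \<I>" by measurable
  then have "T -` {y \<in> space M. g y = g x} \<inter> space M = {y \<in> space M. g y = g x}"
    by (simp add: sets_invariant space_invariant)
  then show ?thesis using x by blast
qed

lemma invariant_fun_funpow:
  fixes g :: "'a \<Rightarrow> real"
  assumes "g \<in> borel_measurable \<I>" and "x \<in> space M"
  shows "g ((T ^^ n) x) = g x"
  by (induction n) (auto simp: invariant_fun[OF assms(1)] funpow_space assms)

lemma birkhoff_sum_measurable [measurable]:
  assumes [measurable]: "g \<in> borel_measurable M"
  shows "birkhoff_sum g n \<in> borel_measurable M"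
  unfolding birkhoff_sum_def by measurable

lemma birkhoff_sum_Suc: "birkhoff_sum g (Suc n) x = g x + birkhoff_sum g n (T x)"
  unfolding birkhoff_sum_def by (subst sum.lessThan_Suc_shift) (simp add: funpow_swap1)

text \<open>\<open>max_sum g n\<close> is the maximum of \<open>0\<close> and the first \<open>n\<close> Birkhoff sums of \<open>g\<close>; the recursion is the
  form in which Garsia's proof of the maximal ergodic theorem uses it.\<close>

primrec max_sum :: "('a \<Rightarrow> real) \<Rightarrow> nat \<Rightarrow> 'a \<Rightarrow> real" where
  "max_sum g 0 x = 0"
| "max_sum g (Suc n) x = max 0 (g x + max_sum g n (T x))"

lemma max_sum_nonneg: "0 \<le> max_sum g n x"
  by (cases n) auto

lemma max_sum_mono: "max_sum g n x \<le> max_sum g (Suc n) x"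
proof (induction n arbitrary: x)
  case (Suc n)
  have "max 0 (g x + max_sum g n (T x)) \<le> max 0 (g x + max_sum g (Suc n) (T x))"
    by (intro max.mono add_left_mono Suc.IH order_refl)
  then show ?case by (simp only: max_sum.simps(2)[of g _ x])
qed simp

lemma birkhoff_sum_le_max_sum: "birkhoff_sum g n x \<le> max_sum g n x"
proof (induction n arbitrary: x)
  case (Suc n)
  show ?case using Suc.IH[of "T x"] by (simp add: birkhoff_sum_Suc le_max_iff_disj)
qed (simp add: birkhoff_sum_def)

lemma integrable_max_sum: "integrable M g \<Longrightarrow> integrable M (max_sum g n)"
proof (induction n)
  case (Suc n)
  have "integrable M (\<lambda>x. g x + max_sum g n (T x))"
    by (rule Bochner_Integration.integrable_add[OF Suc.prems integrable_T[OF Suc.IH[OF Suc.prems]]])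
  then have "integrable M (\<lambda>x. max 0 (g x + max_sum g n (T x)))"
    by (rule integrable_max[rotated]) simp
  then show ?case by (simp add: max_sum.simps(2)[abs_def])
next
  case 0
  have "max_sum g 0 = (\<lambda>_. 0)" by (simp add: fun_eq_iff)
  then show ?case by simp
qed

text \<open>Where \<open>max_sum g n\<close> is positive it is at most \<open>g\<close> plus its own composition with \<open>T\<close>; elsewhere it
  vanishes. The difference of a function and its composition with \<open>T\<close> has integral \<open>0\<close>.\<close>

lemma maximal_ergodic_finite:
  assumes g: "integrable M g"
  shows "0 \<le> (\<integral>x. indicator {x \<in> space M. 0 < max_sum g n x} x * g x \<partial>M)"
proof -
  let ?P = "{x \<in> space M. 0 < max_sum g n x}"
  have [measurable]: "g \<in> borel_measurable M" "max_sum g n \<in> borel_measurable M"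
    using g integrable_max_sum[OF g, of n] by auto
  have P [measurable]: "?P \<in> sets M" by measurable
  have m: "integrable M (max_sum g n)" "integrable M (\<lambda>x. max_sum g n (T x))"
    using integrable_max_sum[OF g] integrable_T by auto
  have "0 = (\<integral>x. max_sum g n x - max_sum g n (T x) \<partial>M)"
    using m integral_T[of "max_sum g n"] by simp
  also have "\<dots> \<le> (\<integral>x. indicator ?P x * g x \<partial>M)"
  proof (rule integral_mono)
    show "integrable M (\<lambda>x. indicator ?P x * g x)"
      using integrable_real_mult_indicator[OF P g] by (simp add: mult.commute)
    fix x assume x: "x \<in> space M"
    show "max_sum g n x - max_sum g n (T x) \<le> indicator ?P x * g x"
    proof (cases "x \<in> ?P")
      case True
      then obtain k where k: "n = Suc k" by (cases n) auto
      have "max_sum g n x = g x + max_sum g k (T x)" using True by (auto simp: k max_def split: if_splits)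
      also have "\<dots> \<le> g x + max_sum g n (T x)" using max_sum_mono[of g k "T x"] by (simp only: k)
      finally show ?thesis using True by simp
    next
      case False
      then have "max_sum g n x = 0" using max_sum_nonneg[of g n x] x by auto
      then show ?thesis using False max_sum_nonneg[of g n "T x"] by simp
    qed
  qed (use m in auto)
  finally show ?thesis .
qed

lemma maximal_ergodic:
  assumes g: "integrable M g" and A: "A \<in> sets \<I>"
    and pos: "\<And>x. x \<in> A \<Longrightarrow> \<exists>n. 0 < birkhoff_sum g n x"
  shows "0 \<le> (\<integral>x\<in>A. g x \<partial>M)"
proof -
  note A' = A[unfolded sets_invariant mem_Collect_eq]
  note AM [measurable] = conjunct1[OF A'] and inv = conjunct2[OF A']
  define h where "h x = indicator A x * g x" for x
  have h: "integrable M h" unfolding h_def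
    using integrable_real_mult_indicator[OF AM g] by (simp add: mult.commute)
  have TA: "x \<in> A \<longleftrightarrow> T x \<in> A" if "x \<in> space M" for x using inv that by blast
  have off: "max_sum h n x = 0" if "x \<in> space M" "x \<notin> A" for n x
    using that
  proof (induction n arbitrary: x)
    case (Suc n)
    have "T x \<notin> A" using TA[OF Suc.prems(1)] Suc.prems(2) by blast
    then show ?case using Suc.IH[OF T_space[OF Suc.prems(1)]] Suc.prems(2) by (simp add: h_def)
  qed simp
  have on: "birkhoff_sum h n x = birkhoff_sum g n x" if "x \<in> A" for n x
    using that
  proof (induction n arbitrary: x)
    case (Suc n)
    have "T x \<in> A" using Suc TA AM sets.sets_into_space by blast
    then show ?case using Suc by (simp add: birkhoff_sum_Suc h_def)
  qed (simp add: birkhoff_sum_def)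
  have lim: "(\<lambda>n. \<integral>x. indicator {x \<in> space M. 0 < max_sum h n x} x * h x \<partial>M) \<longlonglongrightarrow> (\<integral>x. indicator A x * g x \<partial>M)"
  proof (rule integral_dominated_convergence[where w = "\<lambda>x. \<bar>h x\<bar>"])
    have [measurable]: "h \<in> borel_measurable M" "max_sum h n \<in> borel_measurable M" for n
      using h integrable_max_sum[OF h, of n] by auto
    show "(\<lambda>x. indicator {x \<in> space M. 0 < max_sum h n x} x * h x) \<in> borel_measurable M" for n by measurable
    show "(\<lambda>x. indicator A x * g x) \<in> borel_measurable M" using borel_measurable_integrable[OF h] unfolding h_def .
    show "AE x in M. (\<lambda>n. indicator {x \<in> space M. 0 < max_sum h n x} x * h x) \<longlonglongrightarrow> indicator A x * g x"
      using AE_space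
    proof eventually_elim
      case (elim x)
      show ?case
      proof (cases "x \<in> A")
        case True
        obtain n where "0 < birkhoff_sum g n x" using pos True by blast
        then have n: "0 < max_sum h n x" using birkhoff_sum_le_max_sum[of h n x] on[OF True] by simp
        have "0 < max_sum h k x" if "k \<ge> n" for k
          using lift_Suc_mono_le[of "\<lambda>n. max_sum h n x", OF max_sum_mono that] n by simp
        then show ?thesis using elim
          by (intro tendsto_eventually) (auto simp: eventually_sequentially h_def intro!: exI[of _ n])
      qed (simp add: h_def)
    qed
    show "AE x in M. norm (indicator {x \<in> space M. 0 < max_sum h n x} x * h x) \<le> \<bar>h x\<bar>" for n
      by (auto simp: indicator_def)
  qed (use h in auto)
  have "0 \<le> (\<integral>x. indicator A x * g x \<partial>M)"
    by (rule LIMSEQ_le_const[OF lim]) (use maximal_ergodic_finite[OF h] in blast)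
  then show ?thesis by (simp add: set_lebesgue_integral_def)
qed

text \<open>The set \<open>A\<close> where the Birkhoff sums of \<open>g - \<epsilon>\<close> are unbounded above is exactly invariant. By the
  maximal ergodic theorem \<open>g - \<epsilon>\<close> has a nonnegative integral over \<open>A\<close>; but \<open>g\<close> itself has integral
  \<open>0\<close> over every invariant set, so \<open>A\<close> is null.\<close>

lemma birkhoff_sum_upper:
  assumes g: "integrable M g" and z: "AE x in M. real_cond_exp M \<I> g x = 0" and e: "0 < \<epsilon>"
  shows "AE x in M. \<exists>K. \<forall>n. birkhoff_sum g n x \<le> \<epsilon> * real n + K"
proof -
  have [measurable]: "g \<in> borel_measurable M" using g by auto
  define h where "h x = g x - \<epsilon>" for x
  have h: "integrable M h" unfolding h_def using g by auto
  then have [measurable]: "h \<in> borel_measurable M" by auto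
  have hg: "birkhoff_sum h n x = birkhoff_sum g n x - \<epsilon> * real n" for n x
    by (simp add: birkhoff_sum_def h_def sum_subtractf)
  define A where "A = {x \<in> space M. \<forall>K::nat. \<exists>n. real K < birkhoff_sum h n x}"
  have AM [measurable]: "A \<in> sets M" unfolding A_def by measurable
  have iff: "T x \<in> A \<longleftrightarrow> x \<in> A" if x: "x \<in> space M" for x
  proof
    assume Tx: "T x \<in> A"
    show "x \<in> A" unfolding A_def
    proof (intro CollectI conjI x allI)
      fix K :: nat
      obtain K' :: nat where "real K + \<bar>h x\<bar> \<le> real K'" using real_arch_simple by blast
      moreover obtain n where "real K' < birkhoff_sum h n (T x)" using Tx by (auto simp: A_def)
      ultimately show "\<exists>n. real K < birkhoff_sum h n x"
        by (intro exI[of _ "Suc n"]) (simp add: birkhoff_sum_Suc)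
    qed
  next
    assume xA: "x \<in> A"
    show "T x \<in> A" unfolding A_def
    proof (intro CollectI conjI T_space x allI)
      fix K :: nat
      obtain K' :: nat where "real K + \<bar>h x\<bar> \<le> real K'" using real_arch_simple by blast
      moreover obtain n where n: "real K' < birkhoff_sum h n x" using xA by (auto simp: A_def)
      moreover obtain k where "n = Suc k"
        using n by (cases n) (auto simp: birkhoff_sum_def)
      ultimately show "\<exists>n. real K < birkhoff_sum h n (T x)"
        by (intro exI[of _ k]) (simp add: birkhoff_sum_Suc)
    qed
  qed
  then have A: "A \<in> sets \<I>"
    using AM by (auto simp: sets_invariant A_def)
  have "0 \<le> (\<integral>x\<in>A. h x \<partial>M)"
  proof (rule maximal_ergodic[OF h A])
    fix x assume "x \<in> A"
    then obtain n where "real 0 < birkhoff_sum h n x" unfolding A_def by blast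
    then show "\<exists>n. 0 < birkhoff_sum h n x" by auto
  qed
  also have "(\<integral>x\<in>A. h x \<partial>M) = (\<integral>x\<in>A. g x \<partial>M) - \<epsilon> * prob A"
  proof -
    have "integrable M (\<lambda>x. indicator A x * g x)"
      using integrable_real_mult_indicator[OF AM g] by (simp add: mult.commute)
    then show ?thesis by (simp add: set_lebesgue_integral_def h_def right_diff_distrib less_top[symmetric] mult.commute)
  qed
  also have "(\<integral>x\<in>A. g x \<partial>M) = (\<integral>x\<in>A. real_cond_exp M \<I> g x \<partial>M)"
    by (rule I.real_cond_exp_intA[OF g A])
  also have "\<dots> = (\<integral>x. 0 \<partial>M)" unfolding set_lebesgue_integral_def
    using z by (intro integral_cong_AE) auto
  finally have "prob A = 0" using e by (simp add: mult_le_0_iff measure_le_0_iff)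
  then have "AE x in M. x \<notin> A" by (intro AE_not_in) (simp add: null_sets_def emeasure_eq_measure)
  then show ?thesis using AE_space
  proof eventually_elim
    case (elim x)
    then obtain K :: nat where "\<And>n. \<not> real K < birkhoff_sum h n x" by (auto simp: A_def)
    then show ?case by (intro exI[of _ "real K"]) (auto simp: hg not_less algebra_simps)
  qed
qed

text \<open>Subtracting the conditional expectation, which is invariant, reduces to \<open>birkhoff_sum_upper\<close> for the
  function and its negative.\<close>

theorem birkhoff:
  assumes g: "integrable M g"
  shows "AE x in M. (\<lambda>n. birkhoff_sum g n x / real n) \<longlonglongrightarrow> real_cond_exp M \<I> g x"
proof -
  define c where "c = real_cond_exp M \<I> g"
  have cm [measurable]: "c \<in> borel_measurable \<I>" by (simp add: c_def)
  have ci: "integrable M c" unfolding c_def by (rule I.real_cond_exp_int(1)[OF g])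
  define f where "f x = g x - c x" for x
  have f: "integrable M f" unfolding f_def using g ci by auto
  have f0: "AE x in M. real_cond_exp M \<I> f x = 0"
    using I.real_cond_exp_diff[OF g ci] I.real_cond_exp_F_meas[OF ci cm]
    by eventually_elim (simp add: f_def[abs_def] c_def)
  have f0': "AE x in M. real_cond_exp M \<I> (\<lambda>x. (-1) * f x) x = 0"
    using I.real_cond_exp_cmult[OF f, of "-1"] f0 by eventually_elim simp
  have "AE x in M. \<forall>j::nat. \<exists>K. \<forall>n. birkhoff_sum f n x \<le> (1 / Suc j) * real n + K"
    unfolding AE_all_countable by (intro allI birkhoff_sum_upper f f0) simp
  moreover have "AE x in M. \<forall>j::nat. \<exists>K. \<forall>n. birkhoff_sum (\<lambda>x. (-1) * f x) n x \<le> (1 / Suc j) * real n + K"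
    unfolding AE_all_countable by (intro allI birkhoff_sum_upper f0' Bochner_Integration.integrable_mult_right f) simp
  ultimately show ?thesis using AE_space
  proof eventually_elim
    case (elim x)
    have neg: "birkhoff_sum (\<lambda>x. (-1) * f x) n x = - birkhoff_sum f n x" for n
      by (simp add: birkhoff_sum_def sum_negf)
    have "(\<lambda>n. birkhoff_sum f n x / real n) \<longlonglongrightarrow> 0"
    proof (rule tendstoI)
      fix e :: real assume "e > 0"
      then obtain j :: nat where "inverse (real (Suc j)) < e / 2" using reals_Archimedean[of "e/2"] by auto
      then have j: "1 / Suc j < e / 2" by (simp add: inverse_eq_divide)
      obtain K1 where K1: "\<And>n. birkhoff_sum f n x \<le> (1 / Suc j) * real n + K1" using elim(1) by blast
      obtain K2 where K2: "\<And>n. - birkhoff_sum f n x \<le> (1 / Suc j) * real n + K2" using elim(2) unfolding neg by blast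
      define K where "K = \<bar>K1\<bar> + \<bar>K2\<bar>"
      have K: "\<bar>birkhoff_sum f n x\<bar> \<le> (1 / Suc j) * real n + K" for n
        using K1[of n] K2[of n] by (simp add: K_def)
      have "(\<lambda>n. K / real n) \<longlonglongrightarrow> 0" by (rule lim_const_over_n)
      then have "\<forall>\<^sub>F n in sequentially. K / real n < e / 2" using \<open>e > 0\<close> by (intro order_tendstoD(2)) auto
      then show "\<forall>\<^sub>F n in sequentially. dist (birkhoff_sum f n x / real n) 0 < e"
        using eventually_gt_at_top[of 0]
      proof eventually_elim
        case (elim n)
        have "dist (birkhoff_sum f n x / real n) 0 = \<bar>birkhoff_sum f n x\<bar> / real n" by (simp add: abs_divide)
        also have "\<dots> \<le> ((1 / Suc j) * real n + K) / real n" using K[of n] by (intro divide_right_mono) auto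
        also have "\<dots> = 1 / Suc j + K / real n" using elim by (simp add: add_divide_distrib)
        finally show ?case using elim j by linarith
      qed
    qed
    then have "(\<lambda>n. birkhoff_sum f n x / real n + c x) \<longlonglongrightarrow> 0 + c x" by (intro tendsto_intros)
    moreover have "\<forall>\<^sub>F n in sequentially. birkhoff_sum f n x / real n + c x = birkhoff_sum g n x / real n"
      using eventually_gt_at_top[of 0]
    proof eventually_elim
      case (elim n)
      have "birkhoff_sum g n x = birkhoff_sum f n x + real n * c x"
        using invariant_fun_funpow[OF cm \<open>x \<in> space M\<close>]
        by (simp add: birkhoff_sum_def f_def sum_subtractf)
      then show ?case using elim by (simp add: add_divide_distrib)
    qed
    ultimately show ?case by (auto simp: c_def intro: Lim_transform_eventually)
  qed
qed

lemma ergodic_cond_exp: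
  assumes erg: "ergodic M T" and g: "integrable M g"
  shows "AE x in M. real_cond_exp M \<I> g x = (\<integral>y. g y \<partial>M)"
proof (rule I.real_cond_exp_charact[OF _ g])
  fix A assume A: "A \<in> sets \<I>"
  note A' = A[unfolded sets_invariant mem_Collect_eq]
  note AM [measurable] = conjunct1[OF A'] and inv = conjunct2[OF A']
  have [measurable]: "g \<in> borel_measurable M" using g by auto
  consider "prob A = 0" | "prob A = 1" using erg[unfolded ergodic_def, rule_format, OF AM inv] by blast
  then show "(\<integral>x\<in>A. g x \<partial>M) = (\<integral>x\<in>A. (\<integral>y. g y \<partial>M) \<partial>M)"
  proof cases
    case 1
    then have "AE x in M. x \<notin> A" by (intro AE_not_in) (simp add: null_sets_def emeasure_eq_measure)
    then have "(\<integral>x\<in>A. g x \<partial>M) = (\<integral>x. 0 \<partial>M)" unfolding set_lebesgue_integral_def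
      by (intro integral_cong_AE) auto
    then show ?thesis using 1 by (simp add: set_lebesgue_integral_def)
  next
    case 2
    then have "AE x in M. x \<in> A" by (subst (asm) prob_eq_1) auto
    then have "(\<integral>x\<in>A. g x \<partial>M) = (\<integral>x. g x \<partial>M)" unfolding set_lebesgue_integral_def
      by (intro integral_cong_AE) auto
    then show ?thesis using 2 by (simp add: set_lebesgue_integral_def)
  qed
qed auto

text \<open>Maker's theorem. Let \<open>u N\<close> be the supremum of \<open>e l\<close> over \<open>l \<ge> N\<close>. All but the last \<open>N\<close> terms are
  at most the corresponding values of \<open>u N\<close>, whose averages converge to the conditional expectation of
  \<open>u N\<close>; this is small for large \<open>N\<close> by dominated convergence. The last \<open>N\<close> terms are bounded by
  \<open>H\<close> and negligible because the averages of \<open>H\<close> converge.\<close>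

theorem maker:
  assumes e [measurable]: "\<And>N. e N \<in> borel_measurable M" and H: "integrable M H"
    and eH: "\<And>N x. 0 \<le> e N x \<and> e N x \<le> H x" and lim: "AE x in M. (\<lambda>N. e N x) \<longlonglongrightarrow> 0"
  shows "AE x in M. (\<lambda>n. (\<Sum>k<n. e (n - k) ((T ^^ k) x)) / real n) \<longlonglongrightarrow> 0"
proof -
  define u where "u N x = (SUP l\<in>{N..}. e l x)" for N :: nat and x
  have bdd: "bdd_above ((\<lambda>l. e l x) ` {N..})" for N x
    using eH by (intro bdd_aboveI[of _ "H x"]) auto
  have u_upper: "e l x \<le> u N x" if "N \<le> l" for l N x
    unfolding u_def using that bdd by (intro cSUP_upper) auto
  have uH: "0 \<le> u N x \<and> u N x \<le> H x" for N x
  proof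
    show "0 \<le> u N x" using u_upper[of N N x] eH[of N x] by linarith
    show "u N x \<le> H x" unfolding u_def using eH by (intro cSUP_least) auto
  qed
  have [measurable]: "u N \<in> borel_measurable M" for N
    unfolding u_def by (rule borel_measurable_cSUP) (use bdd in auto)
  have [measurable]: "H \<in> borel_measurable M" using H by auto
  have ui: "integrable M (u N)" for N
  proof (rule Bochner_Integration.integrable_bound[OF H])
    show "AE x in M. norm (u N x) \<le> norm (H x)"
    proof (rule AE_I2)
      fix x show "norm (u N x) \<le> norm (H x)" using uH[of N x] by simp
    qed
  qed simp
  have u_lim: "AE x in M. (\<lambda>N. u N x) \<longlonglongrightarrow> 0"
    using lim
  proof eventually_elim
    case (elim x)
    show ?case
    proof (rule tendstoI)
      fix \<eta> :: real assume "\<eta> > 0"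
      then have "\<forall>\<^sub>F N in sequentially. e N x < \<eta> / 2" using elim by (intro order_tendstoD(2)) auto
      then obtain N0 where "\<And>N. N \<ge> N0 \<Longrightarrow> e N x < \<eta> / 2" by (auto simp: eventually_sequentially)
      then have "u N x \<le> \<eta> / 2" if "N \<ge> N0" for N
        unfolding u_def using that by (intro cSUP_least) (auto intro: less_imp_le)
      then have "dist (u N x) 0 < \<eta>" if "N \<ge> N0" for N
        using that uH[of N x] \<open>\<eta> > 0\<close> by (force simp: dist_real_def)
      then show "\<forall>\<^sub>F N in sequentially. dist (u N x) 0 < \<eta>" unfolding eventually_sequentially by blast
    qed
  qed
  have int0: "(\<lambda>N. \<integral>x. u N x \<partial>M) \<longlonglongrightarrow> (\<integral>x. 0 \<partial>M)"
    by (rule integral_dominated_convergence[OF _ _ H u_lim]) (use uH in auto)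
  define c where "c N = real_cond_exp M \<I> (u N)" for N
  have c0: "AE x in M. 0 \<le> c N x" for N unfolding c_def
    by (rule I.real_cond_exp_pos) (use uH in auto)
  have small: "AE x in M. \<exists>N. c N x < t" if t: "t > 0" for t
  proof -
    define D where "D = {x \<in> space M. \<forall>N. t \<le> c N x}"
    have [measurable]: "c N \<in> borel_measurable M" for N unfolding c_def by simp
    have D [measurable]: "D \<in> sets M" unfolding D_def by measurable
    have "t * prob D \<le> (\<integral>x. u N x \<partial>M)" for N
    proof -
      have "t * prob D = (\<integral>x. t * indicator D x \<partial>M)" by simp
      also have "\<dots> \<le> (\<integral>x. c N x \<partial>M)"
      proof (rule integral_mono_AE)
        show "integrable M (c N)" unfolding c_def by (rule I.real_cond_exp_int(1)[OF ui])
        show "AE x in M. t * indicator D x \<le> c N x"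
          using c0[of N] by eventually_elim (auto simp: D_def indicator_def)
      qed (auto simp: less_top[symmetric])
      also have "\<dots> = (\<integral>x. u N x \<partial>M)" unfolding c_def by (rule I.real_cond_exp_int(2)[OF ui])
      finally show ?thesis .
    qed
    then have "t * prob D \<le> (\<integral>x. 0 \<partial>M)" by (intro LIMSEQ_le_const[OF int0]) auto
    then have "prob D = 0" using t by (simp add: mult_le_0_iff measure_le_0_iff)
    then have "AE x in M. x \<notin> D" by (intro AE_not_in) (simp add: null_sets_def emeasure_eq_measure)
    then show ?thesis using AE_space by eventually_elim (auto simp: D_def not_le)
  qed
  have "AE x in M. \<forall>j::nat. \<exists>N. c N x < 1 / Suc j"
    unfolding AE_all_countable by (intro allI small) simp
  moreover have "AE x in M. \<forall>N. (\<lambda>n. birkhoff_sum (u N) n x / real n) \<longlonglongrightarrow> c N x"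
    using birkhoff[OF ui] by (simp add: AE_all_countable c_def)
  ultimately show ?thesis using birkhoff[OF H]
  proof eventually_elim
    case (elim x)
    define h where "h = real_cond_exp M \<I> H x"
    have tail: "(\<lambda>n. (birkhoff_sum H n x - birkhoff_sum H (n - N) x) / real n) \<longlonglongrightarrow> 0" for N
    proof -
      have 1: "(\<lambda>n. birkhoff_sum H (n - N) x / real (n - N)) \<longlonglongrightarrow> h"
        using elim(3) unfolding h_def by (rule filterlim_compose[OF _ filterlim_minus_const_nat_at_top])
      have 2: "(\<lambda>n. real (n - N) / real n) \<longlonglongrightarrow> 1"
      proof -
        have "(\<lambda>n. 1 - real N / real n) \<longlonglongrightarrow> 1 - 0" by (intro tendsto_intros lim_const_over_n)
        moreover have "\<forall>\<^sub>F n in sequentially. 1 - real N / real n = real (n - N) / real n"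
          using eventually_gt_at_top[of N] by eventually_elim (simp add: of_nat_diff diff_divide_distrib)
        ultimately show ?thesis by (auto intro: Lim_transform_eventually)
      qed
      have "(\<lambda>n. birkhoff_sum H n x / real n - (birkhoff_sum H (n - N) x / real (n - N)) * (real (n - N) / real n)) \<longlonglongrightarrow> h - h * 1"
        using elim(3) by (intro tendsto_intros 1 2) (simp add: h_def)
      moreover have "\<forall>\<^sub>F n in sequentially. birkhoff_sum H n x / real n - (birkhoff_sum H (n - N) x / real (n - N)) * (real (n - N) / real n)
          = (birkhoff_sum H n x - birkhoff_sum H (n - N) x) / real n"
        using eventually_gt_at_top[of N] by eventually_elim (simp add: diff_divide_distrib del: of_nat_diff)
      ultimately show ?thesis by (auto intro: Lim_transform_eventually)
    qed
    have bound: "(\<Sum>k<n. e (n - k) ((T ^^ k) x)) \<le> birkhoff_sum (u N) n x + (birkhoff_sum H n x - birkhoff_sum H (n - N) x)" for n N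
    proof -
      have "(\<Sum>k<n. e (n - k) ((T ^^ k) x)) \<le> (\<Sum>k<n. u N ((T ^^ k) x) + (if n - N \<le> k then H ((T ^^ k) x) else 0))"
      proof (rule sum_mono)
        fix k assume "k \<in> {..<n}"
        show "e (n - k) ((T ^^ k) x) \<le> u N ((T ^^ k) x) + (if n - N \<le> k then H ((T ^^ k) x) else 0)"
        proof (cases "n - N \<le> k")
          case True
          then show ?thesis using eH[of "n - k" "(T ^^ k) x"] uH[of N "(T ^^ k) x"] by simp
        next
          case False
          then show ?thesis using u_upper[of N "n - k" "(T ^^ k) x"] by simp
        qed
      qed
      also have "\<dots> = birkhoff_sum (u N) n x + (\<Sum>k<n. if n - N \<le> k then H ((T ^^ k) x) else 0)"
        by (simp add: sum.distrib birkhoff_sum_def)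
      also have "(\<Sum>k<n. if n - N \<le> k then H ((T ^^ k) x) else 0) = birkhoff_sum H n x - birkhoff_sum H (n - N) x"
      proof -
        have "birkhoff_sum H n x = (\<Sum>k\<in>{..<n-N} \<union> {n-N..<n}. H ((T ^^ k) x))"
          unfolding birkhoff_sum_def by (intro sum.cong) auto
        also have "\<dots> = birkhoff_sum H (n - N) x + (\<Sum>k\<in>{n-N..<n}. H ((T ^^ k) x))"
          unfolding birkhoff_sum_def by (intro sum.union_disjoint) auto
        also have "(\<Sum>k\<in>{n-N..<n}. H ((T ^^ k) x)) = (\<Sum>k<n. if n - N \<le> k then H ((T ^^ k) x) else 0)"
          by (rule sum.mono_neutral_cong_left) auto
        finally show ?thesis by simp
      qed
      finally show ?thesis .
    qed
    show ?case
    proof (rule tendstoI)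
      fix \<eta> :: real assume "\<eta> > 0"
      then obtain j :: nat where j: "1 / Suc j < \<eta>" using reals_Archimedean by (auto simp: divide_inverse)
      obtain N where N: "c N x < 1 / Suc j" using elim(1) by blast
      have "(\<lambda>n. birkhoff_sum (u N) n x / real n + (birkhoff_sum H n x - birkhoff_sum H (n - N) x) / real n) \<longlonglongrightarrow> c N x + 0"
        using elim(2) by (intro tendsto_intros tail) auto
      then have "\<forall>\<^sub>F n in sequentially. birkhoff_sum (u N) n x / real n + (birkhoff_sum H n x - birkhoff_sum H (n - N) x) / real n < \<eta>"
        by (rule order_tendstoD(2)) (use N j in linarith)
      then show "\<forall>\<^sub>F n in sequentially. dist ((\<Sum>k<n. e (n - k) ((T ^^ k) x)) / real n) 0 < \<eta>"
      proof eventually_elim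
        case (elim n)
        have "(\<Sum>k<n. e (n - k) ((T ^^ k) x)) / real n \<le> (birkhoff_sum (u N) n x + (birkhoff_sum H n x - birkhoff_sum H (n - N) x)) / real n"
          by (intro divide_right_mono bound) simp
        moreover have "0 \<le> (\<Sum>k<n. e (n - k) ((T ^^ k) x)) / real n"
          using eH by (intro divide_nonneg_nonneg sum_nonneg) auto
        ultimately show ?case using elim by (simp add: add_divide_distrib dist_real_def)
      qed
    qed
  qed
qed

end

section \<open>Local dimension of an expanding factor\<close>

definition near_similarity ::
    "real \<Rightarrow> real \<Rightarrow> ('a \<Rightarrow> 'b::metric_space) \<Rightarrow> ('a \<Rightarrow> 'a) \<Rightarrow> ('a \<Rightarrow> real) \<Rightarrow> 'a set \<Rightarrow> bool" where
  "near_similarity \<epsilon> \<delta> s T D A \<longleftrightarrow> (\<forall>x\<in>A. \<forall>y\<in>A.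
      dist (s x) (s y) < \<delta> \<or> dist (s (T x)) (s (T y)) < \<delta> \<longrightarrow>
      exp (- \<epsilon>) * D x * dist (s x) (s y) \<le> dist (s (T x)) (s (T y)) \<and>
      dist (s (T x)) (s (T y)) \<le> exp \<epsilon> * D x * dist (s x) (s y))"

text \<open>The dynamics seen through \<open>s\<close>. The map \<open>T\<close> need not descend to the Euclidean space, so
  \<open>distortion\<close> compares only points of one atom, on which \<open>T\<close> acts by a single branch. It also
  asserts that two points of one atom with close images are themselves close up to the expected
  factor, which is injectivity of the branch in a uniform form.\<close>

locale expanding_factor = measure_preserving_system M T for M :: "'a measure" and T +
  fixes s :: "'a \<Rightarrow> 'b::euclidean_space" and \<R> :: "'a set set" and D :: "'a \<Rightarrow> real"
    and C L Dmax :: real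
  assumes s [measurable]: "s \<in> borel_measurable M"
    and bounded_s: "bounded (s ` space M)"
    and \<R>: "finite \<R>" "partition_on (space M) \<R>" "\<R> \<subseteq> sets M"
    and D [measurable]: "D \<in> borel_measurable M"
    and C: "0 < C" and L: "1 < L"
    and growth: "\<And>x n. x \<in> space M \<Longrightarrow> 1 \<le> n \<Longrightarrow> C * L ^ n \<le> (\<Prod>k<n. D ((T ^^ k) x))"
    and D_le: "\<And>x. x \<in> space M \<Longrightarrow> D x \<le> Dmax"
    and distortion: "\<And>\<epsilon>. 0 < \<epsilon> \<Longrightarrow> \<exists>\<delta>>0. \<forall>A\<in>\<R>. near_similarity \<epsilon> \<delta> s T D A"
begin

text \<open>Two factors enter: \<open>P\<close> by \<open>s\<close>, and \<open>Q\<close> by \<open>s \<circ> T\<close>, whose balls are the preimages under \<open>T\<close> of the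
  balls of \<open>P\<close>.\<close>

sublocale P: euclidean_factor M s
  by unfold_locales (rule s)

sublocale Q: euclidean_factor M "\<lambda>x. s (T x)"
  by unfold_locales measurable

definition ball_mass :: "'a \<Rightarrow> real \<Rightarrow> real" where
  "ball_mass x r = prob (factor_ball M s x r)"

lemma D_bounds:
  assumes x: "x \<in> space M"
  shows "C * L \<le> D x" "0 < D x"
proof -
  show "C * L \<le> D x" using growth[OF x, of 1] by simp
  moreover have "0 < C * L" using C L by simp
  ultimately show "0 < D x" by linarith
qed

lemma bounded_sT: "bounded ((\<lambda>x. s (T x)) ` space M)"
  by (rule bounded_subset[OF bounded_s]) (use T_space in auto)

lemma ball_mass_image: "prob (factor_ball M (\<lambda>x. s (T x)) x r) = ball_mass (T x) r"
proof -
  have "factor_ball M (\<lambda>x. s (T x)) x r = T -` factor_ball M s (T x) r \<inter> space M"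
    using T_space by (auto simp: factor_ball_def)
  then have "prob (factor_ball M (\<lambda>x. s (T x)) x r) = measure (distr M M T) (factor_ball M s (T x) r)"
    by (simp add: measure_distr)
  then show ?thesis by (simp only: distr_T ball_mass_def)
qed

lemma ball_mass_mono: "r \<le> r' \<Longrightarrow> ball_mass x r \<le> ball_mass x r'"
  unfolding ball_mass_def by (rule finite_measure_mono) (auto simp: factor_ball_def)

text \<open>At charged points all the logarithms below are taken of positive numbers, and almost every orbit
  consists of charged points.\<close>

definition charged :: "'a \<Rightarrow> bool" where
  "charged x \<longleftrightarrow> x \<in> space M \<and> (\<forall>A\<in>\<R>. x \<in> A \<longrightarrow> (\<forall>r>0. 0 < prob (A \<inter> factor_ball M s x r) \<and>
     0 < prob (A \<inter> factor_ball M (\<lambda>x. s (T x)) x r)))"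

lemma AE_charged: "AE x in M. \<forall>n. charged ((T ^^ n) x)"
proof (rule AE_funpow)
  have "AE x in M. \<forall>A\<in>\<R>. x \<in> A \<longrightarrow> (\<forall>r>0. 0 < prob (A \<inter> factor_ball M s x r))"
    "AE x in M. \<forall>A\<in>\<R>. x \<in> A \<longrightarrow> (\<forall>r>0. 0 < prob (A \<inter> factor_ball M (\<lambda>x. s (T x)) x r))"
    using P.AE_atom_factor_ball_pos Q.AE_atom_factor_ball_pos \<R> by (auto intro!: AE_finite_allI)
  then show "AE x in M. charged x" using AE_space by eventually_elim (auto simp: charged_def)
qed

lemma charged_ball_mass:
  assumes "charged x" "0 < r"
  shows "0 < ball_mass x r" "0 < ball_mass (T x) r"
proof -
  obtain A where A: "A \<in> \<R>" "x \<in> A" using assms partition_onD1[OF \<R>(2)] by (auto simp: charged_def)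
  then have "A \<in> sets M" using \<R> by auto
  then have "prob (A \<inter> factor_ball M s x r) \<le> ball_mass x r"
    "prob (A \<inter> factor_ball M (\<lambda>x. s (T x)) x r) \<le> ball_mass (T x) r"
    unfolding ball_mass_image[symmetric] unfolding ball_mass_def by (auto intro!: finite_measure_mono)
  moreover have "0 < prob (A \<inter> factor_ball M s x r)" "0 < prob (A \<inter> factor_ball M (\<lambda>x. s (T x)) x r)"
    using assms A by (auto simp: charged_def)
  ultimately show "0 < ball_mass x r" "0 < ball_mass (T x) r" by linarith+
qed

lemma ball_info_atom:
  assumes "charged x" "0 < r" and A: "A \<in> \<R>" "x \<in> A"
  shows "P.ball_info \<R> r x = ln (ball_mass x r) - ln (prob (A \<inter> factor_ball M s x r))"
    and "Q.ball_info \<R> r x = ln (ball_mass (T x) r) - ln (prob (A \<inter> factor_ball M (\<lambda>x. s (T x)) x r))"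
proof -
  have pos: "0 < prob (A \<inter> factor_ball M s x r)" "0 < prob (A \<inter> factor_ball M (\<lambda>x. s (T x)) x r)"
    using assms by (auto simp: charged_def)
  note m = charged_ball_mass[OF assms(1,2)]
  have "P.ball_info \<R> r x = - ln (prob (A \<inter> factor_ball M s x r) / ball_mass x r)"
    unfolding P.ball_info_def by (simp add: P.sum_indicator_partition[OF \<R>(2,1) A] ball_mass_def)
  then show "P.ball_info \<R> r x = ln (ball_mass x r) - ln (prob (A \<inter> factor_ball M s x r))"
    using pos m by (simp add: ln_div)
  have "Q.ball_info \<R> r x = - ln (prob (A \<inter> factor_ball M (\<lambda>x. s (T x)) x r) / ball_mass (T x) r)"
    unfolding Q.ball_info_def by (simp add: Q.sum_indicator_partition[OF \<R>(2,1) A] ball_mass_image)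
  then show "Q.ball_info \<R> r x = ln (ball_mass (T x) r) - ln (prob (A \<inter> factor_ball M (\<lambda>x. s (T x)) x r))"
    using pos m by (simp add: ln_div)
qed

text \<open>One step of the recursion for the mass of balls. The two informations arise from comparing a ball
  with its intersection with the atom, before and after applying \<open>T\<close>; the distortion estimate
  compares these intersections with each other. Shrinking the image radius by \<open>exp (- \<epsilon>)\<close> gives a
  lower bound, and enlarging it by \<open>exp \<epsilon>\<close> in \<open>step_upper\<close> an upper bound.\<close>

lemma step_lower:
  assumes \<delta>: "\<forall>A\<in>\<R>. near_similarity \<epsilon> \<delta> s T D A" and x: "charged x" and r: "0 < r" "r * (exp (- \<epsilon>) * D x) \<le> \<delta>"
  shows "ln (ball_mass (T x) (r * (exp (- \<epsilon>) * D x))) + (P.ball_info \<R> r x - Q.ball_info \<R> (r * (exp (- \<epsilon>) * D x)) x)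
      \<le> ln (ball_mass x r)"
proof -
  obtain A where A: "A \<in> \<R>" "x \<in> A" using x partition_onD1[OF \<R>(2)] by (auto simp: charged_def)
  have Am [measurable]: "A \<in> sets M" using A \<R> by auto
  have D0: "0 < exp (- \<epsilon>) * D x" using D_bounds x by (auto simp: charged_def)
  define r' where "r' = r * (exp (- \<epsilon>) * D x)"
  have r': "0 < r'" using r D0 by (simp add: r'_def)
  have "A \<inter> factor_ball M (\<lambda>x. s (T x)) x r' \<subseteq> A \<inter> factor_ball M s x r"
  proof
    fix y assume y: "y \<in> A \<inter> factor_ball M (\<lambda>x. s (T x)) x r'"
    then have d: "dist (s (T x)) (s (T y)) < r'" by (auto simp: factor_ball_def dist_commute)
    then have "dist (s (T x)) (s (T y)) < \<delta>" using r by (simp add: r'_def)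
    then have "exp (- \<epsilon>) * D x * dist (s x) (s y) \<le> dist (s (T x)) (s (T y))"
      using \<delta> A y unfolding near_similarity_def by blast
    then have "(exp (- \<epsilon>) * D x) * dist (s x) (s y) < (exp (- \<epsilon>) * D x) * r" using d by (simp add: r'_def mult.commute)
    then have "dist (s x) (s y) < r" using D0 by (simp only: mult_less_cancel_left_pos)
    then show "y \<in> A \<inter> factor_ball M s x r" using y by (auto simp: factor_ball_def dist_commute)
  qed
  then have "prob (A \<inter> factor_ball M (\<lambda>x. s (T x)) x r') \<le> prob (A \<inter> factor_ball M s x r)"
    by (rule finite_measure_mono) measurable
  moreover have "0 < prob (A \<inter> factor_ball M (\<lambda>x. s (T x)) x r')" using x A r' by (auto simp: charged_def)
  ultimately have "ln (prob (A \<inter> factor_ball M (\<lambda>x. s (T x)) x r')) \<le> ln (prob (A \<inter> factor_ball M s x r))" by simp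
  then show "ln (ball_mass (T x) (r * (exp (- \<epsilon>) * D x))) + (P.ball_info \<R> r x - Q.ball_info \<R> (r * (exp (- \<epsilon>) * D x)) x)
      \<le> ln (ball_mass x r)"
    using ball_info_atom(1)[OF x r(1) A] ball_info_atom(2)[OF x r' A] by (simp add: r'_def)
qed

lemma step_upper:
  assumes \<delta>: "\<forall>A\<in>\<R>. near_similarity \<epsilon> \<delta> s T D A" and x: "charged x" and r: "0 < r" "r \<le> \<delta>"
  shows "ln (ball_mass x r) \<le>
    ln (ball_mass (T x) (r * (exp \<epsilon> * D x))) + (P.ball_info \<R> r x - Q.ball_info \<R> (r * (exp \<epsilon> * D x)) x)"
proof -
  obtain A where A: "A \<in> \<R>" "x \<in> A" using x partition_onD1[OF \<R>(2)] by (auto simp: charged_def)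
  have Am [measurable]: "A \<in> sets M" using A \<R> by auto
  have D0: "0 < exp \<epsilon> * D x" using D_bounds x by (auto simp: charged_def)
  define r' where "r' = r * (exp \<epsilon> * D x)"
  have r': "0 < r'" using r D0 by (simp add: r'_def)
  have "A \<inter> factor_ball M s x r \<subseteq> A \<inter> factor_ball M (\<lambda>x. s (T x)) x r'"
  proof
    fix y assume y: "y \<in> A \<inter> factor_ball M s x r"
    then have d: "dist (s x) (s y) < r" by (auto simp: factor_ball_def dist_commute)
    then have "dist (s x) (s y) < \<delta>" using r by simp
    then have "dist (s (T x)) (s (T y)) \<le> exp \<epsilon> * D x * dist (s x) (s y)"
      using \<delta> A y unfolding near_similarity_def by blast
    also have "\<dots> < r'" using mult_strict_left_mono[OF d D0] by (simp add: r'_def mult_ac)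
    finally show "y \<in> A \<inter> factor_ball M (\<lambda>x. s (T x)) x r'" using y by (auto simp: factor_ball_def dist_commute)
  qed
  then have "prob (A \<inter> factor_ball M s x r) \<le> prob (A \<inter> factor_ball M (\<lambda>x. s (T x)) x r')"
    by (rule finite_measure_mono) measurable
  moreover have "0 < prob (A \<inter> factor_ball M s x r)" using x A r by (auto simp: charged_def)
  ultimately have "ln (prob (A \<inter> factor_ball M s x r)) \<le> ln (prob (A \<inter> factor_ball M (\<lambda>x. s (T x)) x r'))" by simp
  then show ?thesis
    using ball_info_atom(1)[OF x r(1) A] ball_info_atom(2)[OF x r' A] by (simp add: r'_def)
qed

text \<open>The factor by which the radius has been multiplied after \<open>k\<close> steps, when every step adds the
  distortion \<open>exp \<sigma>\<close>.\<close>

definition dilation :: "real \<Rightarrow> nat \<Rightarrow> 'a \<Rightarrow> real" where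
  "dilation \<sigma> k x = exp (\<sigma> * real k) * (\<Prod>i<k. D ((T ^^ i) x))"

definition info_sum :: "real \<Rightarrow> nat \<Rightarrow> real \<Rightarrow> 'a \<Rightarrow> real" where
  "info_sum \<sigma> n r x = (\<Sum>k<n. P.ball_info \<R> (r * dilation \<sigma> k x) ((T ^^ k) x) -
     Q.ball_info \<R> (r * dilation \<sigma> (Suc k) x) ((T ^^ k) x))"

lemma dilation_0 [simp]: "dilation \<sigma> 0 x = 1"
  by (simp add: dilation_def)

lemma dilation_Suc: "dilation \<sigma> (Suc k) x = dilation \<sigma> k x * (exp \<sigma> * D ((T ^^ k) x))"
  by (simp add: dilation_def algebra_simps exp_add)

lemma dilation_pos: "x \<in> space M \<Longrightarrow> 0 < dilation \<sigma> k x"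
  unfolding dilation_def by (intro mult_pos_pos prod_pos) (auto intro: D_bounds funpow_space)

lemma dilation_growth:
  assumes x: "x \<in> space M" and k: "k \<le> n"
  shows "min C 1 * (exp \<sigma> * L) ^ (n - k) * dilation \<sigma> k x \<le> dilation \<sigma> n x"
proof -
  have eq: "dilation \<sigma> n x = dilation \<sigma> k x * (exp (\<sigma> * real (n - k)) * (\<Prod>i<n-k. D ((T ^^ i) ((T ^^ k) x))))"
  proof -
    have "(\<Prod>i<n. D ((T ^^ i) x)) = (\<Prod>i\<in>{..<k} \<union> {k..<n}. D ((T ^^ i) x))"
      using k by (intro prod.cong) auto
    also have "\<dots> = (\<Prod>i<k. D ((T ^^ i) x)) * (\<Prod>i\<in>{k..<n}. D ((T ^^ i) x))"
      by (rule prod.union_disjoint) auto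
    also have "(\<Prod>i\<in>{k..<n}. D ((T ^^ i) x)) = (\<Prod>i<n-k. D ((T ^^ i) ((T ^^ k) x)))"
      by (rule prod.reindex_bij_witness[of _ "\<lambda>i. i + k" "\<lambda>i. i - k"])
         (auto simp: funpow_add[symmetric, THEN fun_cong, unfolded o_def])
    finally have "(\<Prod>i<n. D ((T ^^ i) x)) = (\<Prod>i<k. D ((T ^^ i) x)) * (\<Prod>i<n-k. D ((T ^^ i) ((T ^^ k) x)))" .
    moreover have "exp (\<sigma> * real n) = exp (\<sigma> * real k) * exp (\<sigma> * real (n - k))"
      using k by (simp add: of_nat_diff algebra_simps flip: exp_add)
    ultimately show ?thesis unfolding dilation_def by simp
  qed
  have "min C 1 * L ^ (n - k) \<le> (\<Prod>i<n-k. D ((T ^^ i) ((T ^^ k) x)))"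
  proof (cases "n = k")
    case False
    then have "C * L ^ (n - k) \<le> (\<Prod>i<n-k. D ((T ^^ i) ((T ^^ k) x)))"
      using k by (intro growth funpow_space x) auto
    moreover have "min C 1 * L ^ (n - k) \<le> C * L ^ (n - k)" using L by (intro mult_right_mono) auto
    ultimately show ?thesis by linarith
  qed simp
  then have "min C 1 * L ^ (n - k) * (exp (\<sigma> * real (n - k)) * dilation \<sigma> k x) \<le>
    (\<Prod>i<n-k. D ((T ^^ i) ((T ^^ k) x))) * (exp (\<sigma> * real (n - k)) * dilation \<sigma> k x)"
    using dilation_pos[OF x, of \<sigma> k] by (intro mult_right_mono) auto
  moreover have "exp (\<sigma> * real (n - k)) = exp \<sigma> ^ (n - k)" by (simp only: exp_of_nat2_mult)
  ultimately show ?thesis unfolding eq by (simp add: power_mult_distrib mult_ac)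
qed

lemma iterate_lower:
  assumes \<delta>: "\<forall>A\<in>\<R>. near_similarity \<epsilon> \<delta> s T D A" and x: "\<And>n. charged ((T ^^ n) x)" and r: "0 < r"
    and small: "\<And>k. k \<le> n \<Longrightarrow> r * dilation (- \<epsilon>) k x \<le> \<delta>"
  shows "ln (ball_mass ((T ^^ n) x) (r * dilation (- \<epsilon>) n x)) + info_sum (- \<epsilon>) n r x \<le> ln (ball_mass x r)"
  using small
proof (induction n)
  case (Suc n)
  have xs: "x \<in> space M" using x[of 0] by (simp add: charged_def)
  let ?r = "r * dilation (- \<epsilon>) n x"
  have r0: "0 < ?r" using r dilation_pos[OF xs] by simp
  have eq: "?r * (exp (- \<epsilon>) * D ((T ^^ n) x)) = r * dilation (- \<epsilon>) (Suc n) x" by (simp add: dilation_Suc)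
  have "ln (ball_mass ((T ^^ Suc n) x) (r * dilation (- \<epsilon>) (Suc n) x)) +
     (P.ball_info \<R> ?r ((T ^^ n) x) - Q.ball_info \<R> (r * dilation (- \<epsilon>) (Suc n) x) ((T ^^ n) x))
      \<le> ln (ball_mass ((T ^^ n) x) ?r)"
    using step_lower[OF \<delta> x[of n] r0] Suc.prems[of "Suc n"] unfolding eq by simp
  moreover have "ln (ball_mass ((T ^^ n) x) ?r) + info_sum (- \<epsilon>) n r x \<le> ln (ball_mass x r)"
    by (rule Suc.IH) (use Suc.prems in simp)
  ultimately show ?case by (simp add: info_sum_def)
qed (simp add: info_sum_def)

lemma iterate_upper:
  assumes \<delta>: "\<forall>A\<in>\<R>. near_similarity \<epsilon> \<delta> s T D A" and x: "\<And>n. charged ((T ^^ n) x)" and r: "0 < r"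
    and small: "\<And>k. k \<le> n \<Longrightarrow> r * dilation \<epsilon> k x \<le> \<delta>"
  shows "ln (ball_mass x r) \<le> info_sum \<epsilon> n r x"
proof -
  have xs: "x \<in> space M" using x[of 0] by (simp add: charged_def)
  have "ln (ball_mass x r) \<le> ln (ball_mass ((T ^^ n) x) (r * dilation \<epsilon> n x)) + info_sum \<epsilon> n r x"
    using small
  proof (induction n)
    case (Suc n)
    let ?r = "r * dilation \<epsilon> n x"
    have r0: "0 < ?r" using r dilation_pos[OF xs] by simp
    have eq: "?r * (exp \<epsilon> * D ((T ^^ n) x)) = r * dilation \<epsilon> (Suc n) x" by (simp add: dilation_Suc)
    have "ln (ball_mass ((T ^^ n) x) ?r) \<le> ln (ball_mass ((T ^^ Suc n) x) (r * dilation \<epsilon> (Suc n) x)) +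
       (P.ball_info \<R> ?r ((T ^^ n) x) - Q.ball_info \<R> (r * dilation \<epsilon> (Suc n) x) ((T ^^ n) x))"
      using step_upper[OF \<delta> x[of n] r0] Suc.prems[of n] unfolding eq by simp
    moreover have "ln (ball_mass x r) \<le> ln (ball_mass ((T ^^ n) x) ?r) + info_sum \<epsilon> n r x"
      by (rule Suc.IH) (use Suc.prems in simp)
    ultimately show ?case by (simp add: info_sum_def)
  qed (simp add: info_sum_def)
  moreover have "0 < ball_mass ((T ^^ n) x) (r * dilation \<epsilon> n x)"
    using r dilation_pos[OF xs] by (intro charged_ball_mass(1) x) simp
  then have "ln (ball_mass ((T ^^ n) x) (r * dilation \<epsilon> n x)) \<le> 0"
    by (simp add: ball_mass_def)
  ultimately show ?thesis by linarith
qed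

text \<open>Finitely many balls of half the radius cover the bounded image of \<open>s\<close>; almost every point lies in
  the preimage of one that carries mass.\<close>

lemma ball_mass_lower_bound:
  assumes c: "0 < c"
  shows "\<exists>\<kappa>>0. AE x in M. \<kappa> \<le> ball_mass x c"
proof -
  have "compact (closure (s ` space M))" using bounded_s by (simp add: compact_closure)
  then obtain K where K: "finite K" "closure (s ` space M) \<subseteq> (\<Union>k\<in>K. ball k (c/2))"
    using seq_compact_imp_totally_bounded[OF compact_imp_seq_compact, rule_format, of "closure (s ` space M)" "c/2"] c
    by (auto intro: that)
  define U where "U k = s -` ball k (c/2) \<inter> space M" for k
  have U [measurable]: "U k \<in> sets M" for k unfolding U_def by measurable
  define \<kappa> where "\<kappa> = Min (insert 1 {prob (U k) | k. k \<in> K \<and> 0 < prob (U k)})"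
  have fin: "finite (insert 1 {prob (U k) | k. k \<in> K \<and> 0 < prob (U k)})" using K by simp
  have "0 < \<kappa>" unfolding \<kappa>_def using fin by (subst Min_gr_iff) auto
  have "AE x in M. x \<notin> U k" if "\<not> 0 < prob (U k)" for k
    using that by (intro AE_not_in) (simp add: null_sets_def emeasure_eq_measure zero_less_measure_iff)
  then have "AE x in M. \<forall>k\<in>K. \<not> 0 < prob (U k) \<longrightarrow> x \<notin> U k"
    by (intro AE_finite_allI K) auto
  then have "AE x in M. \<kappa> \<le> ball_mass x c"
    using AE_space
  proof eventually_elim
    case (elim x)
    have "s x \<in> closure (s ` space M)" using closure_subset[of "s ` space M"] elim(2) by (rule subsetD[OF _ imageI])
    then obtain k where k: "k \<in> K" "s x \<in> ball k (c/2)" using K by blast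
    then have xU: "x \<in> U k" using elim by (simp add: U_def)
    then have "0 < prob (U k)" using elim k by blast
    then have "\<kappa> \<le> prob (U k)" unfolding \<kappa>_def using fin k by (intro Min_le) auto
    also have "\<dots> \<le> ball_mass x c" unfolding ball_mass_def
    proof (rule finite_measure_mono)
      show "U k \<subseteq> factor_ball M s x c"
      proof
        fix y assume y: "y \<in> U k"
        have "dist (s y) (s x) \<le> dist k (s y) + dist k (s x)" by (rule dist_triangle3)
        also have "\<dots> < c" using y xU by (simp add: U_def)
        finally show "y \<in> factor_ball M s x c" using y by (simp add: factor_ball_def U_def)
      qed
    qed simp
    finally show ?case .
  qed
  then show ?thesis using \<open>0 < \<kappa>\<close> by blast
qed

abbreviation "entropy_jump x \<equiv> cond_info M \<R> Q.F x - cond_info M \<R> P.F x"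

abbreviation "lyapunov \<equiv> real_cond_exp M \<I> (\<lambda>x. ln (D x))"

abbreviation "local_entropy \<equiv> real_cond_exp M \<I> entropy_jump"

lemma integrable_ln_D: "integrable M (\<lambda>x. ln (D x))"
proof (rule integrable_const_bound[where B = "\<bar>ln (C * L)\<bar> + \<bar>ln Dmax\<bar>"])
  show "AE x in M. norm (ln (D x)) \<le> \<bar>ln (C * L)\<bar> + \<bar>ln Dmax\<bar>"
    using AE_space
  proof eventually_elim
    case (elim x)
    have "0 < C * L" using C L by simp
    then have "ln (C * L) \<le> ln (D x)" "ln (D x) \<le> ln Dmax"
      using D_bounds[OF elim] D_le[OF elim] by auto
    then show ?case by simp
  qed
qed measurable

lemma integrable_entropy_jump: "integrable M entropy_jump"
proof -
  define \<tau> where "\<tau> N = (1/2::real) ^ N" for N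
  have \<tau>: "0 < \<tau> N \<and> \<tau> N \<le> 1" "\<tau> \<longlonglongrightarrow> 0" for N
    by (auto simp: \<tau>_def[abs_def] power_le_one intro: LIMSEQ_realpow_zero)
  show ?thesis
    using P.information_limit(1)[OF bounded_s \<R> \<tau>] Q.information_limit(1)[OF bounded_sT \<R> \<tau>] by simp
qed

lemma ln_dilation: "x \<in> space M \<Longrightarrow> ln (dilation \<sigma> n x) = \<sigma> * real n + birkhoff_sum (\<lambda>x. ln (D x)) n x"
proof (induction n)
  case (Suc n)
  then show ?case
    using dilation_pos[OF Suc.prems, of \<sigma> n] D_bounds(2)[OF funpow_space[OF Suc.prems], of n]
    by (simp add: dilation_Suc ln_mult birkhoff_sum_def algebra_simps)
qed (simp add: birkhoff_sum_def)

lemma lyapunov_lower: "AE x in M. ln L \<le> lyapunov x"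
  using birkhoff[OF integrable_ln_D] AE_space
proof eventually_elim
  case (elim x)
  have "(\<lambda>n. ln C / real n + ln L) \<longlonglongrightarrow> 0 + ln L" by (intro tendsto_intros lim_const_over_n)
  then have "(\<lambda>n. ln C / real n + ln L) \<longlonglongrightarrow> ln L" by simp
  from this elim(1) show ?case
  proof (rule LIMSEQ_le)
    have "ln C / real n + ln L \<le> birkhoff_sum (\<lambda>x. ln (D x)) n x / real n" if "1 \<le> n" for n
    proof -
      have "C * L ^ n \<le> dilation 0 n x" using growth[OF elim(2) that] by (simp add: dilation_def)
      moreover have "0 < C * L ^ n" using C L by simp
      ultimately have "ln (C * L ^ n) \<le> ln (dilation 0 n x)" by simp
      then have "ln C + real n * ln L \<le> birkhoff_sum (\<lambda>x. ln (D x)) n x"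
        using C L by (simp add: ln_dilation[OF elim(2)] ln_mult ln_realpow)
      then have "(ln C + real n * ln L) / real n \<le> birkhoff_sum (\<lambda>x. ln (D x)) n x / real n"
        by (intro divide_right_mono) auto
      then show ?thesis using that by (simp add: add_divide_distrib)
    qed
    then show "\<exists>N. \<forall>n\<ge>N. ln C / real n + ln L \<le> birkhoff_sum (\<lambda>x. ln (D x)) n x / real n" by blast
  qed
qed

text \<open>\<open>N r\<close> is a number of steps that brings the initial radius \<open>r\<close> to a fixed size, at least \<open>c\<close>, and
  on the way there no radius exceeds the distortion scale \<open>\<delta>\<close>; and the information gathered up to that
  time has the expected rate.\<close>

definition stopping_rule :: "real \<Rightarrow> real \<Rightarrow> real \<Rightarrow> (real \<Rightarrow> nat) \<Rightarrow> 'a \<Rightarrow> bool" where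
  "stopping_rule \<sigma> \<delta> c N x \<longleftrightarrow>
     (\<forall>\<^sub>F r in at_right 0. (\<forall>k\<le>N r. r * dilation \<sigma> k x \<le> \<delta>) \<and> c \<le> r * dilation \<sigma> (N r) x) \<and>
     ((\<lambda>r. info_sum \<sigma> (N r) r x / ln r) \<longlongrightarrow> local_entropy x / (lyapunov x + \<sigma>)) (at_right 0)"

text \<open>The iteration stops at the first time \<open>N r\<close> after which the radius would reach \<open>\<rho>\<close>. By expansion the
  radius at time \<open>k\<close> is then below \<open>\<theta> ^ (N r - k)\<close>, so the \<open>k\<close>-th term of \<open>info_sum\<close> differs from the
  value of \<open>- entropy_jump\<close> at the \<open>k\<close>-th point of the orbit by an error of the kind that \<open>maker\<close> controls.\<close>

lemma info_sum_asymptotics: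
  assumes \<sigma>: "1 < exp \<sigma> * L" and \<delta>: "0 < \<delta>"
  shows "\<exists>c>0. AE x in M. \<exists>N. stopping_rule \<sigma> \<delta> c N x"
proof -
  define \<theta> where "\<theta> = inverse (exp \<sigma> * L)"
  have \<theta>: "0 < \<theta>" "\<theta> < 1"
  proof -
    have "0 < exp \<sigma> * L" using \<sigma> by linarith
    then show "0 < \<theta>" "\<theta> < 1" using \<sigma>
      unfolding \<theta>_def inverse_less_1_iff by (simp_all only: inverse_positive_iff_positive simp_thms)
  qed
  define \<tau> where "\<tau> N = \<theta> ^ N" for N
  have \<tau>: "0 < \<tau> N \<and> \<tau> N \<le> 1" "\<tau> \<longlonglongrightarrow> 0" for N
    using \<theta> by (auto simp: \<tau>_def[abs_def] power_le_one intro: LIMSEQ_realpow_zero)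
  define C' where "C' = min C 1"
  have C': "0 < C'" "C' \<le> 1" using C by (auto simp: C'_def)
  \<comment> \<open>The factor \<open>C'\<close> absorbs the constant in \<open>dilation_growth\<close>; \<open>\<theta>\<close> makes up for the
    index shift in the second information, which is taken one step later.\<close>
  define \<rho> where "\<rho> = C' * \<theta> * min \<delta> 1"
  have \<rho>: "0 < \<rho>" "\<rho> < 1"
  proof -
    show "0 < \<rho>" using C' \<theta> \<delta> by (simp add: \<rho>_def)
    have "\<rho> \<le> 1 * \<theta> * 1" unfolding \<rho>_def using C' \<theta> \<delta> by (intro mult_mono) auto
    then show "\<rho> < 1" using \<theta> by simp
  qed
  have "\<exists>x. x \<in> space M" using not_empty by blast
  then have Dmax: "0 < Dmax" using D_bounds(2) D_le by (meson less_le_trans)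
  define c where "c = \<rho> / (exp \<sigma> * Dmax)"
  have c: "0 < c" using \<rho> Dmax by (simp add: c_def)
  obtain eP HP where eP: "integrable M HP" "\<And>N. eP N \<in> borel_measurable M" "\<And>N x. 0 \<le> eP N x \<and> eP N x \<le> HP x"
      "AE x in M. (\<lambda>N. eP N x) \<longlonglongrightarrow> 0"
      "AE x in M. \<forall>N r. 0 < r \<and> r < \<tau> N \<longrightarrow> \<bar>P.ball_info \<R> r x - cond_info M \<R> P.F x\<bar> \<le> eP N x"
    using P.information_limit(2)[OF bounded_s \<R> \<tau>] by blast
  obtain eQ HQ where eQ: "integrable M HQ" "\<And>N. eQ N \<in> borel_measurable M" "\<And>N x. 0 \<le> eQ N x \<and> eQ N x \<le> HQ x"
      "AE x in M. (\<lambda>N. eQ N x) \<longlonglongrightarrow> 0"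
      "AE x in M. \<forall>N r. 0 < r \<and> r < \<tau> N \<longrightarrow> \<bar>Q.ball_info \<R> r x - cond_info M \<R> Q.F x\<bar> \<le> eQ N x"
    using Q.information_limit(2)[OF bounded_sT \<R> \<tau>] by blast
  have "AE x in M. \<exists>N. stopping_rule \<sigma> \<delta> c N x"
    using AE_space lyapunov_lower birkhoff[OF integrable_ln_D] birkhoff[OF integrable_entropy_jump]
      maker[OF eP(2,1,3,4)] maker[OF eQ(2,1,3,4)] AE_funpow[OF eP(5)] AE_funpow[OF eQ(5)]
  proof eventually_elim
    case (elim x)
    note x = elim(1)
    note P_dev = elim(7)[rule_format] and Q_dev = elim(8)[rule_format]
    define \<Lambda> where "\<Lambda> = lyapunov x"
    define h where "h = local_entropy x"
    define a where "a n = dilation \<sigma> n x" for n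
    have a0: "0 < a n" for n using dilation_pos[OF x] by (simp add: a_def)
    have \<Lambda>: "0 < \<Lambda> + \<sigma>"
    proof -
      have "ln 1 < ln (exp \<sigma> * L)" using \<sigma> by (subst ln_less_cancel_iff) auto
      then have "0 < \<sigma> + ln L" using L by (simp add: ln_mult)
      then show ?thesis using elim(2) by (simp add: \<Lambda>_def)
    qed
    have grow: "a k \<le> a n * (\<theta> ^ (n - k) / C')" if "k \<le> n" for k n
    proof -
      have "C' * (exp \<sigma> * L) ^ (n - k) * a k \<le> a n"
        using dilation_growth[OF x that] by (simp add: a_def C'_def)
      moreover have "0 < C' * (exp \<sigma> * L) ^ (n - k)" using C' \<sigma> by (simp add: L less_trans[OF zero_less_one L])
      ultimately have "a k \<le> a n / (C' * (exp \<sigma> * L) ^ (n - k))" by (simp add: pos_le_divide_eq mult.commute)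
      also have "\<dots> = a n * (\<theta> ^ (n - k) / C')" by (simp add: \<theta>_def power_inverse field_simps)
      finally show ?thesis .
    qed
    have ex: "\<exists>n. \<rho> \<le> r * a (Suc n)" if r: "0 < r" for r
    proof -
      obtain n where n: "\<theta> ^ n < r * C' / \<rho>" using real_arch_pow_inv[OF _ \<theta>(2), of "r * C' / \<rho>"] r C' \<rho> by auto
      have "1 \<le> a (Suc n) * (\<theta> ^ Suc n / C')" using grow[of 0 "Suc n"] by (simp add: a_def)
      also have "\<dots> \<le> a (Suc n) * (\<theta> ^ n / C')"
        using a0[of "Suc n"] \<theta> C' by (intro mult_left_mono divide_right_mono) (auto intro: mult_left_le_one_le)
      also have "\<dots> \<le> a (Suc n) * (r / \<rho>)"
      proof (rule mult_left_mono)
        show "\<theta> ^ n / C' \<le> r / \<rho>" using n C' by (simp add: pos_divide_le_eq mult.commute)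
      qed (use a0[of "Suc n"] in simp)
      finally have "\<rho> \<le> r * a (Suc n)" using \<rho> by (simp add: pos_le_divide_eq mult.commute)
      then show ?thesis ..
    qed
    define N where "N r = (LEAST n. \<rho> \<le> r * a (Suc n))" for r
    have N1: "\<rho> \<le> r * a (Suc (N r))" if "0 < r" for r
      unfolding N_def using LeastI_ex[OF ex[OF that]] .
    have N2: "r * a (N r) < \<rho>" if "0 < r" "r < \<rho>" for r
    proof (cases "N r")
      case 0 then show ?thesis using that by (simp add: a_def)
    next
      case (Suc j)
      then have "\<not> \<rho> \<le> r * a (Suc j)" using not_less_Least[of j "\<lambda>n. \<rho> \<le> r * a (Suc n)"] by (simp add: N_def)
      then show ?thesis using Suc by simp
    qed
    have N3: "c \<le> r * a (N r)" if "0 < r" for r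
    proof -
      have "\<rho> \<le> r * (a (N r) * (exp \<sigma> * D ((T ^^ N r) x)))" using N1[OF that] by (simp add: a_def dilation_Suc)
      also have "\<dots> \<le> r * (a (N r) * (exp \<sigma> * Dmax))"
        using that a0[of "N r"] D_le[OF funpow_space[OF x]] by (intro mult_left_mono) auto
      finally show ?thesis using Dmax by (simp add: c_def pos_divide_le_eq mult_ac)
    qed
    have small: "r * a k < \<theta> * min \<delta> 1 * \<theta> ^ (N r - k)" if r: "0 < r" "r < \<rho>" and k: "k \<le> N r" for r k
    proof -
      have "r * a k \<le> r * a (N r) * (\<theta> ^ (N r - k) / C')"
        using mult_left_mono[OF grow[OF k], of r] r by (simp add: mult.assoc)
      also have "\<dots> < \<rho> * (\<theta> ^ (N r - k) / C')"
        using N2[OF r] \<theta> C' by (intro mult_strict_right_mono) auto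
      also have "\<dots> = \<theta> * min \<delta> 1 * \<theta> ^ (N r - k)" using C' by (simp add: \<rho>_def)
      finally show ?thesis .
    qed
    have small\<delta>: "r * a k \<le> \<delta>" if r: "0 < r" "r < \<rho>" and k: "k \<le> N r" for r k
    proof -
      note small[OF that]
      also have "\<theta> * min \<delta> 1 * \<theta> ^ (N r - k) \<le> 1 * \<delta> * 1"
        using \<theta> \<delta> by (intro mult_mono) (auto intro: power_le_one)
      finally show ?thesis by simp
    qed
    have small\<tau>: "r * a k < \<theta> * \<tau> (N r - k)" if r: "0 < r" "r < \<rho>" and k: "k \<le> N r" for r k
    proof -
      note small[OF that]
      also have "\<theta> * min \<delta> 1 * \<theta> ^ (N r - k) \<le> \<theta> * 1 * \<theta> ^ (N r - k)"
        using \<theta> \<delta> by (intro mult_right_mono mult_left_mono) auto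
      finally show ?thesis by (simp add: \<tau>_def)
    qed
    have ev: "\<forall>\<^sub>F r in at_right 0. 0 < r \<and> r < \<rho>"
      unfolding eventually_at_right_field using \<rho> by auto
    have Ninf: "filterlim N at_top (at_right 0)"
      unfolding filterlim_at_top
    proof
      fix K :: nat
      define S where "S = 1 + (\<Sum>j\<le>Suc K. a j)"
      have aS: "a j \<le> S" if "j \<le> Suc K" for j
      proof -
        have "a j \<le> (\<Sum>j\<le>Suc K. a j)" using that a0 by (intro member_le_sum) (auto intro: less_imp_le)
        then show ?thesis by (simp add: S_def)
      qed
      have S: "0 < S" using aS[of 0] a0[of 0] by simp
      have "K \<le> N r" if r: "0 < r" "r < \<rho> / S" for r
      proof (rule ccontr)
        assume "\<not> K \<le> N r"
        then have "r * a (Suc (N r)) \<le> r * S" using r by (intro mult_left_mono aS) auto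
        also have "\<dots> < \<rho>" using r S by (simp add: pos_less_divide_eq)
        finally show False using N1[OF r(1)] by simp
      qed
      then show "\<forall>\<^sub>F r in at_right 0. K \<le> N r"
        unfolding eventually_at_right_field using \<rho> S by (intro exI[of _ "\<rho> / S"]) auto
    qed
    have Ninf': "filterlim (\<lambda>r. real (N r)) at_top (at_right 0)"
      by (rule filterlim_compose[OF filterlim_real_sequentially Ninf])
    have N0: "\<forall>\<^sub>F r in at_right 0. 0 < N r" 
      using filterlim_at_top[THEN iffD1, OF Ninf, rule_format, of 1] by (rule eventually_mono) simp
    \<comment> \<open>The radius at the stopping time lies between \<open>c\<close> and \<open>\<rho>\<close>, so
      \<open>ln r\<close> is minus the logarithm of the dilation up to \<open>O(1)\<close>.\<close>
    have lnr: "((\<lambda>r. ln r / real (N r)) \<longlongrightarrow> - (\<sigma> + \<Lambda>)) (at_right 0)"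
    proof -
      have 1: "((\<lambda>r. ln (r * a (N r)) / real (N r)) \<longlongrightarrow> 0) (at_right 0)"
      proof (rule Lim_null_comparison)
        show "\<forall>\<^sub>F r in at_right 0. norm (ln (r * a (N r)) / real (N r)) \<le> (\<bar>ln c\<bar> + \<bar>ln \<rho>\<bar>) / real (N r)"
          using ev
        proof eventually_elim
          case (elim r)
          have "ln c \<le> ln (r * a (N r))" "ln (r * a (N r)) \<le> ln \<rho>"
            using N3[of r] N2[of r] elim c by auto
          then have "\<bar>ln (r * a (N r))\<bar> \<le> \<bar>ln c\<bar> + \<bar>ln \<rho>\<bar>" by linarith
          then show ?case by (simp add: abs_divide divide_right_mono)
        qed
        show "((\<lambda>r. (\<bar>ln c\<bar> + \<bar>ln \<rho>\<bar>) / real (N r)) \<longlongrightarrow> 0) (at_right 0)"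
          by (rule tendsto_divide_0[OF tendsto_const filterlim_at_top_imp_at_infinity[OF Ninf']])
      qed
      have 2: "((\<lambda>r. birkhoff_sum (\<lambda>x. ln (D x)) (N r) x / real (N r)) \<longlongrightarrow> \<Lambda>) (at_right 0)"
        using filterlim_compose[OF elim(3) Ninf] by (simp add: \<Lambda>_def)
      have "((\<lambda>r. ln (r * a (N r)) / real (N r) - (\<sigma> + birkhoff_sum (\<lambda>x. ln (D x)) (N r) x / real (N r))) \<longlongrightarrow> 0 - (\<sigma> + \<Lambda>)) (at_right 0)"
        by (intro tendsto_intros 1 2)
      moreover have "\<forall>\<^sub>F r in at_right 0. ln (r * a (N r)) / real (N r) - (\<sigma> + birkhoff_sum (\<lambda>x. ln (D x)) (N r) x / real (N r)) = ln r / real (N r)"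
        using ev N0
      proof eventually_elim
        case (elim r)
        have "ln (r * a (N r)) = ln r + (\<sigma> * real (N r) + birkhoff_sum (\<lambda>x. ln (D x)) (N r) x)"
          using elim a0[of "N r"] by (simp add: ln_mult ln_dilation[OF x] a_def)
        then show ?case using elim by (simp add: add_divide_distrib)
      qed
      ultimately show ?thesis by (auto intro: Lim_transform_eventually)
    qed
    have info: "((\<lambda>r. info_sum \<sigma> (N r) r x / real (N r)) \<longlongrightarrow> - h) (at_right 0)"
    proof -
      let ?E = "\<lambda>n. (\<Sum>k<n. eP (n - k) ((T ^^ k) x)) / real n + (\<Sum>k<n. eQ (n - k) ((T ^^ k) x)) / real n"
      let ?B = "\<lambda>n. birkhoff_sum entropy_jump n x"
      have termwise: "\<bar>(P.ball_info \<R> (r * a k) ((T ^^ k) x) - cond_info M \<R> P.F ((T ^^ k) x)) -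
            (Q.ball_info \<R> (r * a (Suc k)) ((T ^^ k) x) - cond_info M \<R> Q.F ((T ^^ k) x))\<bar>
          \<le> eP (N r - k) ((T ^^ k) x) + eQ (N r - k) ((T ^^ k) x)"
        if r: "0 < r \<and> r < \<rho>" and k: "k < N r" for r k
      proof -
        have pos: "0 < r * a k" "0 < r * a (Suc k)" using r a0 by auto
        have "r * a k < \<theta> * \<tau> (N r - k)" by (rule small\<tau>) (use r k in auto)
        also have "\<dots> \<le> 1 * \<tau> (N r - k)"
          using \<theta> \<tau>(1)[of "N r - k"] by (intro mult_right_mono less_imp_le) auto
        finally have 1: "r * a k < \<tau> (N r - k)" by simp
        have "r * a (Suc k) < \<theta> * \<tau> (N r - Suc k)" by (rule small\<tau>) (use r k in auto)
        also have "\<dots> = \<tau> (Suc (N r - Suc k))" by (simp add: \<tau>_def)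
        also have "Suc (N r - Suc k) = N r - k" by (rule Suc_diff_Suc[OF k])
        finally have 2: "r * a (Suc k) < \<tau> (N r - k)" .
        have "\<bar>P.ball_info \<R> (r * a k) ((T ^^ k) x) - cond_info M \<R> P.F ((T ^^ k) x)\<bar> \<le> eP (N r - k) ((T ^^ k) x)"
          by (rule P_dev) (use pos 1 in simp)
        moreover have "\<bar>Q.ball_info \<R> (r * a (Suc k)) ((T ^^ k) x) - cond_info M \<R> Q.F ((T ^^ k) x)\<bar> \<le> eQ (N r - k) ((T ^^ k) x)"
          by (rule Q_dev) (use pos 2 in simp)
        ultimately show ?thesis by linarith
      qed
      have "?E \<longlonglongrightarrow> 0 + 0" using elim(5,6) by (rule tendsto_add)
      then have E: "((\<lambda>r. ?E (N r)) \<longlongrightarrow> 0) (at_right 0)" using filterlim_compose[OF _ Ninf] by simp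
      have "((\<lambda>r. info_sum \<sigma> (N r) r x / real (N r) + ?B (N r) / real (N r)) \<longlongrightarrow> 0) (at_right 0)"
      proof (rule Lim_null_comparison[OF _ E])
        show "\<forall>\<^sub>F r in at_right 0. norm (info_sum \<sigma> (N r) r x / real (N r) + ?B (N r) / real (N r)) \<le> ?E (N r)"
          using ev
        proof eventually_elim
          case (elim r)
          let ?n = "N r"
          let ?p = "\<lambda>k. P.ball_info \<R> (r * a k) ((T ^^ k) x) - cond_info M \<R> P.F ((T ^^ k) x)"
          let ?q = "\<lambda>k. Q.ball_info \<R> (r * a (Suc k)) ((T ^^ k) x) - cond_info M \<R> Q.F ((T ^^ k) x)"
          have eq: "info_sum \<sigma> ?n r x + ?B ?n = (\<Sum>k<?n. ?p k - ?q k)"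
            by (simp add: info_sum_def birkhoff_sum_def a_def sum_subtractf sum.distrib)
          have "\<bar>info_sum \<sigma> ?n r x + ?B ?n\<bar> \<le> (\<Sum>k<?n. \<bar>?p k - ?q k\<bar>)" unfolding eq by (rule sum_abs)
          also have "\<dots> \<le> (\<Sum>k<?n. eP (?n - k) ((T ^^ k) x) + eQ (?n - k) ((T ^^ k) x))"
            by (rule sum_mono) (use termwise[OF elim] in simp)
          finally have "\<bar>info_sum \<sigma> ?n r x + ?B ?n\<bar> \<le> (\<Sum>k<?n. eP (?n - k) ((T ^^ k) x)) + (\<Sum>k<?n. eQ (?n - k) ((T ^^ k) x))"
            by (simp add: sum.distrib)
          then show ?case by (simp add: abs_divide divide_right_mono flip: add_divide_distrib)
        qed
      qed
      moreover have "((\<lambda>r. ?B (N r) / real (N r)) \<longlongrightarrow> h) (at_right 0)"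
        using filterlim_compose[OF elim(4) Ninf] by (simp add: h_def)
      ultimately have "((\<lambda>r. (info_sum \<sigma> (N r) r x / real (N r) + ?B (N r) / real (N r)) - ?B (N r) / real (N r)) \<longlongrightarrow> 0 - h) (at_right 0)"
        by (rule tendsto_diff)
      then show ?thesis by simp
    qed
    have "((\<lambda>r. (info_sum \<sigma> (N r) r x / real (N r)) / (ln r / real (N r))) \<longlongrightarrow> (- h) / (- (\<sigma> + \<Lambda>))) (at_right 0)"
      using \<Lambda> by (intro tendsto_divide info lnr) auto
    moreover have "\<forall>\<^sub>F r in at_right 0. (info_sum \<sigma> (N r) r x / real (N r)) / (ln r / real (N r)) = info_sum \<sigma> (N r) r x / ln r"
      using N0 by eventually_elim simp
    ultimately have "((\<lambda>r. info_sum \<sigma> (N r) r x / ln r) \<longlongrightarrow> (- h) / (- (\<sigma> + \<Lambda>))) (at_right 0)"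
      by (rule Lim_transform_eventually)
    moreover have "(- h) / (- (\<sigma> + \<Lambda>)) = h / (\<Lambda> + \<sigma>)"
      by (simp only: minus_divide_divide add.commute)
    ultimately have "((\<lambda>r. info_sum \<sigma> (N r) r x / ln r) \<longlongrightarrow> h / (\<Lambda> + \<sigma>)) (at_right 0)"
      by (simp only:)
    moreover have "\<forall>\<^sub>F r in at_right 0. (\<forall>k\<le>N r. r * dilation \<sigma> k x \<le> \<delta>) \<and> c \<le> r * dilation \<sigma> (N r) x"
      using ev by eventually_elim (use small\<delta> N3 in \<open>auto simp: a_def\<close>)
    ultimately show ?case unfolding \<Lambda>_def h_def stopping_rule_def by (intro exI[of _ N]) blast
  qed
  then show ?thesis using c by blast
qed

text \<open>For every \<open>\<epsilon>\<close> the logarithmic mass ratio lies asymptotically between the local entropy divided by the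
  exponent plus \<open>\<epsilon>\<close>, and the local entropy divided by the exponent minus \<open>\<epsilon>\<close>.\<close>

theorem local_dimension:
  "AE x in M. ((\<lambda>r. ln (ball_mass x r) / ln r) \<longlongrightarrow>
     local_entropy x / lyapunov x) (at_right 0)"
proof -
  define \<Lambda> where "\<Lambda> = lyapunov"
  define h where "h = local_entropy"
  \<comment> \<open>Below \<open>ln L\<close>, so that the perturbed system is still expanding.\<close>
  define \<epsilon> where "\<epsilon> j = ln L / (real j + 2)" for j :: nat
  have lnL: "0 < ln L" using L by simp
  have \<epsilon>: "0 < \<epsilon> j" "\<epsilon> j < ln L" for j using lnL by (auto simp: \<epsilon>_def pos_divide_less_eq mult_less_cancel_left1)
  have \<epsilon>0: "\<epsilon> \<longlonglongrightarrow> 0" unfolding \<epsilon>_def by real_asymp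
  have expand: "1 < exp (\<epsilon> j) * L" "1 < exp (- \<epsilon> j) * L" for j
  proof -
    have "exp 0 < exp (\<epsilon> j + ln L)" "exp 0 < exp (- \<epsilon> j + ln L)" using \<epsilon>[of j] lnL by (simp_all only: exp_less_cancel_iff)
    then show "1 < exp (\<epsilon> j) * L" "1 < exp (- \<epsilon> j) * L" using L by (simp_all add: exp_add exp_minus exp_diff field_simps)
  qed
  have upper: "AE x in M. \<exists>g. (g \<longlongrightarrow> h x / (\<Lambda> x - \<epsilon> j)) (at_right 0) \<and> (\<forall>\<^sub>F r in at_right 0. ln (ball_mass x r) / ln r \<le> g r)" for j
  proof -
    obtain \<delta> where \<delta>: "0 < \<delta>" "\<forall>A\<in>\<R>. near_similarity (\<epsilon> j) \<delta> s T D A"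
      using distortion[OF \<epsilon>(1)[of j]] by blast
    obtain c where c: "0 < c" and as: "AE x in M. \<exists>N. stopping_rule (- \<epsilon> j) \<delta> c N x"
      using info_sum_asymptotics[OF expand(2) \<delta>(1)] by blast
    obtain \<kappa> where \<kappa>: "0 < \<kappa>" and low: "AE x in M. \<kappa> \<le> ball_mass x c" using ball_mass_lower_bound[OF c] by blast
    show ?thesis using as AE_funpow[OF low] AE_charged
    proof eventually_elim
      case (elim x)
      obtain N where N: "\<forall>\<^sub>F r in at_right 0. (\<forall>k\<le>N r. r * dilation (- \<epsilon> j) k x \<le> \<delta>) \<and> c \<le> r * dilation (- \<epsilon> j) (N r) x"
        "((\<lambda>r. info_sum (- \<epsilon> j) (N r) r x / ln r) \<longlongrightarrow> h x / (\<Lambda> x - \<epsilon> j)) (at_right 0)"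
        using elim(1) by (auto simp: h_def \<Lambda>_def stopping_rule_def)
      have "((\<lambda>r. ln \<kappa> / ln r) \<longlongrightarrow> 0) (at_right 0)" by real_asymp
      then have "((\<lambda>r. ln \<kappa> / ln r + info_sum (- \<epsilon> j) (N r) r x / ln r) \<longlongrightarrow> 0 + h x / (\<Lambda> x - \<epsilon> j)) (at_right 0)"
        by (intro tendsto_add N(2))
      moreover have "\<forall>\<^sub>F r in at_right 0. ln (ball_mass x r) / ln r \<le> ln \<kappa> / ln r + info_sum (- \<epsilon> j) (N r) r x / ln r"
      proof -
        have "\<forall>\<^sub>F r::real in at_right 0. 0 < r \<and> r < 1" unfolding eventually_at_right_field by (intro exI[of _ 1]) auto
        with N(1) show ?thesis
        proof eventually_elim
          case (elim r)
          have charged: "\<And>n. charged ((T ^^ n) x)" using \<open>\<forall>n. charged ((T ^^ n) x)\<close> by blast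
          have "\<kappa> \<le> ball_mass ((T ^^ N r) x) c" using \<open>\<forall>n. \<kappa> \<le> ball_mass ((T ^^ n) x) c\<close> by blast
          also have "\<dots> \<le> ball_mass ((T ^^ N r) x) (r * dilation (- \<epsilon> j) (N r) x)" using elim by (intro ball_mass_mono) simp
          finally have "ln \<kappa> \<le> ln (ball_mass ((T ^^ N r) x) (r * dilation (- \<epsilon> j) (N r) x))" using \<kappa> by simp
          moreover have "ln (ball_mass ((T ^^ N r) x) (r * dilation (- \<epsilon> j) (N r) x)) + info_sum (- \<epsilon> j) (N r) r x \<le> ln (ball_mass x r)"
            using elim by (intro iterate_lower[OF \<delta>(2) charged]) auto
          ultimately have "ln \<kappa> + info_sum (- \<epsilon> j) (N r) r x \<le> ln (ball_mass x r)" by linarith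
          then have "ln (ball_mass x r) / ln r \<le> (ln \<kappa> + info_sum (- \<epsilon> j) (N r) r x) / ln r"
            using elim by (intro divide_right_mono_neg) auto
          then show ?case by (simp add: add_divide_distrib)
        qed
      qed
      ultimately show ?case by auto
    qed
  qed
  have lower: "AE x in M. \<exists>g. (g \<longlongrightarrow> h x / (\<Lambda> x + \<epsilon> j)) (at_right 0) \<and> (\<forall>\<^sub>F r in at_right 0. g r \<le> ln (ball_mass x r) / ln r)" for j
  proof -
    obtain \<delta> where \<delta>: "0 < \<delta>" "\<forall>A\<in>\<R>. near_similarity (\<epsilon> j) \<delta> s T D A"
      using distortion[OF \<epsilon>(1)[of j]] by blast
    obtain c where c: "0 < c" and as: "AE x in M. \<exists>N. stopping_rule (\<epsilon> j) \<delta> c N x"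
      using info_sum_asymptotics[OF expand(1) \<delta>(1)] by blast
    show ?thesis using as AE_charged
    proof eventually_elim
      case (elim x)
      obtain N where N: "\<forall>\<^sub>F r in at_right 0. (\<forall>k\<le>N r. r * dilation (\<epsilon> j) k x \<le> \<delta>) \<and> c \<le> r * dilation (\<epsilon> j) (N r) x"
        "((\<lambda>r. info_sum (\<epsilon> j) (N r) r x / ln r) \<longlongrightarrow> h x / (\<Lambda> x + \<epsilon> j)) (at_right 0)"
        using elim(1) by (auto simp: h_def \<Lambda>_def stopping_rule_def)
      have "\<forall>\<^sub>F r::real in at_right 0. 0 < r \<and> r < 1" unfolding eventually_at_right_field by (intro exI[of _ 1]) auto
      with N(1) have "\<forall>\<^sub>F r in at_right 0. info_sum (\<epsilon> j) (N r) r x / ln r \<le> ln (ball_mass x r) / ln r"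
      proof eventually_elim
        case (elim r)
        have charged: "\<And>n. charged ((T ^^ n) x)" using \<open>\<forall>n. charged ((T ^^ n) x)\<close> by blast
        have "ln (ball_mass x r) \<le> info_sum (\<epsilon> j) (N r) r x"
          using elim by (intro iterate_upper[OF \<delta>(2) charged]) auto
        then show ?case using elim by (intro divide_right_mono_neg) auto
      qed
      then show ?case using N(2) by auto
    qed
  qed
  have "AE x in M. \<forall>j. \<exists>g. (g \<longlongrightarrow> h x / (\<Lambda> x - \<epsilon> j)) (at_right 0) \<and> (\<forall>\<^sub>F r in at_right 0. ln (ball_mass x r) / ln r \<le> g r)"
    "AE x in M. \<forall>j. \<exists>g. (g \<longlongrightarrow> h x / (\<Lambda> x + \<epsilon> j)) (at_right 0) \<and> (\<forall>\<^sub>F r in at_right 0. g r \<le> ln (ball_mass x r) / ln r)"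
    using upper lower by (simp_all add: AE_all_countable)
  then have "AE x in M. ((\<lambda>r. ln (ball_mass x r) / ln r) \<longlongrightarrow> h x / \<Lambda> x) (at_right 0)"
    using lyapunov_lower
  proof eventually_elim
    case (elim x)
    have \<Lambda>: "0 < \<Lambda> x" using elim(3) lnL by (simp add: \<Lambda>_def)
    have lim: "(\<lambda>j. h x / (\<Lambda> x - \<epsilon> j)) \<longlonglongrightarrow> h x / (\<Lambda> x - 0)" "(\<lambda>j. h x / (\<Lambda> x + \<epsilon> j)) \<longlonglongrightarrow> h x / (\<Lambda> x + 0)"
      using \<Lambda> by (intro tendsto_intros \<epsilon>0; simp)+
    show ?case
    proof (rule order_tendstoI)
      fix l assume "l < h x / \<Lambda> x"
      then have "\<forall>\<^sub>F j in sequentially. l < h x / (\<Lambda> x + \<epsilon> j)" using order_tendstoD(1)[OF lim(2)] by simp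
      then obtain j where j: "l < h x / (\<Lambda> x + \<epsilon> j)" by (auto simp: eventually_sequentially)
      obtain g where g: "(g \<longlongrightarrow> h x / (\<Lambda> x + \<epsilon> j)) (at_right 0)" "\<forall>\<^sub>F r in at_right 0. g r \<le> ln (ball_mass x r) / ln r"
        using elim(2) by blast
      from g(2) order_tendstoD(1)[OF g(1) j] show "\<forall>\<^sub>F r in at_right 0. l < ln (ball_mass x r) / ln r"
        by eventually_elim linarith
    next
      fix u assume "h x / \<Lambda> x < u"
      then have "\<forall>\<^sub>F j in sequentially. h x / (\<Lambda> x - \<epsilon> j) < u" using order_tendstoD(2)[OF lim(1)] by simp
      then obtain j where j: "h x / (\<Lambda> x - \<epsilon> j) < u" by (auto simp: eventually_sequentially)
      obtain g where g: "(g \<longlongrightarrow> h x / (\<Lambda> x - \<epsilon> j)) (at_right 0)" "\<forall>\<^sub>F r in at_right 0. ln (ball_mass x r) / ln r \<le> g r"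
        using elim(1) by blast
      from g(2) order_tendstoD(2)[OF g(1) j] show "\<forall>\<^sub>F r in at_right 0. ln (ball_mass x r) / ln r < u"
        by eventually_elim linarith
    qed
  qed
  then show ?thesis by (simp add: h_def \<Lambda>_def)
qed

end

section \<open>The sphere with the chordal metric\<close>

text \<open>The spherical distance is the angle between the stereographic images, so the Euclidean distance of the
  images is the chord of that angle. Estimates below are made for the chord, which is an algebraic
  function in every chart.\<close>

lemma chord_eq: "dist (stereo x) (stereo y) = 2 * sin (dist x y / 2)"
  and dist_le_pi: "dist x y \<le> pi"
proof -
  note bd = inner_unit_bounds[of "stereo x" "stereo y", simplified]
  have d: "cos (dist x y) = stereo x \<bullet> stereo y" "0 \<le> dist x y" "dist x y \<le> pi"
    using bd by (auto simp: dist_rsphere_def intro: arccos_lbound arccos_ubound)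
  have "(dist (stereo x) (stereo y))\<^sup>2 = 2 - 2 * (stereo x \<bullet> stereo y)"
    by (simp add: dist_norm power2_norm_eq_inner inner_diff inner_commute) 
       (simp flip: power2_norm_eq_inner)
  also have "\<dots> = (2 * sin (dist x y / 2))\<^sup>2"
    using cos_double_sin[of "dist x y / 2"] by (simp add: d(1)[symmetric] power_mult_distrib)
  finally show "dist (stereo x) (stereo y) = 2 * sin (dist x y / 2)"
  proof (subst (asm) power2_eq_iff_nonneg)
    have "0 \<le> sin (dist x y / 2)" by (rule sin_ge_zero) (use d in linarith)+
    then show "0 \<le> 2 * sin (dist x y / 2)" by simp
  qed auto
  show "dist x y \<le> pi" by (rule d)
qed

lemma dist_less_iff_chord:
  assumes "0 < r" "r \<le> pi"
  shows "dist x y < r \<longleftrightarrow> dist (stereo x) (stereo y) < 2 * sin (r / 2)"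
proof -
  have "sin (dist x y / 2) < sin (r / 2) \<longleftrightarrow> dist x y / 2 < r / 2"
    using assms dist_le_pi[of x y] by (intro sin_mono_less_eq) (auto intro: order_trans[of _ 0])
  then show ?thesis by (simp add: chord_eq)
qed

lemma chord_le_dist: "dist (stereo x) (stereo y) \<le> dist x y"
  unfolding chord_eq using sin_x_le_x[of "dist x y / 2"] by simp

lemma dist_small_if_chord_small:
  assumes "0 < e"
  shows "\<exists>\<delta>>0. \<forall>y z. dist (stereo y) (stereo z) < \<delta> \<longrightarrow> dist y z < e"
proof -
  define e' where "e' = min e pi"
  have e': "0 < e'" "e' \<le> pi" "e' \<le> e" using assms by (auto simp: e'_def)
  have "0 < sin (e' / 2)" using e' by (intro sin_gt_zero) auto
  then show ?thesis using dist_less_iff_chord[OF e'(1,2)] e'(3)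
    by (intro exI[of _ "2 * sin (e' / 2)"]) (auto intro: less_le_trans)
qed

lemma continuous_stereo: "continuous_on A stereo"
  unfolding continuous_on_iff using chord_le_dist by (meson le_less_trans)

lemma open_rsphere_vimage:
  assumes U: "open (U :: rsphere set)"
  shows "\<exists>V. open V \<and> U = stereo -` V"
proof -
  have "\<forall>x\<in>U. \<exists>e. 0 < e \<and> e \<le> pi \<and> ball x e \<subseteq> U"
  proof
    fix x assume "x \<in> U"
    then obtain e where "0 < e" "ball x e \<subseteq> U" using U openE by blast
    then show "\<exists>e. 0 < e \<and> e \<le> pi \<and> ball x e \<subseteq> U" by (intro exI[of _ "min e pi"]) auto
  qed
  then obtain e where e: "\<And>x. x \<in> U \<Longrightarrow> 0 < e x \<and> e x \<le> pi \<and> ball x (e x) \<subseteq> U" by metis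
  have ball: "stereo -` ball (stereo x) (2 * sin (e x / 2)) = ball x (e x)" if "x \<in> U" for x
    using dist_less_iff_chord[of "e x" x] e[OF that] by auto
  let ?V = "\<Union>x\<in>U. ball (stereo x) (2 * sin (e x / 2))"
  have "stereo -` ?V = (\<Union>x\<in>U. ball x (e x))" using ball by (auto simp: vimage_UN)
  also have "\<dots> = U" using e by force
  finally show ?thesis by (intro exI[of _ ?V]) auto
qed

text \<open>The stereographic embedding generates the Borel sets of the sphere, so conditioning on the sphere
  coordinate and on its embedding is the same.\<close>

lemma borel_rsphere_vimage:
  assumes "A \<in> sets (borel :: rsphere measure)"
  shows "\<exists>B\<in>sets borel. A = stereo -` B"
proof -
  let ?V = "vimage_algebra UNIV stereo borel"
  have "{S. open S} \<subseteq> sets ?V"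
  proof
    fix S :: "rsphere set" assume "S \<in> {S. open S}"
    then obtain W where "open W" "S = stereo -` W" using open_rsphere_vimage by blast
    then show "S \<in> sets ?V" using in_vimage_algebra[of W borel stereo UNIV] by simp
  qed
  then have "sigma_sets (space ?V) {S. open S} \<subseteq> sets ?V" by (rule sets.sigma_sets_subset)
  then have "sets borel \<subseteq> sets ?V" by (simp add: borel_def)
  then show ?thesis using assms by (auto simp: sets_vimage_algebra2)
qed

text \<open>The spherical metric in a chart is \<open>2 / (chordal_weight u)\<^sup>2\<close> times the Euclidean one, and the chord
  between two points is the Euclidean distance divided by both weights, up to the factor \<open>2\<close>.\<close>

definition chordal_weight :: "complex \<Rightarrow> real" where
  "chordal_weight u = sqrt (1 + (cmod u)\<^sup>2)"

lemma chordal_weight_pos: "0 < chordal_weight u" and chordal_weight_ge_1: "1 \<le> chordal_weight u" and chordal_weight_sq: "(chordal_weight u)\<^sup>2 = 1 + (cmod u)\<^sup>2"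
  by (auto simp: chordal_weight_def add_pos_nonneg)

lemma chordal_weight_triangle: "chordal_weight u \<le> chordal_weight v + cmod (u - v)"
proof -
  have k: "chordal_weight w = norm (1::real, w)" for w by (simp add: chordal_weight_def norm_prod_def)
  have "norm (1::real, u) \<le> norm (1::real, v) + norm ((1::real, u) - (1, v))" by (rule norm_triangle_sub)
  then show ?thesis by (simp add: k norm_prod_def)
qed

lemma isCont_chordal_weight: "isCont chordal_weight u"
  unfolding chordal_weight_def by (intro continuous_intros)

lemma chord_Fin: "dist (stereo (Fin u)) (stereo (Fin v)) = 2 * cmod (u - v) / (chordal_weight u * chordal_weight v)"
proof -
  define a b where "a = (cmod u)\<^sup>2" and "b = (cmod v)\<^sup>2"
  have ab: "0 < 1 + a" "0 < 1 + b" by (auto simp: a_def b_def add_pos_nonneg)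
  have inner: "stereo (Fin u) \<bullet> stereo (Fin v) = (4 * (u \<bullet> v) + (a - 1) * (b - 1)) / ((1 + a) * (1 + b))"
    using ab by (simp add: a_def[symmetric] b_def[symmetric] add_divide_distrib)
  have uv: "(cmod (u - v))\<^sup>2 = a + b - 2 * (u \<bullet> v)"
    by (simp add: power2_norm_eq_inner inner_diff inner_commute a_def b_def)
  have "(dist (stereo (Fin u)) (stereo (Fin v)))\<^sup>2 = 2 - 2 * (stereo (Fin u) \<bullet> stereo (Fin v))"
    unfolding dist_norm power2_norm_eq_inner inner_diff
    by (simp add: inner_commute power2_norm_eq_inner[symmetric] del: stereo.simps)
  also have "\<dots> = 4 * (cmod (u - v))\<^sup>2 / ((1 + a) * (1 + b))"
  proof -
    define n x where "n = (1 + a) * (1 + b)" and "x = 4 * (u \<bullet> v) + (a - 1) * (b - 1)"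
    have "n \<noteq> 0" using ab by (simp add: n_def)
    then have "2 - 2 * (x / n) = (2 * n - 2 * x) / n" by (simp add: diff_divide_distrib)
    also have "2 * n - 2 * x = 4 * (a + b - 2 * (u \<bullet> v))" by (simp add: n_def x_def algebra_simps)
    finally show ?thesis unfolding inner uv n_def x_def .
  qed
  also have "\<dots> = (2 * cmod (u - v) / (chordal_weight u * chordal_weight v))\<^sup>2"
    by (simp add: power_mult_distrib power_divide chordal_weight_sq a_def b_def)
  finally show ?thesis
    by (subst (asm) power2_eq_iff_nonneg) (auto intro!: divide_nonneg_pos mult_pos_pos chordal_weight_pos)
qed

lemma stereo_param_Infty:
  "stereo (param Infty u) = (cnj (fst (stereo (Fin u))), - snd (stereo (Fin u)))"
proof (cases "u = 0")
  case False
  define a where "a = (cmod u)\<^sup>2"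
  have a: "0 < a" using False by (simp add: a_def)
  have inv: "inverse u = (1 / a) *\<^sub>R cnj u"
  proof -
    have "complex_of_real a = u * cnj u" unfolding a_def by (rule complex_norm_square)
    then show ?thesis using False by (simp add: scaleR_conv_of_real divide_inverse)
  qed
  have n: "(cmod (inverse u))\<^sup>2 = 1 / a" by (simp only: norm_inverse power_inverse) (simp add: a_def inverse_eq_divide)
  have "(2 / (1 + 1 / a)) *\<^sub>R inverse u = (2 / (1 + a)) *\<^sub>R cnj u"
  proof -
    have "2 / (1 + 1 / a) * (1 / a) = 2 / (1 + a)" using a by (simp add: field_simps)
    then show ?thesis unfolding inv scaleR_scaleR by (simp only:)
  qed
  moreover have "(1 / a - 1) / (1 + 1 / a) = - ((a - 1) / (1 + a))"
  proof -
    have "1 / a - 1 = (1 - a) / a" "1 + 1 / a = (1 + a) / a" using a by (simp_all add: diff_divide_distrib add_divide_distrib)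
    then have "(1 / a - 1) / (1 + 1 / a) = (1 - a) / (1 + a)" using a by simp
    then show ?thesis by (simp only: minus_divide_left minus_diff_eq)
  qed
  ultimately show ?thesis using False by (simp add: param_def n del: norm_inverse) (simp add: a_def)
qed (simp add: param_def)

text \<open>The chart at infinity differs from the finite one by the isometry of the unit sphere that
  conjugates the first coordinate and reflects the second.\<close>

lemma chord_param: "dist (stereo (param x u)) (stereo (param x v)) = 2 * cmod (u - v) / (chordal_weight u * chordal_weight v)"
proof (cases "x = Infty")
  case True
  have "dist (stereo (param Infty u)) (stereo (param Infty v)) = dist (stereo (Fin u)) (stereo (Fin v))"
    unfolding stereo_param_Infty dist_prod_def
    by (simp add: dist_norm norm_minus_commute power2_commute flip: complex_cnj_diff del: complex_cnj_scaleR stereo.simps)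
  then show ?thesis using True chord_Fin by simp
next
  case False
  then show ?thesis using chord_Fin by (simp add: param_def del: stereo.simps)
qed

lemma coord_param [simp]: "coord x (param x u) = u"
  by (auto simp: coord_def param_def)

lemma param_coord_self [simp]: "param x (coord x x) = x"
  by (cases x) (auto simp: coord_def param_def)

lemma param_coord: "y = param x (coord x y) \<or> y = (if x = Infty then Fin 0 else Infty)"
  by (cases x; cases y) (auto simp: coord_def param_def)

lemma chart_simps: "coord (Fin w) (Fin z) = z" "coord Infty (Fin z) = inverse z" "coord Infty Infty = 0"
  "param (Fin w) z = Fin z" "param Infty z = (if z = 0 then Infty else Fin (inverse z))"
  by (simp_all add: coord_def param_def)

lemma chord_pos: "x \<noteq> y \<Longrightarrow> 0 < dist (stereo x) (stereo y)"
  by (simp add: stereo_inject)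

text \<open>Inverting the formula for the chord: the weight at \<open>y\<close> exceeds that at \<open>x\<close> by at most the distance
  in the chart, so a short chord forces a short distance. The only point outside of the chart is kept
  away by the first bound on \<open>\<delta>\<close>.\<close>

lemma chart_neighbourhood:
  assumes e: "0 < e"
  shows "\<exists>\<delta>>0. \<forall>y. dist (stereo x) (stereo y) < \<delta> \<longrightarrow> (\<exists>u. y = param x u \<and> dist u (coord x x) < e)"
proof -
  define u0 where "u0 = coord x x"
  define w where "w = (if x = Infty then Fin 0 else Infty)"
  have wx: "w \<noteq> x" by (auto simp: w_def)
  define k where "k = chordal_weight u0"
  have k: "1 \<le> k" by (simp add: k_def chordal_weight_ge_1)
  define \<delta> where "\<delta> = min (dist (stereo x) (stereo w)) (min (1 / k) (e / k\<^sup>2))"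
  have "0 < \<delta>" using chord_pos[of x w] wx k e by (auto simp: \<delta>_def)
  moreover have "\<exists>u. y = param x u \<and> dist u u0 < e" if y: "dist (stereo x) (stereo y) < \<delta>" for y
  proof -
    define u where "u = coord x y"
    have "y \<noteq> w" using y by (auto simp: \<delta>_def)
    then have yu: "y = param x u" using param_coord[of y x] by (auto simp: w_def u_def)
    define c t where "c = dist (stereo x) (stereo y)" and "t = cmod (u - u0)"
    have "c = 2 * cmod (u0 - u) / (k * chordal_weight u)"
      using chord_param[of x u0 u] by (simp add: c_def yu u0_def k_def)
    then have "2 * t = c * (k * chordal_weight u)" using chordal_weight_pos[of u] k by (simp add: t_def norm_minus_commute)
    also have "\<dots> \<le> c * (k * (k + t))"
      using chordal_weight_triangle[of u u0] k by (intro mult_left_mono) (auto simp: c_def t_def k_def)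
    finally have "2 * t \<le> c * k\<^sup>2 + (c * k) * t" by (simp add: power2_eq_square algebra_simps)
    moreover have "c * k \<le> 1" using y k by (simp add: c_def \<delta>_def pos_less_divide_eq)
    then have "(c * k) * t \<le> t" by (intro mult_left_le_one_le) (auto simp: c_def t_def k[THEN order_trans[of 0 1, OF zero_le_one]])
    moreover have "c * k\<^sup>2 < e"
    proof -
      have "c < e / k\<^sup>2" using y by (simp add: c_def \<delta>_def)
      moreover have "0 < k\<^sup>2" using k by simp
      ultimately show ?thesis by (simp add: pos_less_divide_eq)
    qed
    ultimately have "t < e" by linarith
    then show ?thesis using yu by (auto simp: t_def dist_norm)
  qed
  ultimately show ?thesis unfolding u0_def by blast
qed

definition chart_rep :: "(rsphere \<Rightarrow> rsphere) \<Rightarrow> rsphere \<Rightarrow> complex \<Rightarrow> complex" where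
  "chart_rep g x = coord (g x) \<circ> g \<circ> param x"

section \<open>Rational maps as conformal maps of the sphere\<close>

text \<open>Differentiability in the charts used by \<open>sph_deriv_norm\<close>, together with the fact that near the point
  these charts really do represent the map and produce no junk values.\<close>

definition chart_diff :: "(rsphere \<Rightarrow> rsphere) \<Rightarrow> rsphere \<Rightarrow> bool" where
  "chart_diff g x \<longleftrightarrow> chart_rep g x field_differentiable at (coord x x) \<and>
     (\<forall>\<^sub>F u in nhds (coord x x). g (param x u) = param (g x) (chart_rep g x u))"

lemma coord_deriv_chart_rep: "coord_deriv g x = deriv (chart_rep g x) (coord x x)"
  by (simp only: coord_deriv_def chart_rep_def)

lemma chart_rep_self: "chart_rep g x (coord x x) = coord (g x) (g x)"
  by (simp add: chart_rep_def)

lemma chart_diff_comp: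
  assumes g: "chart_diff g x" and h: "chart_diff h (g x)"
  shows "chart_diff (h \<circ> g) x" "sph_deriv_norm (h \<circ> g) x = sph_deriv_norm h (g x) * sph_deriv_norm g x"
proof -
  let ?u = "coord x x" and ?F = "chart_rep g x" and ?H = "chart_rep h (g x)"
  obtain F' where F': "(?F has_field_derivative F') (at ?u)" using g by (auto simp: chart_diff_def field_differentiable_def)
  obtain H' where H': "(?H has_field_derivative H') (at (?F ?u))"
    using h by (auto simp: chart_diff_def field_differentiable_def chart_rep_self)
  have "isCont ?F ?u" using F' by (rule DERIV_isCont)
  then have "filterlim ?F (nhds (coord (g x) (g x))) (nhds ?u)"
    using chart_rep_self[of g x] by (metis continuous_at isCont_def tendsto_nhds_iff)
  then have ev: "\<forall>\<^sub>F u in nhds ?u. h (param (g x) (?F u)) = param (h (g x)) (?H (?F u))"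
    using h unfolding chart_diff_def filterlim_iff by blast
  have ev2: "\<forall>\<^sub>F u in nhds ?u. (h \<circ> g) (param x u) = param (h (g x)) (?H (?F u))"
    using ev g unfolding chart_diff_def by (auto elim: eventually_elim2)
  have ev3: "\<forall>\<^sub>F u in nhds ?u. chart_rep (h \<circ> g) x u = (?H \<circ> ?F) u"
    using ev2 by eventually_elim (simp add: chart_rep_def)
  have der: "((?H \<circ> ?F) has_field_derivative H' * F') (at ?u)" by (rule DERIV_chain[OF H' F'])
  then have der': "(chart_rep (h \<circ> g) x has_field_derivative H' * F') (at ?u)"
    using DERIV_cong_ev[OF refl ev3 refl] by blast
  show "chart_diff (h \<circ> g) x"
    unfolding chart_diff_def using der' ev2 ev3
    by (auto simp: field_differentiable_def elim: eventually_elim2)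
  have "coord_deriv (h \<circ> g) x = H' * F'" "coord_deriv g x = F'" "coord_deriv h (g x) = H'"
    using der' F' H' unfolding coord_deriv_chart_rep chart_rep_self by (auto intro: DERIV_imp_deriv)
  moreover have "1 + (cmod (coord (g x) (g x)))\<^sup>2 \<noteq> 0" using one_plus_norm_sq_pos[of "coord (g x) (g x)"] by simp
  ultimately show "sph_deriv_norm (h \<circ> g) x = sph_deriv_norm h (g x) * sph_deriv_norm g x"
    by (simp add: sph_deriv_norm_eq norm_mult)
qed

text \<open>Both points move: the map multiplies all chords near \<open>x\<close> by almost the same factor. This gives
  continuity of the derivative norm without any computation of how it changes between charts.\<close>

definition strict_conformal_at :: "(rsphere \<Rightarrow> rsphere) \<Rightarrow> rsphere \<Rightarrow> bool" where
  "strict_conformal_at g x \<longleftrightarrow> (\<forall>\<epsilon>>0. \<exists>\<delta>>0. \<forall>y z. dist (stereo x) (stereo y) < \<delta> \<longrightarrow> dist (stereo x) (stereo z) < \<delta> \<longrightarrow>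
     \<bar>dist (stereo (g y)) (stereo (g z)) - sph_deriv_norm g x * dist (stereo y) (stereo z)\<bar> \<le> \<epsilon> * dist (stereo y) (stereo z))"

text \<open>The quotient of the two chords is the difference quotient in the charts times a quotient of weights.
  Both converge as the two points approach \<open>x\<close> independently.\<close>

lemma strict_conformal_if_strict_derivative:
  assumes ev: "\<forall>\<^sub>F u in nhds (coord x x). g (param x u) = param (g x) (chart_rep g x u)"
    and der: "(chart_rep g x has_field_derivative F') (at (coord x x))"
    and strict: "\<And>e. 0 < e \<Longrightarrow> \<exists>d>0. \<forall>u v. dist u (coord x x) < d \<longrightarrow> dist v (coord x x) < d \<longrightarrow>
      cmod (chart_rep g x u - chart_rep g x v - F' * (u - v)) \<le> e * cmod (u - v)"
  shows "strict_conformal_at g x"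
  unfolding strict_conformal_at_def
proof (intro allI impI)
  fix \<epsilon> :: real assume \<epsilon>: "0 < \<epsilon>"
  define F where "F = chart_rep g x"
  define u0 where "u0 = coord x x"
  define P where "P = inf (nhds u0 \<times>\<^sub>F nhds u0) (principal {(u, v). u \<noteq> v})"
  define quot where "quot = (\<lambda>(u, v). cmod (F u - F v) / cmod (u - v))"
  define G where "G = (\<lambda>(u, v). chordal_weight u * chordal_weight v / (chordal_weight (F u) * chordal_weight (F v)))"
  have F0: "F u0 = coord (g x) (g x)" by (simp add: F_def u0_def chart_rep_self)
  have "isCont F u0" using DERIV_isCont[OF der] by (simp add: F_def u0_def)
  then have Fl: "(F \<longlongrightarrow> F u0) (nhds u0)" by (simp add: isCont_def tendsto_nhds_iff)
  have kl: "(chordal_weight \<longlongrightarrow> chordal_weight u) (nhds u)" for u using isCont_chordal_weight[of u] by (simp add: isCont_def tendsto_nhds_iff)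
  have fst: "filterlim fst (nhds u0) P" and snd: "filterlim snd (nhds u0) P"
    unfolding P_def by (rule filterlim_mono[OF filterlim_fst order_refl inf_le1] filterlim_mono[OF filterlim_snd order_refl inf_le1])+
  have Gl: "(G \<longlongrightarrow> chordal_weight u0 * chordal_weight u0 / (chordal_weight (F u0) * chordal_weight (F u0))) P"
    unfolding G_def case_prod_unfold
    by (intro tendsto_intros filterlim_compose[OF kl fst] filterlim_compose[OF kl snd]
        filterlim_compose[OF kl filterlim_compose[OF Fl fst]] filterlim_compose[OF kl filterlim_compose[OF Fl snd]])
       (use chordal_weight_pos[of "F u0"] in auto)
  have ql: "(quot \<longlongrightarrow> cmod F') P"
  proof (rule tendstoI)
    fix e :: real assume "0 < e"
    then obtain d where d: "d > 0" "\<And>u v. dist u u0 < d \<Longrightarrow> dist v u0 < d \<Longrightarrow> cmod (F u - F v - F' * (u - v)) \<le> (e / 2) * cmod (u - v)"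
      using strict[of "e/2"] by (auto simp: F_def u0_def)
    have "\<forall>\<^sub>F p in nhds u0 \<times>\<^sub>F nhds u0. dist (fst p) u0 < d \<and> dist (snd p) u0 < d"
      using d(1) by (intro eventually_conj)
        (auto intro!: filterlim_fst[THEN filterlim_iff[THEN iffD1], rule_format] filterlim_snd[THEN filterlim_iff[THEN iffD1], rule_format] simp: eventually_nhds_metric)
    then show "\<forall>\<^sub>F p in P. dist (quot p) (cmod F') < e"
      unfolding P_def eventually_inf_principal
    proof eventually_elim
      case (elim p)
      obtain u v where p: "p = (u, v)" by (cases p)
      show ?case
      proof (clarsimp simp: p quot_def)
        assume uv: "u \<noteq> v"
        have "\<bar>cmod (F u - F v) - cmod (F' * (u - v))\<bar> \<le> cmod (F u - F v - F' * (u - v))" by (rule norm_triangle_ineq3)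
        also have "\<dots> \<le> (e / 2) * cmod (u - v)" using d(2)[of u v] elim by (simp add: p)
        also have "\<dots> < e * cmod (u - v)" using uv \<open>0 < e\<close> by simp
        finally have "\<bar>cmod (F u - F v) - cmod F' * cmod (u - v)\<bar> / cmod (u - v) < e"
          using uv by (simp add: pos_divide_less_eq norm_mult)
        moreover have "cmod (F u - F v) / cmod (u - v) - cmod F' = (cmod (F u - F v) - cmod F' * cmod (u - v)) / cmod (u - v)"
          using uv by (simp add: diff_divide_distrib)
        ultimately show "dist (cmod (F u - F v) / cmod (u - v)) (cmod F') < e" by (simp add: dist_real_def abs_divide)
      qed
    qed
  qed
  have "coord_deriv g x = F'" using der unfolding coord_deriv_chart_rep by (rule DERIV_imp_deriv)
  then have D: "sph_deriv_norm g x = cmod F' * (chordal_weight u0 * chordal_weight u0 / (chordal_weight (F u0) * chordal_weight (F u0)))"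
    by (simp add: sph_deriv_norm_eq F0[symmetric] chordal_weight_sq flip: u0_def power2_eq_square)
  have "((\<lambda>p. quot p * G p) \<longlongrightarrow> sph_deriv_norm g x) P" unfolding D by (intro tendsto_mult ql Gl)
  then have "\<forall>\<^sub>F p in P. dist (quot p * G p) (sph_deriv_norm g x) < \<epsilon>" using \<epsilon> by (rule tendstoD)
  then have "\<forall>\<^sub>F p in nhds u0 \<times>\<^sub>F nhds u0. fst p \<noteq> snd p \<longrightarrow> \<bar>quot p * G p - sph_deriv_norm g x\<bar> < \<epsilon>"
    unfolding P_def eventually_inf_principal by eventually_elim (auto simp: dist_real_def case_prod_unfold)
  then obtain A B where AB: "eventually A (nhds u0)" "eventually B (nhds u0)"
    "\<And>u v. A u \<Longrightarrow> B v \<Longrightarrow> u \<noteq> v \<Longrightarrow> \<bar>quot (u, v) * G (u, v) - sph_deriv_norm g x\<bar> < \<epsilon>"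
    by (auto simp: eventually_prod_filter)
  have "\<forall>\<^sub>F u in nhds u0. A u \<and> B u \<and> g (param x u) = param (g x) (F u)"
    using AB(1,2) ev by (auto simp: F_def u0_def intro: eventually_conj)
  then obtain e where e: "0 < e" "\<And>u. dist u u0 < e \<Longrightarrow> A u \<and> B u \<and> g (param x u) = param (g x) (F u)"
    by (auto simp: eventually_nhds_metric)
  obtain \<delta> where \<delta>: "0 < \<delta>" "\<And>y. dist (stereo x) (stereo y) < \<delta> \<Longrightarrow> \<exists>u. y = param x u \<and> dist u u0 < e"
    using chart_neighbourhood[OF e(1), of x] unfolding u0_def by blast
  show "\<exists>\<delta>>0. \<forall>y z. dist (stereo x) (stereo y) < \<delta> \<longrightarrow> dist (stereo x) (stereo z) < \<delta> \<longrightarrow>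
     \<bar>dist (stereo (g y)) (stereo (g z)) - sph_deriv_norm g x * dist (stereo y) (stereo z)\<bar> \<le> \<epsilon> * dist (stereo y) (stereo z)"
  proof (intro exI[of _ \<delta>] conjI \<delta>(1) allI impI)
    fix y z assume "dist (stereo x) (stereo y) < \<delta>" "dist (stereo x) (stereo z) < \<delta>"
    then obtain u v where u: "y = param x u" "dist u u0 < e" and v: "z = param x v" "dist v u0 < e"
      using \<delta>(2) by meson
    show "\<bar>dist (stereo (g y)) (stereo (g z)) - sph_deriv_norm g x * dist (stereo y) (stereo z)\<bar> \<le> \<epsilon> * dist (stereo y) (stereo z)"
    proof (cases "u = v")
      case False
      define c where "c = dist (stereo y) (stereo z)"
      have c: "c = 2 * cmod (u - v) / (chordal_weight u * chordal_weight v)" unfolding c_def u v by (rule chord_param)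
      have "dist (stereo (g y)) (stereo (g z)) = 2 * cmod (F u - F v) / (chordal_weight (F u) * chordal_weight (F v))"
        using e(2)[OF u(2)] e(2)[OF v(2)] unfolding u v by (simp add: chord_param del: stereo.simps)
      also have "\<dots> = (quot (u, v) * G (u, v)) * c"
        using False chordal_weight_pos[of u] chordal_weight_pos[of v] by (simp add: quot_def G_def c)
      finally have "dist (stereo (g y)) (stereo (g z)) - sph_deriv_norm g x * c = (quot (u, v) * G (u, v) - sph_deriv_norm g x) * c"
        by (simp add: left_diff_distrib)
      also have "\<bar>\<dots>\<bar> \<le> \<epsilon> * c"
        using AB(3)[of u v] e(2)[OF u(2)] e(2)[OF v(2)] False unfolding abs_mult
        by (intro mult_mono) (auto simp: c_def)
      finally show ?thesis by (simp add: c_def)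
    qed (simp add: u v)
  qed
qed

text \<open>The mean value inequality for the ratio minus its linear part, whose derivative is small near \<open>u0\<close>.\<close>

lemma ratio_strict_derivative:
  fixes N M :: "complex poly"
  assumes M0: "poly M u0 \<noteq> 0" and e: "0 < e"
  defines "F' \<equiv> (poly (pderiv N) u0 * poly M u0 - poly N u0 * poly (pderiv M) u0) / (poly M u0 * poly M u0)"
  shows "\<exists>d>0. \<forall>u v. dist u u0 < d \<longrightarrow> dist v u0 < d \<longrightarrow>
      cmod (poly N u / poly M u - poly N v / poly M v - F' * (u - v)) \<le> e * cmod (u - v)"
    and "((\<lambda>u. poly N u / poly M u) has_field_derivative F') (at u0)"
proof -
  define H where "H u = (poly (pderiv N) u * poly M u - poly N u * poly (pderiv M) u) / (poly M u * poly M u)" for u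
  have der: "((\<lambda>u. poly N u / poly M u) has_field_derivative H u) (at u within S)" if "poly M u \<noteq> 0" for u S
    unfolding H_def using that by (intro DERIV_divide has_field_derivative_at_within[OF poly_DERIV]) auto
  show "((\<lambda>u. poly N u / poly M u) has_field_derivative F') (at u0)"
    using der[OF M0] by (simp add: F'_def H_def)
  have "open {u. poly M u \<noteq> 0}" by (intro open_Collect_neq continuous_intros)
  then have "\<forall>\<^sub>F u in nhds u0. poly M u \<noteq> 0" using M0 by (auto simp: eventually_nhds)
  moreover have "isCont H u0" unfolding H_def using M0 by (intro continuous_intros) auto
  then have "\<forall>\<^sub>F u in nhds u0. dist (H u) (H u0) < e"
    using e by (intro tendstoD[of H "H u0"]) (simp_all add: isCont_def tendsto_nhds_iff)
  ultimately have "\<forall>\<^sub>F u in nhds u0. poly M u \<noteq> 0 \<and> dist (H u) (H u0) < e" by (rule eventually_conj)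
  then obtain d where d: "0 < d" "\<And>u. dist u u0 < d \<Longrightarrow> poly M u \<noteq> 0 \<and> dist (H u) (H u0) < e"
    by (auto simp: eventually_nhds_metric)
  have "cmod (poly N u / poly M u - poly N v / poly M v - F' * (u - v)) \<le> e * cmod (u - v)"
    if u: "dist u u0 < d" and v: "dist v u0 < d" for u v
  proof -
    have "cmod ((poly N u / poly M u - F' * u) - (poly N v / poly M v - F' * v)) \<le> e * cmod (u - v)"
    proof (rule field_differentiable_bound[where S = "ball u0 d" and f' = "\<lambda>w. H w - F'"])
      fix w assume "w \<in> ball u0 d"
      then have w: "poly M w \<noteq> 0" "dist (H w) (H u0) < e" using d(2)[of w] by (auto simp: dist_commute)
      show "((\<lambda>u. poly N u / poly M u - F' * u) has_field_derivative H w - F') (at w within ball u0 d)"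
        by (rule derivative_eq_intros der w refl | simp)+
      show "cmod (H w - F') \<le> e" using w(2) by (simp add: F'_def H_def dist_norm)
    qed (use u v in \<open>auto simp: dist_commute\<close>)
    then show ?thesis by (simp add: algebra_simps)
  qed
  then show "\<exists>d>0. \<forall>u v. dist u u0 < d \<longrightarrow> dist v u0 < d \<longrightarrow>
      cmod (poly N u / poly M u - poly N v / poly M v - F' * (u - v)) \<le> e * cmod (u - v)"
    using d(1) by blast
qed

text \<open>In the chart at infinity the two polynomials are reversed, as polynomials of the common formal degree
  \<open>d\<close>; since \<open>d\<close> is the degree of one of them, they have no common zero at \<open>0\<close>.\<close>

lemma homogeneous_coordinates:
  assumes "rational_map g"
  shows "\<exists>a b. (\<forall>u. g (param x u) = (if poly b u = 0 then Infty else Fin (poly a u / poly b u))) \<and>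
    (poly a (coord x x) \<noteq> 0 \<or> poly b (coord x x) \<noteq> 0)"
proof -
  obtain p q where pq: "q \<noteq> 0" "coprime p q" "g = rat_map p q" using assms by (auto simp: rational_map_def)
  show ?thesis
  proof (cases x)
    case (Fin z)
    have "poly p z \<noteq> 0 \<or> poly q z \<noteq> 0"
      using coprime_poly_0[OF pq(2)] by auto
    then show ?thesis using Fin pq(3)
      by (intro exI[of _ p] exI[of _ q]) (auto simp: rat_map_def param_def coord_def)
  next
    case Infty
    define d where "d = max (degree p) (degree q)"
    define refl where "refl r = monom 1 (d - degree r) * reflect_poly r" for r :: "complex poly"
    have nz: "poly (refl r) u = u ^ d * poly r (inverse u)" if "u \<noteq> 0" "degree r \<le> d" for r u
      using that by (simp add: refl_def poly_monom poly_reflect_poly_nz flip: power_add)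
    have z: "poly (refl r) 0 = coeff r d" if "degree r \<le> d" for r
    proof (cases "degree r = d")
      case True
      then show ?thesis by (simp add: refl_def poly_monom)
    next
      case False
      then show ?thesis using that by (simp add: refl_def poly_monom coeff_eq_0)
    qed
    have le: "degree p \<le> d" "degree q \<le> d" by (auto simp: d_def)
    have "coeff p d \<noteq> 0 \<or> coeff q d \<noteq> 0"
    proof (cases "degree q = d")
      case True
      then show ?thesis using pq(1) by auto
    next
      case False
      then have "degree p = d" "p \<noteq> 0" by (auto simp: d_def max_def split: if_splits)
      then show ?thesis by auto
    qed
    moreover have "g (param x u) = (if poly (refl q) u = 0 then Infty else Fin (poly (refl p) u / poly (refl q) u))" for u
      using le nz z by (cases "u = 0") (auto simp: Infty pq(3) rat_map_def param_def Let_def d_def[symmetric])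
    ultimately show ?thesis using z le by (intro exI[of _ "refl p"] exI[of _ "refl q"]) (auto simp: Infty coord_def)
  qed
qed

text \<open>Of two homogeneous coordinates at least one is non-zero, and the chart of the image divides by it.\<close>

lemma rational_chart_rep:
  assumes "rational_map g"
  shows "\<exists>N M. poly M (coord x x) \<noteq> 0 \<and>
    (\<forall>\<^sub>F u in nhds (coord x x). chart_rep g x u = poly N u / poly M u \<and> g (param x u) = param (g x) (chart_rep g x u))"
proof -
  define u0 where "u0 = coord x x"
  obtain a b where ab: "\<And>u. g (param x u) = (if poly b u = 0 then Infty else Fin (poly a u / poly b u))"
    "poly a u0 \<noteq> 0 \<or> poly b u0 \<noteq> 0"
    using homogeneous_coordinates[OF assms, of x] unfolding u0_def by blast
  have gx: "g x = (if poly b u0 = 0 then Infty else Fin (poly a u0 / poly b u0))"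
    using ab(1)[of u0] by (simp add: u0_def)
  have ev: "\<forall>\<^sub>F u in nhds u0. poly c u \<noteq> 0" if "poly c u0 \<noteq> 0" for c
  proof -
    have "open {u. poly c u \<noteq> 0}" by (intro open_Collect_neq continuous_intros)
    then show ?thesis using that by (auto simp: eventually_nhds)
  qed
  show ?thesis
  proof (cases "poly b u0 = 0")
    case False
    have "\<forall>\<^sub>F u in nhds u0. chart_rep g x u = poly a u / poly b u \<and> g (param x u) = param (g x) (chart_rep g x u)"
      using ev[OF False]
      by eventually_elim (use False in \<open>auto simp: chart_rep_def ab(1) gx chart_simps\<close>)
    then show ?thesis using False unfolding u0_def by blast
  next
    case True
    then have a0: "poly a u0 \<noteq> 0" using ab(2) by simp
    have "\<forall>\<^sub>F u in nhds u0. chart_rep g x u = poly b u / poly a u \<and> g (param x u) = param (g x) (chart_rep g x u)"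
      using ev[OF a0]
      by eventually_elim (use True in \<open>auto simp: chart_rep_def ab(1) gx chart_simps\<close>)
    then show ?thesis using a0 unfolding u0_def by blast
  qed
qed

lemma rational_chart_diff:
  assumes "rational_map g"
  shows "chart_diff g x" and "strict_conformal_at g x"
proof -
  define u0 where "u0 = coord x x"
  obtain N M where NM: "poly M u0 \<noteq> 0"
    "\<forall>\<^sub>F u in nhds u0. chart_rep g x u = poly N u / poly M u \<and> g (param x u) = param (g x) (chart_rep g x u)"
    using rational_chart_rep[OF assms, of x] unfolding u0_def by blast
  define F' where "F' = (poly (pderiv N) u0 * poly M u0 - poly N u0 * poly (pderiv M) u0) / (poly M u0 * poly M u0)"
  have ev: "\<forall>\<^sub>F u in nhds u0. chart_rep g x u = poly N u / poly M u"
    "\<forall>\<^sub>F u in nhds u0. g (param x u) = param (g x) (chart_rep g x u)"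
    using NM(2) by (auto elim: eventually_mono)
  have "((\<lambda>u. poly N u / poly M u) has_field_derivative F') (at u0)"
    unfolding F'_def by (rule ratio_strict_derivative(2)[OF NM(1) zero_less_one])
  then have der: "(chart_rep g x has_field_derivative F') (at u0)"
    using DERIV_cong_ev[OF refl ev(1) refl] by blast
  then show "chart_diff g x" using ev(2) by (auto simp: chart_diff_def field_differentiable_def u0_def)
  show "strict_conformal_at g x"
  proof (rule strict_conformal_if_strict_derivative[OF ev(2)[unfolded u0_def] der[unfolded u0_def]])
    fix e :: real assume "0 < e"
    then obtain d where d: "0 < d" "\<And>u v. dist u u0 < d \<Longrightarrow> dist v u0 < d \<Longrightarrow>
      cmod (poly N u / poly M u - poly N v / poly M v - F' * (u - v)) \<le> e * cmod (u - v)"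
      using ratio_strict_derivative(1)[OF NM(1), of e N] unfolding F'_def by blast
    obtain d' where d': "0 < d'" "\<And>u. dist u u0 < d' \<Longrightarrow> chart_rep g x u = poly N u / poly M u"
      using ev(1) by (auto simp: eventually_nhds_metric)
    show "\<exists>d>0. \<forall>u v. dist u (coord x x) < d \<longrightarrow> dist v (coord x x) < d \<longrightarrow>
      cmod (chart_rep g x u - chart_rep g x v - F' * (u - v)) \<le> e * cmod (u - v)"
      using d d' by (intro exI[of _ "min d d'"]) (auto simp: u0_def)
  qed
qed

lemma nearby_point:
  assumes "0 < \<delta>"
  shows "\<exists>z. z \<noteq> y \<and> dist (stereo y) (stereo z) < \<delta>"
proof -
  define u where "u = coord y y"
  define t where "t = complex_of_real (\<delta> / 4)"
  define z where "z = param y (u + t)"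
  have t: "t \<noteq> 0" "cmod t = \<delta> / 4" using assms by (auto simp: t_def)
  have "coord y z \<noteq> coord y y" using t by (simp add: z_def u_def)
  then have "z \<noteq> y" by auto
  moreover have "1 \<le> chordal_weight u * chordal_weight (u + t)"
    using mult_mono[OF chordal_weight_ge_1[of u] chordal_weight_ge_1[of "u + t"]] chordal_weight_ge_1[of u] by simp
  then have "2 * cmod t / (chordal_weight u * chordal_weight (u + t)) \<le> 2 * cmod t / 1"
    by (intro divide_left_mono) auto
  then have "dist (stereo y) (stereo z) < \<delta>"
    using chord_param[of y u "u + t"] t assms by (simp add: z_def u_def)
  ultimately show ?thesis by blast
qed

text \<open>At a point \<open>y\<close> near \<open>x\<close> the chords from \<open>y\<close> are multiplied by almost the factor at \<open>y\<close> and by almost the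
  factor at \<open>x\<close>; as \<open>y\<close> is not isolated, the two factors are close.\<close>

lemma strict_conformal_continuous:
  assumes g: "\<And>x. strict_conformal_at g x"
  shows "continuous_on UNIV (sph_deriv_norm g)" and "continuous_on UNIV g"
proof -
  show "continuous_on UNIV (sph_deriv_norm g)"
    unfolding continuous_on_iff
  proof (intro ballI allI impI)
    fix x and \<epsilon> :: real assume \<epsilon>: "0 < \<epsilon>"
    define e where "e = \<epsilon> / 3"
    have e: "0 < e" using \<epsilon> by (simp add: e_def)
    obtain \<delta> where \<delta>: "0 < \<delta>" "\<And>y z. dist (stereo x) (stereo y) < \<delta> \<Longrightarrow> dist (stereo x) (stereo z) < \<delta> \<Longrightarrow>
     \<bar>dist (stereo (g y)) (stereo (g z)) - sph_deriv_norm g x * dist (stereo y) (stereo z)\<bar> \<le> e * dist (stereo y) (stereo z)"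
      using g[of x] e unfolding strict_conformal_at_def by blast
    have "dist (sph_deriv_norm g y) (sph_deriv_norm g x) < \<epsilon>" if "dist y x < \<delta>" for y
    proof -
      have cy: "dist (stereo x) (stereo y) < \<delta>"
        using chord_le_dist[of x y] that by (simp add: dist_commute)
      obtain \<eta> where \<eta>: "0 < \<eta>" "\<And>w z. dist (stereo y) (stereo w) < \<eta> \<Longrightarrow> dist (stereo y) (stereo z) < \<eta> \<Longrightarrow>
       \<bar>dist (stereo (g w)) (stereo (g z)) - sph_deriv_norm g y * dist (stereo w) (stereo z)\<bar> \<le> e * dist (stereo w) (stereo z)"
        using g[of y] e unfolding strict_conformal_at_def by blast
      obtain z where z: "z \<noteq> y" "dist (stereo y) (stereo z) < min \<eta> (\<delta> - dist (stereo x) (stereo y))"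
        using nearby_point[of "min \<eta> (\<delta> - dist (stereo x) (stereo y))" y] \<eta> cy by auto
      have cz: "dist (stereo x) (stereo z) < \<delta>"
        using dist_triangle[of "stereo x" "stereo z" "stereo y"] z(2) by linarith
      define c where "c = dist (stereo y) (stereo z)"
      have c: "0 < c" using chord_pos[of y z] z(1) by (auto simp: c_def)
      define G where "G = dist (stereo (g y)) (stereo (g z))"
      have "\<bar>G - sph_deriv_norm g x * c\<bar> \<le> e * c" using \<delta>(2)[OF cy cz] by (simp add: c_def G_def)
      moreover have "\<bar>G - sph_deriv_norm g y * c\<bar> \<le> e * c" using \<eta>(2)[of y z] \<eta>(1) z(2) by (simp add: c_def G_def)
      ultimately have "\<bar>sph_deriv_norm g y * c - sph_deriv_norm g x * c\<bar> \<le> e * c + e * c" by linarith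
      then have "\<bar>sph_deriv_norm g y - sph_deriv_norm g x\<bar> * c \<le> (2 * e) * c"
        using c by (simp add: abs_mult flip: left_diff_distrib)
      then have "\<bar>sph_deriv_norm g y - sph_deriv_norm g x\<bar> \<le> 2 * e" using c by simp
      then show ?thesis using \<epsilon> by (simp add: dist_real_def e_def)
    qed
    then show "\<exists>d>0. \<forall>y\<in>UNIV. dist y x < d \<longrightarrow> dist (sph_deriv_norm g y) (sph_deriv_norm g x) < \<epsilon>" using \<delta>(1) by blast
  qed
  show "continuous_on UNIV g"
    unfolding continuous_on_iff
  proof (intro ballI allI impI)
    fix x and \<epsilon> :: real assume \<epsilon>: "0 < \<epsilon>"
    obtain \<eta> where \<eta>: "0 < \<eta>" "\<And>y z. dist (stereo y) (stereo z) < \<eta> \<Longrightarrow> dist y z < \<epsilon>"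
      using dist_small_if_chord_small[OF \<epsilon>] by blast
    obtain \<delta> where \<delta>: "0 < \<delta>" "\<And>y z. dist (stereo x) (stereo y) < \<delta> \<Longrightarrow> dist (stereo x) (stereo z) < \<delta> \<Longrightarrow>
     \<bar>dist (stereo (g y)) (stereo (g z)) - sph_deriv_norm g x * dist (stereo y) (stereo z)\<bar> \<le> 1 * dist (stereo y) (stereo z)"
      using g[of x] zero_less_one unfolding strict_conformal_at_def by blast
    define B where "B = \<bar>sph_deriv_norm g x\<bar> + 1"
    have B: "0 < B" by (simp add: B_def add_nonneg_pos)
    have "dist (g y) (g x) < \<epsilon>" if y: "dist y x < min \<delta> (\<eta> / B)" for y
    proof (rule \<eta>(2))
      let ?c = "dist (stereo y) (stereo x)"
      have c: "?c < \<delta>" "?c < \<eta> / B" using chord_le_dist[of y x] y by auto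
      have "\<bar>dist (stereo (g y)) (stereo (g x)) - sph_deriv_norm g x * ?c\<bar> \<le> ?c"
        using \<delta>(2)[of y x] c \<delta>(1) by (simp add: dist_commute)
      moreover have "sph_deriv_norm g x * ?c \<le> \<bar>sph_deriv_norm g x\<bar> * ?c" by (intro mult_right_mono) auto
      ultimately have "dist (stereo (g y)) (stereo (g x)) \<le> B * ?c" by (simp add: B_def distrib_right)
      also have "\<dots> < \<eta>" using c(2) B by (simp add: pos_less_divide_eq mult.commute)
      finally show "dist (stereo (g y)) (stereo (g x)) < \<eta>" .
    qed
    then show "\<exists>d>0. \<forall>y\<in>UNIV. dist y x < d \<longrightarrow> dist (g y) (g x) < \<epsilon>" using \<delta>(1) \<eta>(1) B
      by (intro exI[of _ "min \<delta> (\<eta> / B)"]) auto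
  qed
qed

text \<open>Compactness. In a sequence of violations the two points converge, and either they or their images
  become close; by injectivity of the map on \<open>K\<close> the limits agree in both cases. The strict derivative
  at the common limit then excludes the violations.\<close>

lemma uniform_distortion:
  assumes g: "\<And>x. strict_conformal_at g x" and K: "compact K" and inj: "inj_on g K"
    and S: "S \<subseteq> K" and d0: "0 < d0" "\<And>z. z \<in> S \<Longrightarrow> d0 \<le> sph_deriv_norm g z" and \<epsilon>: "0 < \<epsilon>"
  shows "\<exists>\<delta>>0. near_similarity \<epsilon> \<delta> stereo g (sph_deriv_norm g) S"
proof (rule ccontr)
  define D where "D = sph_deriv_norm g"
  define c where "c y z = dist (stereo y) (stereo z)" for y z
  define ok where "ok z w \<longleftrightarrow> exp (- \<epsilon>) * D z * c z w \<le> c (g z) (g w) \<and> c (g z) (g w) \<le> exp \<epsilon> * D z * c z w" for z w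
  assume "\<not> ?thesis"
  then have "\<forall>\<delta>>0. \<exists>z\<in>S. \<exists>w\<in>S. (c z w < \<delta> \<or> c (g z) (g w) < \<delta>) \<and> \<not> ok z w"
    unfolding near_similarity_def ok_def D_def c_def by blast
  then have "\<forall>n::nat. \<exists>z w. z \<in> S \<and> w \<in> S \<and> (c z w < 1 / Suc n \<or> c (g z) (g w) < 1 / Suc n) \<and> \<not> ok z w"
    by (metis of_nat_0_less_iff zero_less_Suc zero_less_divide_1_iff)
  then obtain Z W where ZW: "\<And>n::nat. Z n \<in> S" "\<And>n. W n \<in> S"
    "\<And>n. c (Z n) (W n) < 1 / Suc n \<or> c (g (Z n)) (g (W n)) < 1 / Suc n" "\<And>n. \<not> ok (Z n) (W n)"
    by metis
  have ZK: "\<forall>n. Z n \<in> K" "\<forall>n. W n \<in> K" using ZW S by auto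
  obtain z r1 where z: "z \<in> K" "strict_mono r1" "(Z \<circ> r1) \<longlonglongrightarrow> z"
    using compact_imp_seq_compact[OF K] ZK(1) unfolding seq_compact_def by blast
  have "\<forall>n. (W \<circ> r1) n \<in> K" using ZK by simp
  then obtain w r2 where w: "w \<in> K" "strict_mono r2" "(W \<circ> r1 \<circ> r2) \<longlonglongrightarrow> w"
    using compact_imp_seq_compact[OF K] unfolding seq_compact_def by blast
  define r where "r = r1 \<circ> r2"
  have r: "strict_mono r" unfolding r_def using z(2) w(2) by (rule strict_mono_o)
  have Zl: "(\<lambda>n. Z (r n)) \<longlonglongrightarrow> z" using LIMSEQ_subseq_LIMSEQ[OF z(3) w(2)] by (simp add: r_def o_def)
  have Wl: "(\<lambda>n. W (r n)) \<longlonglongrightarrow> w" using w(3) by (simp add: r_def o_def)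
  have isC: "isCont stereo x" "isCont g x" "isCont D x" for x
    using continuous_stereo[of UNIV] strict_conformal_continuous[of g] g
    by (auto simp: continuous_on_eq_continuous_at D_def)
  have gl: "(\<lambda>n. g (Z (r n))) \<longlonglongrightarrow> g z" "(\<lambda>n. g (W (r n))) \<longlonglongrightarrow> g w"
    using isCont_tendsto_compose[OF isC(2)] Zl Wl by auto
  have cl: "(\<lambda>n. c (Z (r n)) (W (r n))) \<longlonglongrightarrow> c z w" "(\<lambda>n. c (g (Z (r n))) (g (W (r n)))) \<longlonglongrightarrow> c (g z) (g w)"
    unfolding c_def by (intro tendsto_dist isCont_tendsto_compose[OF isC(1)] Zl Wl gl)+
  have "min (c z w) (c (g z) (g w)) \<le> 0"
  proof (rule LIMSEQ_le[OF tendsto_min[OF cl]])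
    show "(\<lambda>n. 1 / real (Suc (r n))) \<longlonglongrightarrow> 0"
      using LIMSEQ_subseq_LIMSEQ[OF LIMSEQ_inverse_real_of_nat r] by (simp add: o_def inverse_eq_divide)
    show "\<exists>N. \<forall>n\<ge>N. min (c (Z (r n)) (W (r n))) (c (g (Z (r n))) (g (W (r n)))) \<le> 1 / real (Suc (r n))"
      using ZW(3) by (meson less_imp_le min_le_iff_disj)
  qed
  then have "z = w \<or> g z = g w" by (auto simp: c_def min_le_iff_disj stereo_inject)
  then have zw: "w = z" using inj z(1) w(1) by (auto dest: inj_onD)
  have Dl: "(\<lambda>n. D (Z (r n))) \<longlonglongrightarrow> D z" by (rule isCont_tendsto_compose[OF isC(3) Zl])
  have "d0 \<le> D z" by (rule LIMSEQ_le_const[OF Dl]) (use d0 ZW in \<open>auto simp: D_def\<close>)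
  then have Dz: "0 < D z" using d0 by simp
  define e where "e = min ((1 - exp (- \<epsilon>)) * D z / 2) ((exp \<epsilon> - 1) * D z / 2)"
  have e1: "0 < 1 - exp (- \<epsilon>)" "0 < exp \<epsilon> - 1" using \<epsilon> by auto
  have e: "0 < e" using e1 Dz by (simp add: e_def)
  have e2: "exp (- \<epsilon>) * D z < D z - e" "D z + e < exp \<epsilon> * D z"
  proof -
    have "e < (1 - exp (- \<epsilon>)) * D z" "e < (exp \<epsilon> - 1) * D z"
      using mult_pos_pos[OF e1(1) Dz] mult_pos_pos[OF e1(2) Dz] by (auto simp: e_def)
    then show "exp (- \<epsilon>) * D z < D z - e" "D z + e < exp \<epsilon> * D z" by (auto simp: left_diff_distrib)
  qed
  obtain \<delta> where \<delta>: "0 < \<delta>" "\<And>y w. c z y < \<delta> \<Longrightarrow> c z w < \<delta> \<Longrightarrow> \<bar>c (g y) (g w) - D z * c y w\<bar> \<le> e * c y w"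
    using g[of z] e unfolding strict_conformal_at_def c_def D_def by blast
  have "(\<lambda>n. c z (Z (r n))) \<longlonglongrightarrow> c z z" "(\<lambda>n. c z (W (r n))) \<longlonglongrightarrow> c z w"
    unfolding c_def by (intro tendsto_dist tendsto_const isCont_tendsto_compose[OF isC(1)] Zl Wl)+
  then have "\<forall>\<^sub>F n in sequentially. c z (Z (r n)) < \<delta>" "\<forall>\<^sub>F n in sequentially. c z (W (r n)) < \<delta>"
    using \<delta>(1) zw by (auto intro!: order_tendstoD(2) simp: c_def)
  moreover have l1: "(\<lambda>n. exp (- \<epsilon>) * D (Z (r n))) \<longlonglongrightarrow> exp (- \<epsilon>) * D z" and l2: "(\<lambda>n. exp \<epsilon> * D (Z (r n))) \<longlonglongrightarrow> exp \<epsilon> * D z"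
    by (intro tendsto_intros Dl)+
  have "\<forall>\<^sub>F n in sequentially. exp (- \<epsilon>) * D (Z (r n)) < D z - e" "\<forall>\<^sub>F n in sequentially. D z + e < exp \<epsilon> * D (Z (r n))"
    using order_tendstoD(2)[OF l1 e2(1)] order_tendstoD(1)[OF l2 e2(2)] .
  ultimately have "\<forall>\<^sub>F n in sequentially. ok (Z (r n)) (W (r n))"
  proof eventually_elim
    case (elim n)
    define d where "d = c (Z (r n)) (W (r n))"
    have d: "0 \<le> d" by (simp add: d_def c_def)
    have "\<bar>c (g (Z (r n))) (g (W (r n))) - D z * d\<bar> \<le> e * d" using \<delta>(2) elim by (simp add: d_def)
    then have "(D z - e) * d \<le> c (g (Z (r n))) (g (W (r n)))" "c (g (Z (r n))) (g (W (r n))) \<le> (D z + e) * d"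
      by (auto simp: left_diff_distrib distrib_right)
    moreover have "exp (- \<epsilon>) * D (Z (r n)) * d \<le> (D z - e) * d" "(D z + e) * d \<le> exp \<epsilon> * D (Z (r n)) * d"
      using elim d by (intro mult_right_mono; simp)+
    ultimately show ?case by (simp add: ok_def d_def)
  qed
  then show False using ZW(4) by (auto simp: eventually_sequentially)
qed

section \<open>Projections of measures invariant under the skew product\<close>

lemma tendsto_log_chord:
  assumes "((\<lambda>\<rho>. ln (g \<rho>) / ln \<rho>) \<longlongrightarrow> d) (at_right 0)"
  shows "((\<lambda>r. ln (g (2 * sin (r / 2))) / ln r) \<longlongrightarrow> (d :: real)) (at_right 0)"
proof -
  have l: "filterlim (\<lambda>r::real. 2 * sin (r / 2)) (at_right 0) (at_right 0)" by real_asymp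
  have "((\<lambda>r::real. ln (2 * sin (r / 2)) / ln r) \<longlongrightarrow> 1) (at_right 0)" by real_asymp
  with filterlim_compose[OF assms l]
  have "((\<lambda>r. (ln (g (2 * sin (r / 2))) / ln (2 * sin (r / 2))) * (ln (2 * sin (r / 2)) / ln r)) \<longlongrightarrow> d * 1) (at_right 0)"
    by (rule tendsto_mult)
  moreover have "\<forall>\<^sub>F r in at_right 0. (ln (g (2 * sin (r / 2))) / ln (2 * sin (r / 2))) * (ln (2 * sin (r / 2)) / ln r)
      = ln (g (2 * sin (r / 2))) / ln r"
  proof -
    have "\<forall>\<^sub>F \<rho>::real in at_right 0. 0 < \<rho> \<and> \<rho> < 1"
      unfolding eventually_at_right_field by (intro exI[of _ 1]) auto
    from eventually_compose_filterlim[OF this l] show ?thesis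
    proof eventually_elim
      case (elim r)
      then have "ln (2 * sin (r / 2)) \<noteq> 0" by simp
      then show ?case by simp
    qed
  qed
  ultimately show ?thesis by (auto intro: Lim_transform_eventually)
qed

text \<open>A property of almost every point of the source descends to the image measure only for measurable
  properties. As the mass of a ball is left continuous in the radius, rational radii decide the
  limit.\<close>

lemma (in euclidean_factor) local_dimension_set_measurable:
  "{x \<in> space M. ((\<lambda>r. ln (prob (factor_ball M s x r)) / ln r) \<longlongrightarrow> d) (at_right 0)} \<in> sets M"
proof -
  define \<phi> where "\<phi> r x = ln (prob (factor_ball M s x r)) / ln r" for r x
  have eq: "prob (factor_ball M s x r) = prob (space M \<inter> factor_ball M s x r)" for x r
    by (rule arg_cong[of _ _ prob]) (auto simp: factor_ball_def)
  have [measurable]: "\<phi> r \<in> borel_measurable M" for r unfolding \<phi>_def eq by measurable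
  have left: "((\<lambda>t. \<phi> t x) \<longlongrightarrow> \<phi> r x) (at_left r)" if r: "0 < r" "r < 1" for r x
  proof (cases "prob (factor_ball M s x r) = 0")
    case True
    have "\<phi> t x = \<phi> r x" if "t < r" for t
    proof -
      have "prob (factor_ball M s x t) \<le> prob (factor_ball M s x r)" using that by (intro finite_measure_mono) (auto simp: factor_ball_def)
      then show ?thesis using True measure_nonneg[of M "factor_ball M s x t"] by (simp add: \<phi>_def)
    qed
    then show ?thesis by (intro tendsto_eventually) (auto simp: eventually_at_filter)
  next
    case False
    have "((\<lambda>t. prob (factor_ball M s x t)) \<longlongrightarrow> prob (factor_ball M s x r)) (at_left r)"
      unfolding eq by (rule prob_factor_ball_left_continuous) simp
    then show ?thesis unfolding \<phi>_def using False r by (intro tendsto_intros) auto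
  qed
  have "((\<lambda>r. \<phi> r x) \<longlongrightarrow> d) (at_right 0) \<longleftrightarrow>
    (\<forall>j::nat. \<exists>k::nat. \<forall>q::rat. 0 < real_of_rat q \<and> real_of_rat q < 1 / (real k + 2) \<longrightarrow> \<bar>\<phi> (real_of_rat q) x - d\<bar> \<le> 1 / (real j + 1))"
    (is "?L \<longleftrightarrow> ?R") for x
  proof
    assume ?L
    show ?R
    proof
      fix j :: nat
      have "\<forall>\<^sub>F r in at_right 0. dist (\<phi> r x) d < 1 / (real j + 1)" by (rule tendstoD[OF \<open>?L\<close>]) simp
      then obtain b where b: "b > 0" "\<And>t. 0 < t \<Longrightarrow> t < b \<Longrightarrow> dist (\<phi> t x) d < 1 / (real j + 1)"
        by (auto simp: eventually_at_right_field)
      obtain k :: nat where "inverse (real (Suc k)) < b" using reals_Archimedean[OF b(1)] by blast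
      moreover have "1 / (real k + 2) \<le> inverse (real (Suc k))" by (simp add: field_simps)
      ultimately have "1 / (real k + 2) \<le> b" by linarith
      then show "\<exists>k::nat. \<forall>q::rat. 0 < real_of_rat q \<and> real_of_rat q < 1 / (real k + 2) \<longrightarrow> \<bar>\<phi> (real_of_rat q) x - d\<bar> \<le> 1 / (real j + 1)"
      proof (intro exI[of _ k] allI impI)
        fix q :: rat assume "0 < real_of_rat q \<and> real_of_rat q < 1 / (real k + 2)"
        then have "dist (\<phi> (real_of_rat q) x) d < 1 / (real j + 1)" using \<open>1 / (real k + 2) \<le> b\<close> by (intro b(2)) auto
        then show "\<bar>\<phi> (real_of_rat q) x - d\<bar> \<le> 1 / (real j + 1)" by (simp add: dist_real_def)
      qed
    qed
  next
    assume R: ?R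
    show ?L
    proof (rule tendstoI)
      fix e :: real assume "0 < e"
      then obtain j :: nat where "inverse (real (Suc j)) < e" using reals_Archimedean by blast
      then have j: "1 / (real j + 1) < e" by (simp add: inverse_eq_divide add.commute)
      obtain k :: nat where k: "\<And>q::rat. 0 < real_of_rat q \<Longrightarrow> real_of_rat q < 1 / (real k + 2) \<Longrightarrow> \<bar>\<phi> (real_of_rat q) x - d\<bar> \<le> 1 / (real j + 1)"
        using R by blast
      have "\<bar>\<phi> r x - d\<bar> \<le> 1 / (real j + 1)" if r: "0 < r" "r < 1 / (real k + 2)" for r
      proof (rule ccontr)
        assume *: "\<not> ?thesis"
        have "1 / (real k + 2) \<le> 1" by simp
        then have "r < 1" using r by linarith
        then have "((\<lambda>t. \<bar>\<phi> t x - d\<bar>) \<longlongrightarrow> \<bar>\<phi> r x - d\<bar>) (at_left r)" using r by (intro tendsto_intros left) auto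
        then have "\<forall>\<^sub>F t in at_left r. 1 / (real j + 1) < \<bar>\<phi> t x - d\<bar>" using * by (intro order_tendstoD(1)) auto
        then obtain b where b: "b < r" "\<And>t. b < t \<Longrightarrow> t < r \<Longrightarrow> 1 / (real j + 1) < \<bar>\<phi> t x - d\<bar>"
          by (auto simp: eventually_at_left_field)
        obtain q where "max b 0 < real_of_rat q" "real_of_rat q < r" using of_rat_dense[of "max b 0" r] b r by auto
        then show False using b(2)[of "real_of_rat q"] k[of q] r by simp
      qed
      then have "dist (\<phi> r x) d < e" if "0 < r" "r < 1 / (real k + 2)" for r
        unfolding dist_real_def using that j by (meson le_less_trans)
      then show "\<forall>\<^sub>F r in at_right 0. dist (\<phi> r x) d < e"
        unfolding eventually_at_right_field by (intro exI[of _ "1 / (real k + 2)"]) auto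
    qed
  qed
  then have "{x \<in> space M. ((\<lambda>r. ln (prob (factor_ball M s x r)) / ln r) \<longlongrightarrow> d) (at_right 0)} =
    {x \<in> space M. \<forall>j::nat. \<exists>k::nat. \<forall>q::rat. 0 < real_of_rat q \<and> real_of_rat q < 1 / (real k + 2) \<longrightarrow> \<bar>\<phi> (real_of_rat q) x - d\<bar> \<le> 1 / (real j + 1)}"
    by (simp add: \<phi>_def)
  also have "\<dots> \<in> sets M" by measurable
  finally show ?thesis .
qed

lemma shift_in_Sigma: "\<omega> \<in> Sigma_shift m \<Longrightarrow> shift \<omega> \<in> Sigma_shift m"
  by (simp add: Sigma_shift_def shift_def)

lemma fibre_iter_shift: "fibre_iter f \<omega> (Suc n) = fibre_iter f (shift \<omega>) n \<circ> f (\<omega> 1)"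
proof (induction n)
  case (Suc n)
  have "fibre_iter f \<omega> (Suc (Suc n)) = f (\<omega> (int (Suc (Suc n)))) \<circ> (fibre_iter f (shift \<omega>) n \<circ> f (\<omega> 1))"
    by (simp only: fibre_iter.simps(2)[of f \<omega> "Suc n"] Suc)
  also have "\<dots> = fibre_iter f (shift \<omega>) (Suc n) \<circ> f (\<omega> 1)" by (simp add: shift_def o_assoc add.commute)
  finally show ?case .
qed simp

lemma skew_funpow: "(skew f ^^ n) (\<omega>, z) = ((shift ^^ n) \<omega>, fibre_iter f \<omega> n z)"
  and shift_funpow: "(shift ^^ n) \<omega> k = \<omega> (k + int n)"
proof -
  show sh: "(shift ^^ n) \<omega> k = \<omega> (k + int n)" for n k
    by (induction n arbitrary: k) (auto simp: shift_def add_ac)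
  show "(skew f ^^ n) (\<omega>, z) = ((shift ^^ n) \<omega>, fibre_iter f \<omega> n z)"
  proof (induction n)
    case (Suc n)
    have "skew f (\<omega>, z) = (shift \<omega>, f (\<omega> 1) z)" for \<omega> z by (simp add: skew_def)
    then show ?case using Suc by (simp add: sh[where n = n and k = 1] add.commute)
  qed simp
qed

lemma skew_deriv_norm_1: "skew_deriv_norm f 1 (\<omega>, z) = sph_deriv_norm (f (\<omega> 1)) z"
  by (simp add: skew_deriv_norm_def)

lemma chart_id: "chart_diff id x" "sph_deriv_norm id x = 1"
proof -
  have id: "chart_rep id x = (\<lambda>u. u)" by (auto simp: chart_rep_def)
  show "chart_diff id x" by (simp add: chart_diff_def id)
  have "1 + (cmod (coord x x))\<^sup>2 \<noteq> 0" using one_plus_norm_sq_pos[of "coord x x"] by simp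
  then show "sph_deriv_norm id x = 1" by (simp add: sph_deriv_norm_eq coord_deriv_chart_rep id)
qed

lemma skew_deriv_norm_prod:
  assumes rat: "\<And>j. j \<in> {1..m} \<Longrightarrow> rational_map (f j)" and \<omega>: "\<omega> \<in> Sigma_shift m"
  shows "skew_deriv_norm f n (\<omega>, z) = (\<Prod>k<n. skew_deriv_norm f 1 ((skew f ^^ k) (\<omega>, z)))"
proof -
  have "chart_diff (fibre_iter f \<omega> n) z \<and>
    sph_deriv_norm (fibre_iter f \<omega> n) z = (\<Prod>k<n. skew_deriv_norm f 1 ((skew f ^^ k) (\<omega>, z)))"
  proof (induction n)
    case (Suc n)
    have r: "rational_map (f (\<omega> (int (Suc n))))" using rat \<omega> by (simp add: Sigma_shift_def)
    have "skew_deriv_norm f 1 ((skew f ^^ n) (\<omega>, z)) = sph_deriv_norm (f (\<omega> (int (Suc n)))) (fibre_iter f \<omega> n z)"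
      unfolding skew_funpow skew_deriv_norm_1 by (simp add: shift_funpow)
    then show ?case
      using chart_diff_comp[OF _ rational_chart_diff(1)[OF r], of "fibre_iter f \<omega> n" z] Suc
      by (simp only: fibre_iter.simps prod.lessThan_Suc) simp
  next
    case 0
    show ?case using chart_id[of z] by (simp only: fibre_iter.simps lessThan_0 prod.empty simp_thms)
  qed
  moreover have "skew_deriv_norm f n (\<omega>, z) = sph_deriv_norm (fibre_iter f \<omega> n) z" by (simp add: skew_deriv_norm_def)
  ultimately show ?thesis by (simp only:)
qed

text \<open>Normality of the shifted fibre maps near the image gives normality of the fibre maps near the point:
  a sequence of fibre maps either contains the first branch infinitely often, and then has a constant
  subsequence, or has a subsequence that factors through that branch.\<close>

lemma fibre_Julia_forward:
  assumes cont: "continuous_on UNIV (f (\<omega> 1))" and z: "z \<in> fibre_Julia f \<omega>"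
  shows "f (\<omega> 1) z \<in> fibre_Julia f (shift \<omega>)"
proof (rule ccontr)
  let ?g = "f (\<omega> 1)"
  assume "?g z \<notin> fibre_Julia f (shift \<omega>)"
  then obtain U where U: "open U" "?g z \<in> U" and nU: "normal_on {fibre_iter f (shift \<omega>) n | n. n \<ge> 1} U"
    by (auto simp: fibre_Julia_def Julia_def)
  have "normal_on {fibre_iter f \<omega> n | n. n \<ge> 1} (?g -` U)"
    unfolding normal_on_def
  proof (intro allI impI)
    fix h :: "nat \<Rightarrow> rsphere \<Rightarrow> rsphere"
    assume h: "range h \<subseteq> {fibre_iter f \<omega> n | n. n \<ge> 1}"
    have "\<forall>k. \<exists>n. h k = fibre_iter f \<omega> (Suc n)"
    proof
      fix k
      have "h k \<in> {fibre_iter f \<omega> n | n. n \<ge> 1}" using h by blast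
      then obtain n where n: "h k = fibre_iter f \<omega> n" "n \<ge> 1" by blast
      then have "h k = fibre_iter f \<omega> (Suc (n - 1))" by simp
      then show "\<exists>n. h k = fibre_iter f \<omega> (Suc n)" ..
    qed
    then obtain N where N: "\<And>k. h k = fibre_iter f \<omega> (Suc (N k))" by metis
    show "\<exists>r h'. strict_mono r \<and> (\<forall>K. compact K \<and> K \<subseteq> ?g -` U \<longrightarrow> uniform_limit K (h \<circ> r) h' sequentially)"
    proof (cases "infinite {k. N k = 0}")
      case True
      then obtain r :: "nat \<Rightarrow> nat" where r: "strict_mono r" "\<And>n. r n \<in> {k. N k = 0}"
        using infinite_enumerate by blast
      have "h \<circ> r = (\<lambda>_. ?g)" using r(2) by (auto simp: N)
      then have "uniform_limit K (h \<circ> r) ?g sequentially" for K by (simp add: uniform_limit_const)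
      then show ?thesis using r(1) by blast
    next
      case False
      then have "infinite (UNIV - {k. N k = 0})" by (intro Diff_infinite_finite) auto
      then obtain r :: "nat \<Rightarrow> nat" where r: "strict_mono r" "\<And>n. r n \<in> UNIV - {k. N k = 0}"
        using infinite_enumerate by blast
      define h2 where "h2 n = fibre_iter f (shift \<omega>) (N (r n))" for n
      have "range h2 \<subseteq> {fibre_iter f (shift \<omega>) n | n. n \<ge> 1}"
      proof
        fix g assume "g \<in> range h2"
        then obtain n where "g = fibre_iter f (shift \<omega>) (N (r n))" by (auto simp: h2_def)
        moreover have "1 \<le> N (r n)" using r(2)[of n] by simp
        ultimately show "g \<in> {fibre_iter f (shift \<omega>) n | n. n \<ge> 1}" by blast
      qed
      then obtain r2 h' where r2: "strict_mono r2"
        "\<And>K. compact K \<Longrightarrow> K \<subseteq> U \<Longrightarrow> uniform_limit K (h2 \<circ> r2) h' sequentially"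
        using nU unfolding normal_on_def by meson
      have "uniform_limit K (h \<circ> (r \<circ> r2)) (h' \<circ> ?g) sequentially" if K: "compact K" "K \<subseteq> ?g -` U" for K
      proof -
        have "compact (?g ` K)" using K(1) cont by (intro compact_continuous_image) (auto intro: continuous_on_subset)
        then have "uniform_limit (?g ` K) (h2 \<circ> r2) h' sequentially" using K by (intro r2(2)) auto
        then have "uniform_limit K (\<lambda>n x. (h2 \<circ> r2) n (?g x)) (\<lambda>x. h' (?g x)) sequentially"
          unfolding uniform_limit_iff by (auto elim!: eventually_mono)
        moreover have "(\<lambda>n x. (h2 \<circ> r2) n (?g x)) = h \<circ> (r \<circ> r2)"
          by (auto simp: fun_eq_iff h2_def N fibre_iter_shift simp del: fibre_iter.simps)
        ultimately show ?thesis by (simp add: o_def)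
      qed
      then show ?thesis using strict_mono_o[OF r(1) r2(1)] by blast
    qed
  qed
  moreover have "open (?g -` U)" using cont U(1) by (simp add: continuous_on_open_vimage)
  ultimately show False using z U(2) unfolding fibre_Julia_def Julia_def by blast
qed

text \<open>A symbol is locally constant on the shift space.\<close>

lemma continuous_symbol_dependent:
  fixes g :: "nat \<Rightarrow> rsphere \<Rightarrow> 'b::topological_space"
  assumes g: "\<And>j. j \<in> {1..m} \<Longrightarrow> continuous_on UNIV (g j)"
  shows "continuous_on (Sigma_shift m \<times> UNIV) (\<lambda>p. g (fst p 1) (snd p))"
proof -
  have sym: "open {p :: (int \<Rightarrow> nat) \<times> rsphere. fst p 1 = j}" for j
  proof -
    have "continuous_on UNIV (\<lambda>p :: (int \<Rightarrow> nat) \<times> rsphere. fst p 1)"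
      by (rule continuous_on_product_then_coordinatewise[OF continuous_on_fst[OF continuous_on_id]])
    moreover have "open {j}" by (rule discrete_topology_class.open_discrete)
    ultimately have "open ((\<lambda>p :: (int \<Rightarrow> nat) \<times> rsphere. fst p 1) -` {j})"
      by (simp add: continuous_on_open_vimage)
    then show ?thesis by (simp add: vimage_def)
  qed
  show ?thesis
    unfolding continuous_on_def
  proof
    fix p :: "(int \<Rightarrow> nat) \<times> rsphere" assume p: "p \<in> Sigma_shift m \<times> UNIV"
    define j where "j = fst p 1"
    have j: "j \<in> {1..m}" using p by (auto simp: j_def Sigma_shift_def)
    have "isCont (g j) (snd p)" using g[OF j] by (simp add: continuous_on_eq_continuous_at)
    then have "((\<lambda>q. g j (snd q)) \<longlongrightarrow> g j (snd p)) (at p within Sigma_shift m \<times> UNIV)"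
      by (rule isCont_tendsto_compose) (intro tendsto_intros)
    moreover have "\<forall>\<^sub>F q in at p within Sigma_shift m \<times> UNIV. g j (snd q) = g (fst q 1) (snd q)"
    proof -
      have "\<forall>\<^sub>F q in nhds p. fst q 1 = j" using sym[of j] by (auto simp: eventually_nhds j_def)
      then show ?thesis unfolding eventually_at_filter by eventually_elim simp
    qed
    ultimately show "((\<lambda>p. g (fst p 1) (snd p)) \<longlongrightarrow> g (fst p 1) (snd p)) (at p within Sigma_shift m \<times> UNIV)"
      unfolding j_def[symmetric] by (rule Lim_transform_eventually)
  qed
qed

lemma continuous_skew:
  assumes "\<And>j. j \<in> {1..m} \<Longrightarrow> continuous_on UNIV (f j)"
  shows "continuous_on (Sigma_shift m \<times> UNIV) (skew f)"
proof -
  have "continuous_on (Sigma_shift m \<times> UNIV) (\<lambda>p :: (int \<Rightarrow> nat) \<times> rsphere. shift (fst p))"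
    unfolding shift_def
    by (rule continuous_on_coordinatewise_then_product,
        rule continuous_on_product_then_coordinatewise[OF continuous_on_fst[OF continuous_on_id]])
  then have "continuous_on (Sigma_shift m \<times> UNIV) (\<lambda>p. (shift (fst p), f (fst p 1) (snd p)))"
    by (rule continuous_on_Pair) (rule continuous_symbol_dependent[OF assms])
  then show ?thesis by (simp add: skew_def case_prod_unfold)
qed

lemma skew_Julia_forward:
  assumes cont: "\<And>j. j \<in> {1..m} \<Longrightarrow> continuous_on UNIV (f j)"
    and sub: "skew_Julia m f \<subseteq> Sigma_shift m \<times> UNIV"
  shows "skew f ` skew_Julia m f \<subseteq> skew_Julia m f"
  unfolding skew_Julia_def
proof (rule image_closure_subset)
  show "continuous_on (closure (\<Union>\<omega>\<in>Sigma_shift m. {\<omega>} \<times> fibre_Julia f \<omega>)) (skew f)"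
    using continuous_skew[OF cont] sub unfolding skew_Julia_def by (rule continuous_on_subset)
  show "skew f ` (\<Union>\<omega>\<in>Sigma_shift m. {\<omega>} \<times> fibre_Julia f \<omega>) \<subseteq> closure (\<Union>\<omega>\<in>Sigma_shift m. {\<omega>} \<times> fibre_Julia f \<omega>)"
  proof
    fix p assume "p \<in> skew f ` (\<Union>\<omega>\<in>Sigma_shift m. {\<omega>} \<times> fibre_Julia f \<omega>)"
    then obtain \<omega> z where w: "\<omega> \<in> Sigma_shift m" "z \<in> fibre_Julia f \<omega>" "p = (shift \<omega>, f (\<omega> 1) z)"
      by (auto simp: skew_def)
    have "\<omega> 1 \<in> {1..m}" using w(1) by (auto simp: Sigma_shift_def)
    then have "f (\<omega> 1) z \<in> fibre_Julia f (shift \<omega>)" using fibre_Julia_forward[of f \<omega> z] cont w(2) by blast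
    then have "p \<in> (\<Union>\<omega>\<in>Sigma_shift m. {\<omega>} \<times> fibre_Julia f \<omega>)" using w shift_in_Sigma by blast
    then show "p \<in> closure (\<Union>\<omega>\<in>Sigma_shift m. {\<omega>} \<times> fibre_Julia f \<omega>)" by (rule subsetD[OF closure_subset])
  qed
qed simp

text \<open>The atoms of the partition determine the branch, and \<open>uniform_distortion\<close> on the compact set \<open>K\<close> of
  an atom gives the distortion estimate. They also show that the Julia set of the skew product lies
  over the symbols in \<open>{1..m}\<close>, where the skew product is continuous.\<close>

lemma skew_expanding_factor:
  fixes \<mu> :: "((int \<Rightarrow> nat) \<times> rsphere) measure"
  assumes rat: "\<And>j. j \<in> {1..m} \<Longrightarrow> rational_map (f j)"
    and exp: "expanding m f"
    and sets_\<mu>: "sets \<mu> = sets (restrict_space borel (skew_Julia m f))"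
    and inv: "invariant_prob \<mu> (skew f)"
    and ad: "Pi_adapted m f \<R>"
  shows "\<exists>C L Dmax. expanding_factor \<mu> (skew f) (\<lambda>x. stereo (snd x)) \<R> (skew_deriv_norm f 1) C L Dmax"
proof -
  let ?J = "skew_Julia m f" and ?D = "skew_deriv_norm f 1" and ?s = "\<lambda>x :: (int \<Rightarrow> nat) \<times> rsphere. stereo (snd x)"
  interpret prob_space \<mu> using inv by (simp add: invariant_prob_def)
  have cont: "continuous_on UNIV (f j)" "continuous_on UNIV (sph_deriv_norm (f j))" if "j \<in> {1..m}" for j
    using strict_conformal_continuous[OF rational_chart_diff(2)[OF rat[OF that]]] by auto
  have space: "space \<mu> = ?J" using sets_eq_imp_space_eq[OF sets_\<mu>] by (simp add: space_restrict_space)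
  have \<R>: "finite \<R>" "partition_on ?J \<R>" "\<R> \<subseteq> sets borel"
    and adR: "\<And>R. R \<in> \<R> \<Longrightarrow> \<exists>j\<in>{1..m}. \<exists>K U. compact K \<and> open U \<and>
        R \<subseteq> ?J \<inter> ({\<omega> \<in> Sigma_shift m. \<omega> 1 = j} \<times> K) \<and> K \<subseteq> U \<and> inj_on (f j) U"
    using ad by (auto simp: Pi_adapted_def)
  have ex\<R>: "\<exists>R\<in>\<R>. x \<in> R" if "x \<in> ?J" for x using partition_onD1[OF \<R>(2)] that by auto
  have sub: "?J \<subseteq> Sigma_shift m \<times> UNIV"
  proof
    fix x assume "x \<in> ?J"
    then obtain R where R: "R \<in> \<R>" "x \<in> R" using ex\<R> by blast
    then show "x \<in> Sigma_shift m \<times> UNIV" using adR[OF R(1)] by auto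
  qed
  have TJ: "skew f ` ?J \<subseteq> ?J" by (rule skew_Julia_forward[OF cont(1) sub])
  have mcong: "measurable \<mu> N = measurable (restrict_space borel ?J) N" for N :: "'z measure"
    by (rule measurable_cong_sets[OF sets_\<mu> refl])
  have T: "skew f \<in> measurable \<mu> \<mu>"
  proof -
    have "skew f \<in> borel_measurable (restrict_space borel ?J)"
      by (rule borel_measurable_continuous_on_restrict[OF continuous_on_subset[OF continuous_skew[OF cont(1)] sub]])
    then have "skew f \<in> measurable (restrict_space borel ?J) (restrict_space borel ?J)"
      using TJ by (intro measurable_restrict_space2) (auto simp: space_restrict_space)
    then show ?thesis by (simp only: measurable_cong_sets[OF sets_\<mu> sets_\<mu>])
  qed
  have s: "?s \<in> borel_measurable \<mu>"
    unfolding mcong by (intro borel_measurable_continuous_on_restrict continuous_on_compose2[OF continuous_stereo[of UNIV]] continuous_intros) auto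
  have D: "?D \<in> borel_measurable \<mu>"
  proof -
    have "continuous_on (Sigma_shift m \<times> UNIV) (\<lambda>p. sph_deriv_norm (f (fst p 1)) (snd p))"
      by (rule continuous_symbol_dependent[of m "\<lambda>j. sph_deriv_norm (f j)"]) (rule cont(2))
    moreover have "?D = (\<lambda>p. sph_deriv_norm (f (fst p 1)) (snd p))"
      by (auto simp: fun_eq_iff skew_deriv_norm_def)
    ultimately have "continuous_on ?J ?D" using sub by (simp only: continuous_on_subset)
    then show ?thesis unfolding mcong by (rule borel_measurable_continuous_on_restrict)
  qed
  obtain C L where CL: "0 < C" "1 < L" and grow: "\<And>n x. 1 \<le> n \<Longrightarrow> x \<in> ?J \<Longrightarrow> C * L ^ n \<le> skew_deriv_norm f n x"
    using exp by (auto simp: expanding_def)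
  have D1: "C * L \<le> ?D x" if "x \<in> ?J" for x using grow[of 1 x] that by simp
  have "\<exists>b. \<forall>x\<in>R. ?D x \<le> b" if R: "R \<in> \<R>" for R
  proof -
    obtain j K where jK: "j \<in> {1..m}" "compact K" "R \<subseteq> {\<omega> \<in> Sigma_shift m. \<omega> 1 = j} \<times> K"
      using adR[OF R] by blast
    have "compact (sph_deriv_norm (f j) ` K)"
      using jK by (intro compact_continuous_image continuous_on_subset[OF cont(2)]) auto
    then have "bounded (sph_deriv_norm (f j) ` K)" by (rule compact_imp_bounded)
    then obtain b where "\<And>z. z \<in> K \<Longrightarrow> norm (sph_deriv_norm (f j) z) \<le> b" by (auto simp: bounded_iff)
    then have "\<forall>x\<in>R. ?D x \<le> b" using jK(3) by (fastforce simp: skew_deriv_norm_def abs_le_iff)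
    then show ?thesis ..
  qed
  then have "\<forall>R\<in>\<R>. \<exists>b. \<forall>x\<in>R. ?D x \<le> b" by blast
  from bchoice[OF this] obtain b where b: "\<forall>R\<in>\<R>. \<forall>x\<in>R. ?D x \<le> b R" by blast
  define Dmax where "Dmax = Max (b ` \<R>)"
  have Dmax: "?D x \<le> Dmax" if x: "x \<in> ?J" for x
  proof -
    obtain R where R: "R \<in> \<R>" "x \<in> R" using ex\<R>[OF x] by blast
    have "b R \<le> Dmax" unfolding Dmax_def using \<R>(1) R(1) by (intro Max_ge) auto
    then show ?thesis using b R by force
  qed
  have dist: "\<exists>\<delta>>0. \<forall>A\<in>\<R>. near_similarity \<epsilon> \<delta> ?s (skew f) ?D A" if \<epsilon>: "0 < \<epsilon>" for \<epsilon>
  proof -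
    have "\<forall>A\<in>\<R>. \<exists>\<delta>>0. near_similarity \<epsilon> \<delta> ?s (skew f) ?D A"
    proof
      fix R assume R: "R \<in> \<R>"
      obtain j K U where jK: "j \<in> {1..m}" "compact K" "K \<subseteq> U" "inj_on (f j) U"
        "R \<subseteq> ?J \<inter> ({\<omega> \<in> Sigma_shift m. \<omega> 1 = j} \<times> K)"
        using adR[OF R] by blast
      have Rx: "x \<in> ?J" "fst x 1 = j" "snd x \<in> K" if "x \<in> R" for x using jK(5) that by auto
      have Dx: "?D x = sph_deriv_norm (f j) (snd x)" "?s (skew f x) = stereo (f j (snd x))" if "x \<in> R" for x
        using Rx(2)[OF that] by (cases x; simp add: skew_deriv_norm_def skew_def)+
      have "0 < C * L" using CL by simp
      moreover have "C * L \<le> sph_deriv_norm (f j) z" if "z \<in> snd ` R" for z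
        using that D1 Rx(1) Dx(1) by (metis (no_types, lifting) imageE)
      moreover have "snd ` R \<subseteq> K" using Rx(3) by blast
      moreover have "inj_on (f j) K" using jK(3,4) by (rule inj_on_subset[rotated])
      ultimately obtain \<delta> where \<delta>: "0 < \<delta>" "near_similarity \<epsilon> \<delta> stereo (f j) (sph_deriv_norm (f j)) (snd ` R)"
        using uniform_distortion[OF rational_chart_diff(2)[OF rat[OF jK(1)]] jK(2) _ _ _ _ \<epsilon>, of "snd ` R" "C * L"] by blast
      have "near_similarity \<epsilon> \<delta> ?s (skew f) ?D R"
        using \<delta>(2) unfolding near_similarity_def ball_simps by (simp add: Dx del: One_nat_def)
      then show "\<exists>\<delta>>0. near_similarity \<epsilon> \<delta> ?s (skew f) ?D R" using \<delta>(1) by blast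
    qed
    from bchoice[OF this] obtain \<delta> where \<delta>: "\<forall>A\<in>\<R>. 0 < \<delta> A \<and> near_similarity \<epsilon> (\<delta> A) ?s (skew f) ?D A" ..
    define \<delta>0 where "\<delta>0 = Min (insert 1 (\<delta> ` \<R>))"
    have "0 < \<delta>0" unfolding \<delta>0_def using \<R>(1) \<delta> by (subst Min_gr_iff) auto
    moreover have "\<delta>0 \<le> \<delta> A" if "A \<in> \<R>" for A unfolding \<delta>0_def using \<R>(1) that by (intro Min_le) auto
    then have "near_similarity \<epsilon> \<delta>0 ?s (skew f) ?D A" if "A \<in> \<R>" for A
      using \<delta> that unfolding near_similarity_def by (meson less_le_trans)
    ultimately show ?thesis by blast
  qed
  have "expanding_factor \<mu> (skew f) ?s \<R> ?D C L Dmax"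
  proof
    show "distr \<mu> \<mu> (skew f) = \<mu>" using inv by (simp add: invariant_prob_def)
    show "bounded (?s ` space \<mu>)" by (intro boundedI[of _ 1]) auto
    show "partition_on (space \<mu>) \<R>" using \<R>(2) by (simp add: space)
    show "\<R> \<subseteq> sets \<mu>"
    proof
      fix R assume R: "R \<in> \<R>"
      then have "R = ?J \<inter> R" "R \<in> sets borel" using partition_onD1[OF \<R>(2)] \<R>(3) by auto
      then show "R \<in> sets \<mu>" unfolding sets_\<mu> sets_restrict_space by blast
    qed
    show "C * L ^ n \<le> (\<Prod>k<n. ?D ((skew f ^^ k) x))" if x: "x \<in> space \<mu>" and n: "1 \<le> n" for x n
    proof -
      obtain \<omega> z where xz: "x = (\<omega>, z)" by (cases x)
      then have "\<omega> \<in> Sigma_shift m" using x sub by (auto simp: space)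
      then have eq: "skew_deriv_norm f n x = (\<Prod>k<n. ?D ((skew f ^^ k) x))"
        unfolding xz by (intro skew_deriv_norm_prod[OF rat])
      have "C * L ^ n \<le> skew_deriv_norm f n x" using grow[OF n] x unfolding space .
      then show ?thesis unfolding eq .
    qed
  qed (use T s \<R>(1) D CL Dmax dist space in auto)
  then show ?thesis by blast
qed

lemma vimage_algebra_cong_collection:
  assumes "{f -` A \<inter> X | A. A \<in> sets M} = {g -` A \<inter> X | A. A \<in> sets N}"
  shows "vimage_algebra X f M = vimage_algebra X g N"
  using assms by (simp add: vimage_algebra_def)

theorem theoremB:
  fixes m :: nat
    and f :: "nat \<Rightarrow> rsphere \<Rightarrow> rsphere"
    and \<mu> :: "((int \<Rightarrow> nat) \<times> rsphere) measure"
    and \<R> :: "((int \<Rightarrow> nat) \<times> rsphere) set set"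
  assumes "1 \<le> m"
    and "\<And>j. j \<in> {1..m} \<Longrightarrow> rational_map (f j) \<and> \<not> f j constant_on UNIV"
    and "expanding m f"
    and "sets \<mu> = sets (restrict_space borel (skew_Julia m f))"
    and "invariant_prob \<mu> (skew f)"
    and "Pi_adapted m f \<R>"
  shows
    "(AE x in \<mu>. ((\<lambda>r. ln (measure \<mu> (Pi_ball m f x r)) / ln r) \<longlongrightarrow>
        local_proj_entropy f \<mu> \<R> x /
        real_cond_exp \<mu> (invariant_sets \<mu> (skew f)) (\<lambda>y. ln (skew_deriv_norm f 1 y)) x)
        (at_right 0)) \<and>
     (ergodic \<mu> (skew f) \<longrightarrow>
        (AE x in \<mu>. ((\<lambda>r. ln (measure \<mu> (Pi_ball m f x r)) / ln r) \<longlongrightarrow>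
          proj_entropy f \<mu> \<R> / (\<integral>y. ln (skew_deriv_norm f 1 y) \<partial>\<mu>)) (at_right 0))) \<and>
     (ergodic \<mu> (skew f) \<longrightarrow> exact_dimensional (distr \<mu> borel snd))"
proof -
  let ?s = "\<lambda>x :: (int \<Rightarrow> nat) \<times> rsphere. stereo (snd x)"
  have rat: "\<And>j. j \<in> {1..m} \<Longrightarrow> rational_map (f j)" using assms(2) by blast
  obtain C L Dmax where ef: "expanding_factor \<mu> (skew f) ?s \<R> (skew_deriv_norm f 1) C L Dmax"
    using skew_expanding_factor[OF rat assms(3-6)] by blast
  interpret E: expanding_factor \<mu> "skew f" ?s \<R> "skew_deriv_norm f 1" C L Dmax by (rule ef)
  have space: "space \<mu> = skew_Julia m f" using sets_eq_imp_space_eq[OF assms(4)] by (simp add: space_restrict_space)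
  have P: "Pi_alg \<mu> = E.P.F"
    unfolding Pi_alg_def
  proof (rule vimage_algebra_cong_collection, intro set_eqI iffI)
    fix S assume "S \<in> {snd -` A \<inter> space \<mu> | A. A \<in> sets borel}"
    then obtain A where A: "A \<in> sets borel" "S = snd -` A \<inter> space \<mu>" by blast
    obtain B where "B \<in> sets borel" "A = stereo -` B" using borel_rsphere_vimage[OF A(1)] by blast
    then show "S \<in> {?s -` A \<inter> space \<mu> | A. A \<in> sets borel}" using A(2) by blast
  next
    fix S assume "S \<in> {?s -` A \<inter> space \<mu> | A. A \<in> sets borel}"
    then obtain B where B: "B \<in> sets borel" "S = ?s -` B \<inter> space \<mu>" by blast
    have "stereo -` B \<in> sets borel"
      using measurable_sets[OF borel_measurable_continuous_onI[OF continuous_stereo] B(1)] by simp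
    moreover have "S = snd -` (stereo -` B) \<inter> space \<mu>" using B(2) by auto
    ultimately show "S \<in> {snd -` A \<inter> space \<mu> | A. A \<in> sets borel}" by blast
  qed
  have Q: "skew_Pi_alg f \<mu> = E.Q.F"
    unfolding skew_Pi_alg_def P using E.T_space by (subst vimage_algebra_vimage_algebra_eq) auto
  have le: "local_proj_entropy f \<mu> \<R> = real_cond_exp \<mu> (invariant_sets \<mu> (skew f)) E.entropy_jump"
    unfolding local_proj_entropy_def P Q ..
  have pe: "proj_entropy f \<mu> \<R> = (\<integral>x. E.entropy_jump x \<partial>\<mu>)"
  proof -
    define \<tau> where "\<tau> N = (1/2::real) ^ N" for N
    have \<tau>: "0 < \<tau> N \<and> \<tau> N \<le> 1" "\<tau> \<longlonglongrightarrow> 0" for N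
      by (auto simp: \<tau>_def[abs_def] power_le_one intro: LIMSEQ_realpow_zero)
    show ?thesis
      unfolding proj_entropy_def cond_entropy_def P Q
      using E.P.information_limit(1)[OF E.bounded_s E.\<R> \<tau>] E.Q.information_limit(1)[OF E.bounded_sT E.\<R> \<tau>] by simp
  qed
  have ball: "\<forall>\<^sub>F r in at_right 0. Pi_ball m f x r = factor_ball \<mu> ?s x (2 * sin (r / 2))" for x
  proof -
    have "\<forall>\<^sub>F r in at_right 0. 0 < r \<and> r < pi" unfolding eventually_at_right_field by (intro exI[of _ pi]) auto
    then show ?thesis
      by eventually_elim (auto simp: Pi_ball_def factor_ball_def space dist_less_iff_chord)
  qed
  have to_ball: "((\<lambda>r. ln (measure \<mu> (Pi_ball m f x r)) / ln r) \<longlongrightarrow> d) (at_right 0)"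
    if "((\<lambda>r. ln (E.ball_mass x r) / ln r) \<longlongrightarrow> d) (at_right 0)" for x d
  proof (rule Lim_transform_eventually[OF tendsto_log_chord[OF that]])
    show "\<forall>\<^sub>F r in at_right 0. ln (E.ball_mass x (2 * sin (r / 2))) / ln r = ln (measure \<mu> (Pi_ball m f x r)) / ln r"
      using ball[of x] by eventually_elim (simp add: E.ball_mass_def)
  qed
  define d where "d = proj_entropy f \<mu> \<R> / (\<integral>y. ln (skew_deriv_norm f 1 y) \<partial>\<mu>)"
  have erg: "AE x in \<mu>. ((\<lambda>r. ln (E.ball_mass x r) / ln r) \<longlongrightarrow> d) (at_right 0)" if "ergodic \<mu> (skew f)"
    using E.local_dimension E.ergodic_cond_exp[OF that E.integrable_ln_D] E.ergodic_cond_exp[OF that E.integrable_entropy_jump]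
    by eventually_elim (simp add: d_def pe)
  have "AE x in \<mu>. ((\<lambda>r. ln (measure \<mu> (Pi_ball m f x r)) / ln r) \<longlongrightarrow>
        local_proj_entropy f \<mu> \<R> x /
        real_cond_exp \<mu> (invariant_sets \<mu> (skew f)) (\<lambda>y. ln (skew_deriv_norm f 1 y)) x) (at_right 0)"
    using E.local_dimension unfolding le by eventually_elim (rule to_ball)
  moreover have "AE x in \<mu>. ((\<lambda>r. ln (measure \<mu> (Pi_ball m f x r)) / ln r) \<longlongrightarrow> d) (at_right 0)" if "ergodic \<mu> (skew f)"
    using erg[OF that] by eventually_elim (rule to_ball)
  moreover have "exact_dimensional (distr \<mu> borel snd)" if "ergodic \<mu> (skew f)"
  proof -
    have snd [measurable]: "snd \<in> borel_measurable \<mu>"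
      unfolding measurable_cong_sets[OF assms(4) refl]
      by (intro borel_measurable_continuous_on_restrict continuous_intros)
    define \<nu> where "\<nu> = distr \<mu> borel (snd :: (int \<Rightarrow> nat) \<times> rsphere \<Rightarrow> rsphere)"
    interpret N: prob_space \<nu> unfolding \<nu>_def by (rule E.prob_space_distr) simp
    have N_sets [measurable_cong]: "sets \<nu> = sets borel" by (simp add: \<nu>_def)
    have N_space: "space \<nu> = UNIV" by (simp add: \<nu>_def)
    interpret N: euclidean_factor \<nu> stereo
      by unfold_locales (simp add: \<nu>_def borel_measurable_continuous_onI continuous_stereo)
    have mass: "measure \<nu> (factor_ball \<nu> stereo (snd x) r) = E.ball_mass x r" for x r
    proof -
      have "factor_ball \<nu> stereo (snd x) r \<in> sets borel" using factor_ball_sets[OF N.s, of "snd x" r] N_sets by simp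
      then have "measure \<nu> (factor_ball \<nu> stereo (snd x) r) = measure \<mu> (snd -` factor_ball \<nu> stereo (snd x) r \<inter> space \<mu>)"
        unfolding \<nu>_def by (intro measure_distr) auto
      also have "snd -` factor_ball \<nu> stereo (snd x) r \<inter> space \<mu> = factor_ball \<mu> ?s x r"
        by (auto simp: factor_ball_def N_space)
      finally show ?thesis by (simp add: E.ball_mass_def)
    qed
    let ?Q = "\<lambda>z. ((\<lambda>r. ln (measure \<nu> (factor_ball \<nu> stereo z r)) / ln r) \<longlongrightarrow> d) (at_right 0)"
    have "{z \<in> space borel. ?Q z} \<in> sets borel"
      using N.local_dimension_set_measurable[of d] by (simp add: N_sets N_space)
    then have "(AE z in \<nu>. ?Q z) \<longleftrightarrow> (AE x in \<mu>. ?Q (snd x))"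
      by (subst (3) \<nu>_def) (intro AE_distr_iff; simp)
    then have AEQ: "AE z in \<nu>. ?Q z" using erg[OF that] by (simp add: mass)
    have conv: "((\<lambda>r. ln (measure \<nu> (ball z r)) / ln r) \<longlongrightarrow> d) (at_right 0)" if "?Q z" for z
    proof (rule Lim_transform_eventually[OF tendsto_log_chord[OF that]])
      have "\<forall>\<^sub>F r in at_right 0. 0 < r \<and> r < pi" unfolding eventually_at_right_field by (intro exI[of _ pi]) auto
      then show "\<forall>\<^sub>F r in at_right 0. ln (measure \<nu> (factor_ball \<nu> stereo z (2 * sin (r / 2)))) / ln r = ln (measure \<nu> (ball z r)) / ln r"
      proof eventually_elim
        case (elim r)
        have "factor_ball \<nu> stereo z (2 * sin (r / 2)) = ball z r"
        proof (rule set_eqI)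
          fix y
          have "dist z y < r \<longleftrightarrow> dist (stereo y) (stereo z) < 2 * sin (r / 2)"
            using dist_less_iff_chord[of r z y] elim by (simp add: dist_commute)
          then show "y \<in> factor_ball \<nu> stereo z (2 * sin (r / 2)) \<longleftrightarrow> y \<in> ball z r"
            by (simp only: factor_ball_def N_space mem_Collect_eq mem_ball UNIV_I simp_thms)
        qed
        then show ?case by simp
      qed
    qed
    have AEd: "AE z in \<nu>. ((\<lambda>r. ln (measure \<nu> (ball z r)) / ln r) \<longlongrightarrow> d) (at_right 0)"
      using AEQ by eventually_elim (rule conv)
    have "\<exists>z. ((\<lambda>r. ln (measure \<nu> (ball z r)) / ln r) \<longlongrightarrow> d) (at_right 0)"
      by (rule eventually_happens'[OF N.ae_filter_bot AEd])
    then obtain z where z: "((\<lambda>r. ln (measure \<nu> (ball z r)) / ln r) \<longlongrightarrow> d) (at_right 0)" ..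
    have "0 \<le> d"
    proof (rule tendsto_lowerbound[OF z])
      have "\<forall>\<^sub>F r::real in at_right 0. 0 < r \<and> r < 1" unfolding eventually_at_right_field by (intro exI[of _ 1]) auto
      then show "\<forall>\<^sub>F r in at_right 0. 0 \<le> ln (measure \<nu> (ball z r)) / ln r"
      proof eventually_elim
        case (elim r)
        have "ln (measure \<nu> (ball z r)) \<le> 0" by (cases "measure \<nu> (ball z r) = 0") (auto simp: zero_less_measure_iff)
        then show ?case using elim by (intro divide_nonpos_neg) auto
      qed
    qed simp
    then show ?thesis unfolding exact_dimensional_def \<nu>_def[symmetric] using AEd by blast
  qed
  ultimately show ?thesis unfolding d_def by blast
qed

end
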